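(* Let $I\subset\mathbb{R}$ be an open interval, $(F,g_F)$ a pseudo-Riemannian manifold with $\dim F=l$, $f:I\to(0,\infty)$ smooth, and let $M=I\times F$ carry the metric $g=-dt^2+f(t)^2g_F$. Let $\lambda_1,\lambda_2$ be nonzero real constants, $P=\frac{\partial}{\partial t}$, and let $\overline\nabla$ be the quarter-symmetric connection on $M$ determined by $P,\lambda_1,\lambda_2$. Then $(M,\overline\nabla)$ has constant scalar curvature $\overline S$ if and only if $(F,\nabla^F)$ has constant scalar curvature $S^F$ and $$\overline S=\frac{S^F}{f^2}-2l\frac{f''}{f}-l(l-1)\frac{(f')^2}{f^2}+l^2(\lambda_1+\lambda_2)\frac{f'}{f}+l[\lambda_1^2+\lambda_2^2-(l+1)\lambda_1\lambda_2].$$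
   Context: On a pseudo-Riemannian manifold $(M,g)$ with Levi-Civita connection $\nabla$, a vector field $P$, the 1-form $\pi(X)=g(X,P)$ and nonzero real constants $\lambda_1,\lambda_2$, the quarter-symmetric connection is $\overline\nabla_XY=\nabla_XY+\lambda_1\pi(Y)X-\lambda_2g(X,Y)P$. Its curvature is $\overline R(X,Y)=\overline\nabla_X\overline\nabla_Y-\overline\nabla_Y\overline\nabla_X-\overline\nabla_{[X,Y]}$, its Ricci tensor is $\overline{Ric}(X,Y)=\sum_k\varepsilon_k\,g(\overline R(X,E_k)Y,E_k)$ and its scalar curvature is $\overline S=\sum_k\varepsilon_k\overline{Ric}(E_k,E_k)$, where $(E_k)$ is a local orthonormal frame with $g(E_k,E_k)=\varepsilon_k=\pm1$ (note the sign convention). The same formulas with the Levi-Civita connection $\nabla^F$ of $(F,g_F)$ define $Ric^F$ and $S^F$ (same sign convention). In the right-hand condition $\overline S$ denotes the given constant and the identity is required for all $t\in I$. Primes denote $d/dt$. *)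

theory Defs
  imports "HOL-Analysis.Analysis"
begin

section \<open>Smooth functions on open subsets of normed spaces\<close>

primrec times_cont_diff_on ::
    "nat \<Rightarrow> 'a::real_normed_vector set \<Rightarrow> ('a \<Rightarrow> 'b::real_normed_vector) \<Rightarrow> bool" where
  "times_cont_diff_on 0 S f \<longleftrightarrow> continuous_on S f"
| "times_cont_diff_on (Suc n) S f \<longleftrightarrow>
     (\<forall>x\<in>S. f differentiable (at x)) \<and>
     (\<forall>v. times_cont_diff_on n S (\<lambda>x. frechet_derivative f (at x) v))"

text \<open>Meant for open \<open>S\<close> and finite-dimensional domains.\<close>

definition smooth_on :: "'a::real_normed_vector set \<Rightarrow> ('a \<Rightarrow> 'b::real_normed_vector) \<Rightarrow> bool" where
  "smooth_on S f \<longleftrightarrow> (\<forall>n. times_cont_diff_on n S f)"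


section \<open>Smooth manifolds\<close>

text \<open>
  A manifold modelled on the Euclidean space \<open>'e\<close> (so of dimension \<open>DIM('e)\<close>) is given by an atlas;
  its underlying set is the union of the chart domains, an open subset of the
  Hausdorff, second countable space \<open>'a\<close>. Neither connectedness nor maximality
  of the atlas is required. A chart is a domain together with a coordinate map whose values
  outside the domain are irrelevant.
\<close>

type_synonym ('a, 'e) chart = "'a set \<times> ('a \<Rightarrow> 'e)"

definition carrier_of :: "('a, 'e) chart set \<Rightarrow> 'a set" where
  "carrier_of A = (\<Union>(U, \<phi>)\<in>A. U)"

definition smooth_manifold ::
    "('a::{t2_space, second_countable_topology}, 'e::euclidean_space) chart set \<Rightarrow> bool" where
  "smooth_manifold A \<longleftrightarrow>
     carrier_of A \<noteq> {} \<and>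
     (\<forall>(U, \<phi>)\<in>A. open U \<and> open (\<phi> ` U) \<and> (\<exists>\<psi>. homeomorphism U (\<phi> ` U) \<phi> \<psi>)) \<and>
     (\<forall>(U, \<phi>)\<in>A. \<forall>(V, \<psi>)\<in>A. smooth_on (\<phi> ` (U \<inter> V)) (\<lambda>x. \<psi> (inv_into U \<phi> x)))"

definition smooth_fun_on ::
    "('a::topological_space, 'e::euclidean_space) chart set \<Rightarrow> 'a set \<Rightarrow> ('a \<Rightarrow> real) \<Rightarrow> bool" where
  "smooth_fun_on A W h \<longleftrightarrow> (\<forall>(U, \<phi>)\<in>A. smooth_on (\<phi> ` (U \<inter> W)) (\<lambda>x. h (inv_into U \<phi> x)))"

definition smooth_near ::
    "('a::topological_space, 'e::euclidean_space) chart set \<Rightarrow> 'a \<Rightarrow> ('a \<Rightarrow> real) \<Rightarrow> bool" where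
  "smooth_near A p h \<longleftrightarrow> (\<exists>W. open W \<and> p \<in> W \<and> W \<subseteq> carrier_of A \<and> smooth_fun_on A W h)"


section \<open>Tangent vectors and vector fields\<close>

text \<open>
  A tangent vector at \<open>p\<close> is a directional derivative acting on the functions that are smooth near
  \<open>p\<close>. It is set to \<open>0\<close> on all other functions, so that it is determined
  by its action on smooth germs and equality of tangent vectors is equality of functionals.
\<close>

type_synonym 'a tangent_vector = "('a \<Rightarrow> real) \<Rightarrow> real"
type_synonym 'a vector_field = "'a \<Rightarrow> 'a tangent_vector"
type_synonym 'a metric_tensor = "'a \<Rightarrow> 'a tangent_vector \<Rightarrow> 'a tangent_vector \<Rightarrow> real"
type_synonym 'a connection = "'a vector_field \<Rightarrow> 'a vector_field \<Rightarrow> 'a vector_field"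

definition coordinate_vector ::
    "('a::topological_space, 'e::euclidean_space) chart set \<Rightarrow> ('a, 'e) chart \<Rightarrow> 'a \<Rightarrow> 'e
      \<Rightarrow> 'a tangent_vector" where
  "coordinate_vector A c p u = (\<lambda>h.
     if smooth_near A p h
     then frechet_derivative (\<lambda>x. h (inv_into (fst c) (snd c) x)) (at (snd c p)) u
     else 0)"

definition tangent_space ::
    "('a::topological_space, 'e::euclidean_space) chart set \<Rightarrow> 'a \<Rightarrow> 'a tangent_vector set" where
  "tangent_space A p = {coordinate_vector A c p u | c u. c \<in> A \<and> p \<in> fst c}"

definition pushforward ::
    "('b::topological_space, 'e::euclidean_space) chart set \<Rightarrow> ('a \<Rightarrow> 'b) \<Rightarrow> 'a
      \<Rightarrow> 'a tangent_vector \<Rightarrow> 'b tangent_vector" where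
  "pushforward B F p v = (\<lambda>h. if smooth_near B (F p) h then v (\<lambda>q. h (F q)) else 0)"

text \<open>The smooth vector fields on an open set \<open>W\<close>; their values outside \<open>W\<close> are irrelevant.\<close>

definition vector_fields ::
    "('a::topological_space, 'e::euclidean_space) chart set \<Rightarrow> 'a set \<Rightarrow> 'a vector_field set" where
  "vector_fields A W = {X.
     (\<forall>p\<in>W. X p \<in> tangent_space A p) \<and>
     (\<forall>V h. open V \<longrightarrow> V \<subseteq> W \<longrightarrow> smooth_fun_on A V h \<longrightarrow> smooth_fun_on A V (\<lambda>p. X p h))}"

definition vf_add :: "'a vector_field \<Rightarrow> 'a vector_field \<Rightarrow> 'a vector_field" where
  "vf_add X Y = (\<lambda>p h. X p h + Y p h)"

definition vf_scale :: "('a \<Rightarrow> real) \<Rightarrow> 'a vector_field \<Rightarrow> 'a vector_field" where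
  "vf_scale k X = (\<lambda>p h. k p * X p h)"

text \<open>
  Without the case distinction the bracket need not vanish on functions that fail to be smooth near
  \<open>p\<close>: for such \<open>h\<close> the function \<open>\<lambda>q. Y q h\<close> can still happen to be smooth near \<open>p\<close>.
\<close>

definition lie_bracket ::
    "('a::topological_space, 'e::euclidean_space) chart set \<Rightarrow> 'a vector_field \<Rightarrow> 'a vector_field
      \<Rightarrow> 'a vector_field" where
  "lie_bracket A X Y = (\<lambda>p h.
     if smooth_near A p h then X p (\<lambda>q. Y q h) - Y p (\<lambda>q. X q h) else 0)"


section \<open>Pseudo-Riemannian metrics and connections\<close>

text \<open>Constancy of the index is not demanded; on connected components it is automatic.\<close>

definition pseudo_riemannian ::
    "('a::topological_space, 'e::euclidean_space) chart set \<Rightarrow> 'a metric_tensor \<Rightarrow> bool" where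
  "pseudo_riemannian A g \<longleftrightarrow>
     (\<forall>p\<in>carrier_of A.
        (\<forall>u\<in>tangent_space A p. \<forall>v\<in>tangent_space A p. g p u v = g p v u) \<and>
        (\<forall>u\<in>tangent_space A p. \<forall>v\<in>tangent_space A p. \<forall>w\<in>tangent_space A p. \<forall>a b.
           g p (\<lambda>h. a * u h + b * v h) w = a * g p u w + b * g p v w) \<and>
        (\<forall>u\<in>tangent_space A p. (\<forall>v\<in>tangent_space A p. g p u v = 0) \<longrightarrow> u = (\<lambda>h. 0))) \<and>
     (\<forall>W. open W \<longrightarrow> W \<subseteq> carrier_of A \<longrightarrow>
        (\<forall>X\<in>vector_fields A W. \<forall>Y\<in>vector_fields A W.
           smooth_fun_on A W (\<lambda>p. g p (X p) (Y p))))"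

text \<open>
  A connection is a single operator that acts on the vector fields of every open set \<open>W\<close>
  of the manifold, so that it can be applied to local frames. The second clause makes the
  result on \<open>W\<close> depend only on the arguments restricted to \<open>W\<close>, and thereby
  compatible with restriction to smaller open sets.
\<close>

definition affine_connection ::
    "('a::topological_space, 'e::euclidean_space) chart set \<Rightarrow> 'a connection \<Rightarrow> bool" where
  "affine_connection A nab \<longleftrightarrow>
     (\<forall>W. open W \<longrightarrow> W \<subseteq> carrier_of A \<longrightarrow>
       (\<forall>X\<in>vector_fields A W. \<forall>Y\<in>vector_fields A W.
          nab X Y \<in> vector_fields A W \<and>
          (\<forall>X'\<in>vector_fields A W. \<forall>Y'\<in>vector_fields A W.
             (\<forall>p\<in>W. X' p = X p \<and> Y' p = Y p) \<longrightarrow> (\<forall>p\<in>W. nab X' Y' p = nab X Y p)) \<and>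
          (\<forall>Z\<in>vector_fields A W. \<forall>p\<in>W.
             nab (vf_add X Z) Y p = vf_add (nab X Y) (nab Z Y) p \<and>
             nab X (vf_add Y Z) p = vf_add (nab X Y) (nab X Z) p) \<and>
          (\<forall>k. smooth_fun_on A W k \<longrightarrow> (\<forall>p\<in>W.
             nab (vf_scale k X) Y p = vf_scale k (nab X Y) p \<and>
             nab X (vf_scale k Y) p
               = vf_add (vf_scale (\<lambda>q. X q k) Y) (vf_scale k (nab X Y)) p))))"

definition levi_civita ::
    "('a::topological_space, 'e::euclidean_space) chart set \<Rightarrow> 'a metric_tensor
      \<Rightarrow> 'a connection \<Rightarrow> bool" where
  "levi_civita A g nab \<longleftrightarrow>
     affine_connection A nab \<and>
     (\<forall>W. open W \<longrightarrow> W \<subseteq> carrier_of A \<longrightarrow>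
       (\<forall>X\<in>vector_fields A W. \<forall>Y\<in>vector_fields A W. \<forall>p\<in>W.
          (\<forall>h. nab X Y p h - nab Y X p h = lie_bracket A X Y p h) \<and>
          (\<forall>Z\<in>vector_fields A W.
             X p (\<lambda>q. g q (Y q) (Z q)) = g p (nab X Y p) (Z p) + g p (Y p) (nab X Z p))))"

definition quarter_symmetric ::
    "'a metric_tensor \<Rightarrow> 'a connection \<Rightarrow> 'a vector_field \<Rightarrow> real \<Rightarrow> real \<Rightarrow> 'a connection" where
  "quarter_symmetric g nab P a b = (\<lambda>X Y p h.
     nab X Y p h + a * g p (Y p) (P p) * X p h - b * g p (X p) (Y p) * P p h)"


section \<open>Curvature\<close>

definition curvature ::
    "('a::topological_space, 'e::euclidean_space) chart set \<Rightarrow> 'a connection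
      \<Rightarrow> 'a vector_field \<Rightarrow> 'a vector_field \<Rightarrow> 'a vector_field \<Rightarrow> 'a vector_field" where
  "curvature A nab X Y Z = (\<lambda>p h.
     nab X (nab Y Z) p h - nab Y (nab X Z) p h - nab (lie_bracket A X Y) Z p h)"

definition orthonormal_frame_on ::
    "('a::topological_space, 'e::euclidean_space) chart set \<Rightarrow> 'a metric_tensor \<Rightarrow> 'a set
      \<Rightarrow> (nat \<Rightarrow> 'a vector_field) \<Rightarrow> (nat \<Rightarrow> real) \<Rightarrow> bool" where
  "orthonormal_frame_on A g W E \<epsilon> \<longleftrightarrow>
     (\<forall>i<DIM('e). E i \<in> vector_fields A W \<and> \<epsilon> i \<in> {-1, 1} \<and>
        (\<forall>j<DIM('e). \<forall>p\<in>W. g p (E i p) (E j p) = (if i = j then \<epsilon> i else 0)))"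

text \<open>
  An arbitrary choice of an orthonormal frame on some neighbourhood of \<open>p\<close>. The traces below do
  not depend on it.
\<close>

definition local_frame ::
    "('a::topological_space, 'e::euclidean_space) chart set \<Rightarrow> 'a metric_tensor \<Rightarrow> 'a
      \<Rightarrow> (nat \<Rightarrow> 'a vector_field) \<times> (nat \<Rightarrow> real)" where
  "local_frame A g p = (SOME (E, \<epsilon>). \<exists>W. open W \<and> p \<in> W \<and> W \<subseteq> carrier_of A \<and>
     orthonormal_frame_on A g W E \<epsilon>)"

text \<open>Sign convention: the round unit sphere \<open>S\<^sup>n\<close> gets \<open>Ric = -(n - 1) g\<close> with these formulas.\<close>

definition ricci ::
    "('a::topological_space, 'e::euclidean_space) chart set \<Rightarrow> 'a metric_tensor \<Rightarrow> 'a connection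
      \<Rightarrow> 'a vector_field \<Rightarrow> 'a vector_field \<Rightarrow> 'a \<Rightarrow> real" where
  "ricci A g nab X Y p = (let (E, \<epsilon>) = local_frame A g p in
     \<Sum>k<DIM('e). \<epsilon> k * g p (curvature A nab X (E k) Y p) (E k p))"

definition scalar_curvature ::
    "('a::topological_space, 'e::euclidean_space) chart set \<Rightarrow> 'a metric_tensor \<Rightarrow> 'a connection
      \<Rightarrow> 'a \<Rightarrow> real" where
  "scalar_curvature A g nab p = (let (E, \<epsilon>) = local_frame A g p in
     \<Sum>k<DIM('e). \<epsilon> k * ricci A g nab (E k) (E k) p)"

definition has_constant_scalar_curvature ::
    "('a::topological_space, 'e::euclidean_space) chart set \<Rightarrow> 'a metric_tensor \<Rightarrow> 'a connection
      \<Rightarrow> real \<Rightarrow> bool" where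
  "has_constant_scalar_curvature A g nab s \<longleftrightarrow> (\<forall>p\<in>carrier_of A. scalar_curvature A g nab p = s)"


section \<open>Warped products with a one-dimensional base\<close>

definition product_atlas :: "real set \<Rightarrow> ('a, 'e) chart set \<Rightarrow> (real \<times> 'a, real \<times> 'e) chart set" where
  "product_atlas I A = (\<lambda>(U, \<phi>). (I \<times> U, \<lambda>(t, p). (t, \<phi> p))) ` A"

text \<open>
  The metric \<open>- dt\<^sup>2 + f(t)\<^sup>2 g\<close> on \<open>I \<times> F\<close>: the coordinate \<open>t\<close> is the function \<open>fst\<close>, so \<open>dt(v) = v fst\<close>,
  and \<open>g\<close> is pulled back along \<open>snd\<close>.
\<close>

definition warped_metric ::
    "('a::topological_space, 'e::euclidean_space) chart set \<Rightarrow> (real \<Rightarrow> real) \<Rightarrow> 'a metric_tensor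
      \<Rightarrow> (real \<times> 'a) metric_tensor" where
  "warped_metric A f g = (\<lambda>q v w. - (v fst * w fst) +
     (f (fst q))\<^sup>2 * g (snd q) (pushforward A snd q v) (pushforward A snd q w))"

definition ddt ::
    "real set \<Rightarrow> ('a::topological_space, 'e::euclidean_space) chart set
      \<Rightarrow> (real \<times> 'a) vector_field" where
  "ddt I A = (\<lambda>q h.
     if smooth_near (product_atlas I A) q h then deriv (\<lambda>s. h (s, snd q)) (fst q) else 0)"

end

theory Submission
  imports Defs
begin

text \<open>
  The curvature of a connection is linear over the smooth functions in each of its arguments, so the
  double trace that defines the scalar curvature may be computed in any local orthonormal frame; such
  frames exist by an indefinite Gram-Schmidt process. On the warped product the frame is taken to be
  \<open>\<partial>\<^sub>t, X\<^sub>1 / f, \<dots>, X\<^sub>l / f\<close> for an orthonormal frame \<open>X\<^sub>i\<close> of the fibre, and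
  with \<open>H = f' / f\<close> the Koszul formula gives \<open>\<nabla>\<^bsub>\<partial>t\<^esub> \<partial>\<^sub>t = 0\<close>,
  \<open>\<nabla>\<^bsub>\<partial>t\<^esub> X = \<nabla>\<^bsub>X\<^esub> \<partial>\<^sub>t = H X\<close> and \<open>\<nabla>\<^bsub>X\<^esub> Y = \<nabla>\<^sup>F\<^bsub>X\<^esub> Y + f f' g\<^sub>F(X, Y) \<partial>\<^sub>t\<close> for lifted fields.
  The resulting scalar curvature at \<open>(t, p)\<close> is \<open>S\<^sup>F(p) / f(t)\<^sup>2\<close> plus a function of \<open>t\<close>
  alone. Fixing one \<open>t\<close> shows that it can be constant only if \<open>S\<^sup>F\<close> is.
\<close>

section \<open>Calculus of smooth functions\<close>

text \<open>\<open>scalar_curvature\<close> uses a frame picked by \<open>SOME\<close>, and the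
  picks on the product and on the fibre are unrelated; independence of the frame is what makes the
  two sides comparable at all. A connection is a global operator whose values outside
  \<open>W\<close> mean nothing, so every replacement of a field by one that agrees with it only on
  \<open>W\<close> has to go through the locality clause. The quarter-symmetric connection has
  torsion because \<open>lam1 \<noteq> 0\<close> and is not metric when
  \<open>lam1 \<noteq> lam2\<close>, so its curvature lacks the pair symmetries: the argument rests
  on tensoriality and on antisymmetry in the first two slots, and the blocks R(D, X)D and R(X, D)X
  are computed separately, with different coefficients \<kappa> and \<xi>. In indefinite signature
  Gram-Schmidt can meet null vectors; a polarization argument supplies non-null ones. The connection
  on the product is known only through its axioms and is identified by pairing its values with
  \<open>D\<close> and with lifted fields.\<close>

lemma frechet_derivative_eqI:
  "(f has_derivative f') (at x) \<Longrightarrow> frechet_derivative f (at x) v = f' v"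
  using frechet_derivative_at[of f f' x] by simp

text \<open>On an open set the two functions agree near each point, so their derivatives agree on
  \<open>S\<close> as well and the induction can pass to them.\<close>

lemma times_cont_diff_on_cong:
  assumes "open S" "\<And>x. x \<in> S \<Longrightarrow> f x = g x" "times_cont_diff_on n S f"
  shows "times_cont_diff_on n S g"
  using assms(2,3)
proof (induction n arbitrary: f g)
  case 0
  then show ?case by (auto intro: continuous_on_eq)
next
  case (Suc n)
  have "g differentiable (at x)" if "x \<in> S" for x
  proof -
    have "(f has_derivative frechet_derivative f (at x)) (at x)"
      using Suc.prems(2) that by (simp add: frechet_derivative_works[symmetric])
    then have "(g has_derivative frechet_derivative f (at x)) (at x)"
      by (rule has_derivative_transform_within_open[OF _ assms(1) that]) (use Suc.prems(1) in simp)
    then show ?thesis by (rule Derivative.differentiableI)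
  qed
  moreover have "times_cont_diff_on n S (\<lambda>x. frechet_derivative g (at x) v)" for v
  proof (rule Suc.IH)
    show "times_cont_diff_on n S (\<lambda>x. frechet_derivative f (at x) v)"
      using Suc.prems by simp
    show "frechet_derivative f (at x) v = frechet_derivative g (at x) v" if "x \<in> S" for x
      using frechet_derivative_transform_within_open[of f x S g] Suc.prems assms(1) that by auto
  qed
  ultimately show ?case by simp
qed

lemma times_cont_diff_on_SucD: "times_cont_diff_on (Suc n) S f \<Longrightarrow> times_cont_diff_on n S f"
proof (induction n arbitrary: f)
  case 0
  then show ?case
    by (simp add: continuous_at_imp_continuous_on differentiable_imp_continuous_within)
next
  case (Suc n)
  have "times_cont_diff_on n S (\<lambda>x. frechet_derivative f (at x) v)" for v
    by (rule Suc.IH) (use Suc.prems in simp)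
  moreover have "\<forall>x\<in>S. f differentiable (at x)"
    using Suc.prems by simp
  ultimately show ?case by simp
qed

lemma times_cont_diff_on_imp_continuous_on:
  "times_cont_diff_on n S f \<Longrightarrow> continuous_on S f"
proof (induction n)
  case (Suc n)
  then show ?case using times_cont_diff_on_SucD by blast
qed simp

text \<open>Derivatives are taken in the whole space and not within \<open>S\<close>, so shrinking
  \<open>S\<close> changes none of them.\<close>

lemma times_cont_diff_on_subset:
  "times_cont_diff_on n S f \<Longrightarrow> T \<subseteq> S \<Longrightarrow> times_cont_diff_on n T f"
proof (induction n arbitrary: f)
  case 0
  then show ?case using continuous_on_subset by fastforce
qed fastforce

lemma times_cont_diff_on_local:
  assumes "\<And>x. x \<in> S \<Longrightarrow> \<exists>T. open T \<and> x \<in> T \<and> times_cont_diff_on n T f"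
  shows "times_cont_diff_on n S f"
  using assms
proof (induction n arbitrary: f)
  case 0
  then show ?case
    by (metis continuous_at_imp_continuous_on continuous_on_eq_continuous_at times_cont_diff_on.simps(1))
next
  case (Suc n)
  have "times_cont_diff_on n S (\<lambda>x. frechet_derivative f (at x) v)" for v
    by (rule Suc.IH) (use Suc.prems in force)
  with Suc.prems show ?case by fastforce
qed

lemma times_cont_diff_on_const: "times_cont_diff_on n S (\<lambda>x. c)"
  by (induction n arbitrary: c) auto

lemma times_cont_diff_on_bounded_linear:
  assumes "bounded_linear L"
  shows "times_cont_diff_on n S L"
proof (cases n)
  case 0
  then show ?thesis using assms by (simp add: linear_continuous_on)
next
  case (Suc m)
  have "frechet_derivative L (at x) v = L v" for x v
    by (rule frechet_derivative_eqI[OF bounded_linear_imp_has_derivative[OF assms]])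
  then show ?thesis using assms Suc
    by (auto simp: times_cont_diff_on_const bounded_linear_imp_differentiable)
qed

lemma times_cont_diff_on_add:
  assumes "open S" "times_cont_diff_on n S f" "times_cont_diff_on n S g"
  shows "times_cont_diff_on n S (\<lambda>x. f x + g x)"
  using assms(2,3)
proof (induction n arbitrary: f g)
  case 0
  then show ?case by (simp add: continuous_on_add continuous_on_scaleR)
next
  case (Suc n)
  have "times_cont_diff_on n S (\<lambda>x. frechet_derivative (\<lambda>x. f x + g x) (at x) v)" for v
  proof (rule times_cont_diff_on_cong[OF assms(1)])
    show "times_cont_diff_on n S (\<lambda>x. frechet_derivative f (at x) v + frechet_derivative g (at x) v)"
      by (rule Suc.IH) (use Suc.prems in auto)
    show "frechet_derivative f (at x) v + frechet_derivative g (at x) v =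
      frechet_derivative (\<lambda>x. f x + g x) (at x) v" if "x \<in> S" for x
    proof -
      have "((\<lambda>x. f x + g x) has_derivative (\<lambda>v. frechet_derivative f (at x) v + frechet_derivative g (at x) v)) (at x)"
        using Suc.prems that by (intro has_derivative_add) (auto simp: frechet_derivative_works[symmetric])
      then show ?thesis by (rule frechet_derivative_eqI[symmetric])
    qed
  qed
  moreover have "(\<lambda>x. f x + g x) differentiable (at x)" if "x \<in> S" for x
    by (rule differentiable_add) (use Suc.prems that in auto)
  ultimately show ?case by simp
qed

lemma times_cont_diff_on_scaleR:
  fixes f :: "'a::real_normed_vector \<Rightarrow> real"
  assumes "open S" "times_cont_diff_on n S f" "times_cont_diff_on n S g"
  shows "times_cont_diff_on n S (\<lambda>x. f x *\<^sub>R g x)"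
  using assms(2,3)
proof (induction n arbitrary: f g)
  case 0
  then show ?case by (simp add: continuous_on_add continuous_on_scaleR)
next
  case (Suc n)
  have D: "((\<lambda>x. f x *\<^sub>R g x) has_derivative
      (\<lambda>v. f x *\<^sub>R frechet_derivative g (at x) v + frechet_derivative f (at x) v *\<^sub>R g x)) (at x)"
    if "x \<in> S" for x
    using Suc.prems that by (intro has_derivative_scaleR) (auto simp: frechet_derivative_works[symmetric])
  have "times_cont_diff_on n S (\<lambda>x. frechet_derivative (\<lambda>x. f x *\<^sub>R g x) (at x) v)" for v
  proof (rule times_cont_diff_on_cong[OF assms(1)])
    show "times_cont_diff_on n S
      (\<lambda>x. f x *\<^sub>R frechet_derivative g (at x) v + frechet_derivative f (at x) v *\<^sub>R g x)"
      using Suc.prems times_cont_diff_on_SucD[OF Suc.prems(1)] times_cont_diff_on_SucD[OF Suc.prems(2)]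
      by (intro times_cont_diff_on_add[OF assms(1)] Suc.IH) auto
    show "f x *\<^sub>R frechet_derivative g (at x) v + frechet_derivative f (at x) v *\<^sub>R g x =
      frechet_derivative (\<lambda>x. f x *\<^sub>R g x) (at x) v" if "x \<in> S" for x
      by (rule frechet_derivative_eqI[OF D[OF that], symmetric])
  qed
  moreover have "\<forall>x\<in>S. (\<lambda>x. f x *\<^sub>R g x) differentiable (at x)"
    by (intro ballI Derivative.differentiableI[OF D])
  ultimately show ?case by simp
qed

lemma times_cont_diff_on_sum:
  assumes "open S" "\<And>i. i \<in> B \<Longrightarrow> times_cont_diff_on n S (f i)"
  shows "times_cont_diff_on n S (\<lambda>x. \<Sum>i\<in>B. f i x)"
  using assms(2)
proof (induction B rule: infinite_finite_induct)
  case (insert b B)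
  then have "times_cont_diff_on n S (\<lambda>x. f b x + (\<Sum>i\<in>B. f i x))"
    by (intro times_cont_diff_on_add[OF assms(1)]) simp_all
  with insert.hyps show ?case by simp
qed (simp_all add: times_cont_diff_on_const)

lemma times_cont_diff_on_bounded_linear_comp:
  assumes "open S" "bounded_linear L" "times_cont_diff_on n S f"
  shows "times_cont_diff_on n S (\<lambda>x. L (f x))"
  using assms(3)
proof (induction n arbitrary: f)
  case 0
  then show ?case using assms(2) by (auto intro: bounded_linear.continuous_on)
next
  case (Suc n)
  have D: "((\<lambda>x. L (f x)) has_derivative (\<lambda>v. L (frechet_derivative f (at x) v))) (at x)"
    if "x \<in> S" for x
    using Suc.prems that
    by (intro bounded_linear.has_derivative[OF assms(2)]) (auto simp: frechet_derivative_works[symmetric])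
  have "times_cont_diff_on n S (\<lambda>x. frechet_derivative (\<lambda>x. L (f x)) (at x) v)" for v
  proof (rule times_cont_diff_on_cong[OF assms(1)])
    show "times_cont_diff_on n S (\<lambda>x. L (frechet_derivative f (at x) v))"
      using Suc.prems by (intro Suc.IH) auto
    show "L (frechet_derivative f (at x) v) = frechet_derivative (\<lambda>x. L (f x)) (at x) v" if "x \<in> S" for x
      by (rule frechet_derivative_eqI[OF D[OF that], symmetric])
  qed
  moreover have "\<forall>x\<in>S. (\<lambda>x. L (f x)) differentiable (at x)"
    by (intro ballI Derivative.differentiableI[OF D])
  ultimately show ?case by simp
qed

lemma times_cont_diff_on_compose:
  fixes g :: "'b::euclidean_space \<Rightarrow> 'c::real_normed_vector"
  assumes "open S" "open T" "f ` S \<subseteq> T" "times_cont_diff_on n S f" "times_cont_diff_on n T g"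
  shows "times_cont_diff_on n S (\<lambda>x. g (f x))"
  using assms(4,5)
proof (induction n arbitrary: g)
  case 0
  then show ?case using assms(3) by (auto intro: continuous_on_compose2)
next
  case (Suc n)
  \<comment> \<open>The derivative of \<open>g\<close> is applied to a direction that varies with
    \<open>x\<close>, whereas the induction hypothesis covers derivatives in a fixed direction.
    Expanding the direction in the basis of the finite-dimensional middle space leaves smooth scalar
    factors times such derivatives.\<close>
  let ?D = "\<lambda>x v. \<Sum>b\<in>Basis. (frechet_derivative f (at x) v \<bullet> b) *\<^sub>R frechet_derivative g (at (f x)) b"
  have D: "((\<lambda>x. g (f x)) has_derivative ?D x) (at x)" if "x \<in> S" for x
  proof -
    have f: "(f has_derivative frechet_derivative f (at x)) (at x)"
      using Suc.prems that by (auto simp: frechet_derivative_works[symmetric])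
    have gd: "g differentiable at (f x)" using Suc.prems that assms(3) by auto
    then have "(g has_derivative frechet_derivative g (at (f x))) (at (f x))"
      by (simp only: frechet_derivative_works[symmetric])
    from diff_chain_at[OF f this]
    have chain: "((\<lambda>x. g (f x)) has_derivative (\<lambda>v. frechet_derivative g (at (f x)) (frechet_derivative f (at x) v))) (at x)"
      by (simp add: o_def)
    have "frechet_derivative g (at (f x)) w = (\<Sum>b\<in>Basis. (w \<bullet> b) *\<^sub>R frechet_derivative g (at (f x)) b)" for w
    proof -
      have l: "linear (frechet_derivative g (at (f x)))" using gd by (rule linear_frechet_derivative)
      have "frechet_derivative g (at (f x)) (\<Sum>b\<in>Basis. (w \<bullet> b) *\<^sub>R b) =
          (\<Sum>b\<in>Basis. (w \<bullet> b) *\<^sub>R frechet_derivative g (at (f x)) b)"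
        by (simp only: linear_sum[OF l] linear_cmul[OF l])
      then show ?thesis by (simp only: euclidean_representation)
    qed
    then show ?thesis by (intro has_derivative_eq_rhs[OF chain] ext)
  qed
  have "times_cont_diff_on n S (\<lambda>x. frechet_derivative (\<lambda>x. g (f x)) (at x) v)" for v
  proof (rule times_cont_diff_on_cong[OF assms(1)])
    have "times_cont_diff_on n S (\<lambda>x. frechet_derivative f (at x) v \<bullet> b)" for b
      by (rule times_cont_diff_on_bounded_linear_comp[OF assms(1) bounded_linear_inner_left])
        (use Suc.prems(1) in simp)
    moreover have "times_cont_diff_on n S (\<lambda>x. frechet_derivative g (at (f x)) b)" for b
      using Suc.prems times_cont_diff_on_SucD[OF Suc.prems(1)] by (intro Suc.IH) auto
    ultimately show "times_cont_diff_on n S (\<lambda>x. ?D x v)"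
      by (intro times_cont_diff_on_sum times_cont_diff_on_scaleR assms(1))
    show "?D x v = frechet_derivative (\<lambda>x. g (f x)) (at x) v" if "x \<in> S" for x
      by (rule frechet_derivative_eqI[OF D[OF that], symmetric])
  qed
  moreover have "\<forall>x\<in>S. (\<lambda>x. g (f x)) differentiable (at x)"
    by (intro ballI Derivative.differentiableI[OF D])
  ultimately show ?case by simp
qed

text \<open>Differentiation lowers the exponent, so the induction generalizes it. Exponent -1/2
  later normalizes a frame vector, exponent -1 gives smoothness of \<open>1 / f\<close>.\<close>

lemma times_cont_diff_on_powr: "times_cont_diff_on n {0<..} (\<lambda>x::real. x powr a)"
proof (induction n arbitrary: a)
  case 0
  have "continuous_on {0<..} (\<lambda>x::real. x powr a)"
    by (intro continuous_intros) auto
  then show ?case by simp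
next
  case (Suc n)
  have D: "((\<lambda>x::real. x powr a) has_derivative (\<lambda>v. (v * a) *\<^sub>R x powr (a - 1))) (at x)" if "x \<in> {0<..}" for x
  proof -
    have "((\<lambda>x::real. x powr a) has_real_derivative a * x powr (a - 1)) (at x)"
      using that by (intro has_real_derivative_powr) auto
    then show ?thesis
      unfolding has_field_derivative_def by (rule has_derivative_eq_rhs) (simp add: fun_eq_iff)
  qed
  have "times_cont_diff_on n {0<..} (\<lambda>x. frechet_derivative (\<lambda>x::real. x powr a) (at x) v)" for v
  proof (rule times_cont_diff_on_cong)
    show "times_cont_diff_on n {0<..} (\<lambda>x::real. (v * a) *\<^sub>R x powr (a - 1))"
      by (intro times_cont_diff_on_scaleR times_cont_diff_on_const Suc) auto
    show "(v * a) *\<^sub>R x powr (a - 1) = frechet_derivative (\<lambda>x. x powr a) (at x) v" if "x \<in> {0<..}" for x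
      by (rule frechet_derivative_eqI[OF D[OF that], symmetric])
  qed auto
  moreover have "\<forall>x\<in>{0<..}. (\<lambda>x::real. x powr a) differentiable (at x)"
    by (intro ballI Derivative.differentiableI[OF D])
  ultimately show ?case by simp
qed

section \<open>Closure properties of smooth functions on open sets\<close>

lemma smooth_on_cong:
  "open S \<Longrightarrow> (\<And>x. x \<in> S \<Longrightarrow> f x = g x) \<Longrightarrow> smooth_on S f \<Longrightarrow> smooth_on S g"
  unfolding smooth_on_def using times_cont_diff_on_cong by blast

lemma smooth_on_subset: "smooth_on S f \<Longrightarrow> T \<subseteq> S \<Longrightarrow> smooth_on T f"
  unfolding smooth_on_def using times_cont_diff_on_subset by blast

lemma smooth_on_local:
  assumes "\<And>x. x \<in> S \<Longrightarrow> \<exists>T. open T \<and> x \<in> T \<and> smooth_on T f"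
  shows "smooth_on S f"
  unfolding smooth_on_def
proof
  show "times_cont_diff_on n S f" for n
    by (rule times_cont_diff_on_local) (use assms in \<open>unfold smooth_on_def, blast\<close>)
qed

lemma smooth_on_const: "smooth_on S (\<lambda>x. c)"
  by (simp add: smooth_on_def times_cont_diff_on_const)

lemma smooth_on_bounded_linear: "bounded_linear L \<Longrightarrow> smooth_on S L"
  by (simp add: smooth_on_def times_cont_diff_on_bounded_linear)

lemma smooth_on_add:
  "open S \<Longrightarrow> smooth_on S f \<Longrightarrow> smooth_on S g \<Longrightarrow> smooth_on S (\<lambda>x. f x + g x)"
  by (simp add: smooth_on_def times_cont_diff_on_add)

lemma smooth_on_mult:
  fixes f g :: "'a::real_normed_vector \<Rightarrow> real"
  shows "open S \<Longrightarrow> smooth_on S f \<Longrightarrow> smooth_on S g \<Longrightarrow> smooth_on S (\<lambda>x. f x * g x)"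
  unfolding smooth_on_def using times_cont_diff_on_scaleR[of S _ f g] by simp

lemma smooth_on_bounded_linear_comp:
  "open S \<Longrightarrow> bounded_linear L \<Longrightarrow> smooth_on S f \<Longrightarrow> smooth_on S (\<lambda>x. L (f x))"
  by (simp add: smooth_on_def times_cont_diff_on_bounded_linear_comp)

lemma smooth_on_compose:
  fixes g :: "'b::euclidean_space \<Rightarrow> 'c::real_normed_vector"
  shows "open S \<Longrightarrow> open T \<Longrightarrow> f ` S \<subseteq> T \<Longrightarrow> smooth_on S f \<Longrightarrow> smooth_on T g
    \<Longrightarrow> smooth_on S (\<lambda>x. g (f x))"
  unfolding smooth_on_def using times_cont_diff_on_compose by blast

lemma smooth_on_Pair:
  assumes "open S" "smooth_on S f" "smooth_on S g"
  shows "smooth_on S (\<lambda>x. (f x, g x))"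
proof -
  have "bounded_linear (\<lambda>y::'b. (y, 0::'c))" "bounded_linear (\<lambda>y::'c. (0::'b, y))"
    by (rule bounded_linear_Pair bounded_linear_ident bounded_linear_zero)+
  then have "smooth_on S (\<lambda>x. (f x, 0) + (0, g x))"
    by (intro smooth_on_add[OF assms(1)]
        smooth_on_bounded_linear_comp[OF assms(1) _ assms(2), where L = "\<lambda>y. (y, 0)"]
        smooth_on_bounded_linear_comp[OF assms(1) _ assms(3), where L = "\<lambda>y. (0, y)"])
  then show ?thesis by simp
qed

lemma smooth_on_powr: "smooth_on {0<..} (\<lambda>x::real. x powr a)"
  by (simp add: smooth_on_def times_cont_diff_on_powr)

lemma smooth_on_imp_continuous_on: "smooth_on S f \<Longrightarrow> continuous_on S f"
  unfolding smooth_on_def using times_cont_diff_on_imp_continuous_on by blast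

lemma smooth_on_imp_differentiable: "smooth_on S f \<Longrightarrow> x \<in> S \<Longrightarrow> f differentiable (at x)"
  unfolding smooth_on_def using times_cont_diff_on.simps(2) by blast

lemma smooth_on_frechet_derivative:
  assumes "smooth_on S f"
  shows "smooth_on S (\<lambda>x. frechet_derivative f (at x) v)"
  unfolding smooth_on_def
proof
  fix n
  have "times_cont_diff_on (Suc n) S f" using assms by (simp only: smooth_on_def)
  then show "times_cont_diff_on n S (\<lambda>x. frechet_derivative f (at x) v)" by simp
qed

section \<open>Derivatives in one variable\<close>

lemma deriv_eq_frechet_derivative:
  fixes f :: "real \<Rightarrow> real"
  assumes "f differentiable (at x)"
  shows "deriv f x = frechet_derivative f (at x) 1"
proof -
  have "(f has_real_derivative frechet_derivative f (at x) 1) (at x)"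
    unfolding has_field_derivative_def
  proof (rule has_derivative_eq_rhs)
    show "(f has_derivative frechet_derivative f (at x)) (at x)"
      using assms by (simp only: frechet_derivative_works)
    show "frechet_derivative f (at x) = (*) (frechet_derivative f (at x) 1)"
    proof
      fix y
      have "frechet_derivative f (at x) y = y * frechet_derivative f (at x) 1"
        using linear_cmul[OF linear_frechet_derivative[OF assms], of y 1]
        unfolding real_scaleR_def mult_1_right .
      also have "\<dots> = frechet_derivative f (at x) 1 * y" by (rule mult.commute)
      finally show "frechet_derivative f (at x) y = frechet_derivative f (at x) 1 * y" .
    qed
  qed
  then show ?thesis by (rule DERIV_imp_deriv)
qed

lemma smooth_on_deriv:
  fixes f :: "real \<Rightarrow> real"
  assumes "open S" "smooth_on S f"
  shows "smooth_on S (deriv f)"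
  by (rule smooth_on_cong[OF assms(1) _ smooth_on_frechet_derivative[OF assms(2), of 1]])
    (simp add: deriv_eq_frechet_derivative smooth_on_imp_differentiable[OF assms(2)])

section \<open>Tangent vectors and vector fields\<close>

lemma smooth_fun_on_subset: "smooth_fun_on A W h \<Longrightarrow> V \<subseteq> W \<Longrightarrow> smooth_fun_on A V h"
  unfolding smooth_fun_on_def by (fastforce intro: smooth_on_subset)

lemma smooth_fun_on_const: "smooth_fun_on A W (\<lambda>p. c)"
  by (auto simp: smooth_fun_on_def smooth_on_const)

lemma smooth_nearI:
  "smooth_fun_on A W h \<Longrightarrow> open W \<Longrightarrow> p \<in> W \<Longrightarrow> W \<subseteq> carrier_of A \<Longrightarrow> smooth_near A p h"
  by (auto simp: smooth_near_def)

lemma chart_subset_carrier: "(U, \<phi>) \<in> A \<Longrightarrow> U \<subseteq> carrier_of A"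
  by (auto simp: carrier_of_def)

lemma carrierE:
  assumes "p \<in> carrier_of A" obtains U \<phi> where "(U, \<phi>) \<in> A" "p \<in> U"
  using assms by (auto simp: carrier_of_def)

locale manifold =
  fixes A :: "('a::{t2_space, second_countable_topology}, 'e::euclidean_space) chart set"
  assumes manifold: "smooth_manifold A"
begin

abbreviation VF :: "'a set \<Rightarrow> 'a vector_field set" where "VF \<equiv> vector_fields A"

abbreviation TS :: "'a \<Rightarrow> 'a tangent_vector set" where "TS \<equiv> tangent_space A"

lemma chart_properties:
  assumes "(U, \<phi>) \<in> A"
  shows "open U" "open (\<phi> ` U)" "\<exists>\<psi>. homeomorphism U (\<phi> ` U) \<phi> \<psi>"
proof -
  have "\<forall>(U, \<phi>)\<in>A. open U \<and> open (\<phi> ` U) \<and> (\<exists>\<psi>. homeomorphism U (\<phi> ` U) \<phi> \<psi>)"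
    using manifold unfolding smooth_manifold_def by (elim conjE)
  from bspec[OF this assms] show "open U" "open (\<phi> ` U)" "\<exists>\<psi>. homeomorphism U (\<phi> ` U) \<phi> \<psi>"
    by simp_all
qed

lemmas chart_open = chart_properties(1) and chart_homeomorphism = chart_properties(3)

lemma open_carrier: "open (carrier_of A)"
  unfolding carrier_of_def by (auto intro: chart_open)

lemma chart_continuous: "(U, \<phi>) \<in> A \<Longrightarrow> continuous_on U \<phi>"
  using chart_homeomorphism by (auto simp: homeomorphism_def)

lemma chart_inj:
  assumes "(U, \<phi>) \<in> A"
  shows "inj_on \<phi> U"
proof -
  obtain \<psi> where "homeomorphism U (\<phi> ` U) \<phi> \<psi>" using chart_homeomorphism[OF assms] by blast
  then have "\<psi> (\<phi> p) = p" if "p \<in> U" for p using that by (simp add: homeomorphism_def)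
  then show ?thesis by (rule inj_on_inverseI)
qed

lemma chart_inv: "(U, \<phi>) \<in> A \<Longrightarrow> p \<in> U \<Longrightarrow> inv_into U \<phi> (\<phi> p) = p"
  by (simp add: chart_inj)

lemma chart_image_open:
  assumes "(U, \<phi>) \<in> A" "open W"
  shows "open (\<phi> ` (U \<inter> W))"
proof -
  obtain \<psi> where "homeomorphism U (\<phi> ` U) \<phi> \<psi>" using chart_homeomorphism assms by blast
  from homeomorphism_imp_open_map[OF this, of "U \<inter> W"] have "openin (top_of_set (\<phi> ` U)) (\<phi> ` (U \<inter> W))"
    using assms by (auto simp: openin_open)
  moreover have "open (\<phi> ` U)" using assms(1) by (rule chart_properties(2))
  ultimately show ?thesis by (rule openin_open_trans)
qed

lemma transition_smooth:
  assumes "(U, \<phi>) \<in> A" "(V, \<psi>) \<in> A"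
  shows "smooth_on (\<phi> ` (U \<inter> V)) (\<lambda>x. \<psi> (inv_into U \<phi> x))"
proof -
  have "\<forall>(U, \<phi>)\<in>A. \<forall>(V, \<psi>)\<in>A. smooth_on (\<phi> ` (U \<inter> V)) (\<lambda>x. \<psi> (inv_into U \<phi> x))"
    using manifold unfolding smooth_manifold_def by (elim conjE)
  from bspec[OF this assms(1)] have
    "\<forall>(V, \<psi>)\<in>A. smooth_on (\<phi> ` (U \<inter> V)) (\<lambda>x. \<psi> (inv_into U \<phi> x))" by simp
  from bspec[OF this assms(2)] show ?thesis by simp
qed

lemma smooth_fun_onD:
  "smooth_fun_on A W h \<Longrightarrow> (U, \<phi>) \<in> A \<Longrightarrow> smooth_on (\<phi> ` (U \<inter> W)) (\<lambda>x. h (inv_into U \<phi> x))"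
  unfolding smooth_fun_on_def by (drule (1) bspec) simp

lemma smooth_fun_onI:
  "(\<And>U \<phi>. (U, \<phi>) \<in> A \<Longrightarrow> smooth_on (\<phi> ` (U \<inter> W)) (\<lambda>x. h (inv_into U \<phi> x))) \<Longrightarrow> smooth_fun_on A W h"
  by (auto simp: smooth_fun_on_def)

lemma smooth_fun_on_local:
  assumes "\<And>p. p \<in> W \<Longrightarrow> \<exists>V. open V \<and> p \<in> V \<and> smooth_fun_on A V h"
  shows "smooth_fun_on A W h"
proof (intro smooth_fun_onI smooth_on_local)
  fix U \<phi> x assume U: "(U, \<phi>) \<in> A" and "x \<in> \<phi> ` (U \<inter> W)"
  then obtain p where p: "p \<in> U" "p \<in> W" "x = \<phi> p" by auto
  then obtain V where "open V" "p \<in> V" "smooth_fun_on A V h" using assms by blast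
  with p U show "\<exists>T. open T \<and> x \<in> T \<and> smooth_on T (\<lambda>x. h (inv_into U \<phi> x))"
    by (intro exI[of _ "\<phi> ` (U \<inter> V)"]) (auto intro: chart_image_open smooth_fun_onD)
qed

lemma smooth_fun_on_cong:
  assumes "smooth_fun_on A W h" "open W" "\<And>p. p \<in> W \<Longrightarrow> h p = k p"
  shows "smooth_fun_on A W k"
proof (intro smooth_fun_onI)
  fix U \<phi> assume U: "(U, \<phi>) \<in> A"
  show "smooth_on (\<phi> ` (U \<inter> W)) (\<lambda>x. k (inv_into U \<phi> x))"
    by (rule smooth_on_cong[OF chart_image_open[OF U assms(2)] _ smooth_fun_onD[OF assms(1) U]])
      (auto simp: chart_inv[OF U] assms(3))
qed

lemma smooth_fun_on_add:
  "open W \<Longrightarrow> smooth_fun_on A W h \<Longrightarrow> smooth_fun_on A W k \<Longrightarrow> smooth_fun_on A W (\<lambda>p. h p + k p)"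
  by (intro smooth_fun_onI smooth_on_add) (auto intro: chart_image_open smooth_fun_onD)

lemma smooth_fun_on_mult:
  "open W \<Longrightarrow> smooth_fun_on A W h \<Longrightarrow> smooth_fun_on A W k \<Longrightarrow> smooth_fun_on A W (\<lambda>p. h p * k p)"
  by (intro smooth_fun_onI smooth_on_mult) (auto intro: chart_image_open smooth_fun_onD)

lemma smooth_fun_on_sum:
  assumes "open W" "\<And>i. i \<in> B \<Longrightarrow> smooth_fun_on A W (h i)"
  shows "smooth_fun_on A W (\<lambda>p. \<Sum>i\<in>B. h i p)"
  using assms(2)
proof (induction B rule: infinite_finite_induct)
  case (insert b B)
  then have "smooth_fun_on A W (\<lambda>p. h b p + (\<Sum>i\<in>B. h i p))"
    by (intro smooth_fun_on_add[OF assms(1)]) simp_all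
  with insert.hyps show ?case by simp
qed (simp_all add: smooth_fun_on_const)

lemma smooth_fun_on_compose:
  fixes k :: "real \<Rightarrow> real"
  assumes "open W" "smooth_fun_on A W h" "open T" "smooth_on T k" "h ` W \<subseteq> T"
  shows "smooth_fun_on A W (\<lambda>p. k (h p))"
proof (intro smooth_fun_onI)
  fix U \<phi> assume U: "(U, \<phi>) \<in> A"
  show "smooth_on (\<phi> ` (U \<inter> W)) (\<lambda>x. k (h (inv_into U \<phi> x)))"
    by (rule smooth_on_compose[OF chart_image_open[OF U assms(1)] assms(3) _ smooth_fun_onD[OF assms(2) U] assms(4)])
      (use assms(5) in \<open>auto simp: chart_inv[OF U]\<close>)
qed

text \<open>\<open>smooth_fun_on\<close> quantifies over all charts; composing with the transition
  map reduces this to one chart containing \<open>W\<close>.\<close>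

lemma smooth_fun_on_chart:
  assumes U: "(U, \<phi>) \<in> A" and W: "open W" "W \<subseteq> U" and h: "smooth_on (\<phi> ` W) (\<lambda>x. h (inv_into U \<phi> x))"
  shows "smooth_fun_on A W h"
proof (intro smooth_fun_onI)
  fix V \<psi> assume V: "(V, \<psi>) \<in> A"
  have o: "open (\<psi> ` (V \<inter> W))" using V W(1) by (rule chart_image_open)
  have "\<phi> ` W = \<phi> ` (U \<inter> W)" using W by (simp add: Int_absorb1)
  then have o2: "open (\<phi> ` W)" using chart_image_open[OF U W(1)] by simp
  have s: "smooth_on (\<psi> ` (V \<inter> W)) (\<lambda>x. \<phi> (inv_into V \<psi> x))"
    using W by (intro smooth_on_subset[OF transition_smooth[OF V U]]) auto
  have im: "(\<lambda>x. \<phi> (inv_into V \<psi> x)) ` (\<psi> ` (V \<inter> W)) \<subseteq> \<phi> ` W"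
    by (auto simp: chart_inv[OF V])
  show "smooth_on (\<psi> ` (V \<inter> W)) (\<lambda>x. h (inv_into V \<psi> x))"
    by (rule smooth_on_cong[OF o _ smooth_on_compose[OF o o2 im s h]])
      (use W in \<open>auto simp: chart_inv[OF V] chart_inv[OF U]\<close>)
qed

lemma smooth_fun_on_coordinate:
  assumes U: "(U, \<phi>) \<in> A"
  shows "smooth_fun_on A U (\<lambda>p. \<phi> p \<bullet> b)"
proof (rule smooth_fun_on_chart[OF U chart_open[OF U] order_refl])
  have "open (\<phi> ` U)" using chart_image_open[OF U open_UNIV] by simp
  then show "smooth_on (\<phi> ` U) (\<lambda>x. \<phi> (inv_into U \<phi> x) \<bullet> b)"
    by (rule smooth_on_cong[OF _ _ smooth_on_bounded_linear[OF bounded_linear_inner_left]])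
      (auto simp: chart_inv[OF U])
qed

lemma smooth_fun_on_imp_continuous_on:
  assumes "open W" "W \<subseteq> carrier_of A" "smooth_fun_on A W h"
  shows "continuous_on W h"
proof (rule continuous_at_imp_continuous_on, rule ballI)
  fix p assume p: "p \<in> W"
  then have "p \<in> carrier_of A" using assms(2) by auto
  then obtain U \<phi> where U: "(U, \<phi>) \<in> A" "p \<in> U" by (rule carrierE)
  have "continuous_on (\<phi> ` (U \<inter> W)) (\<lambda>x. h (inv_into U \<phi> x))"
    by (rule smooth_on_imp_continuous_on[OF smooth_fun_onD[OF assms(3) U(1)]])
  then have "continuous_on (U \<inter> W) (\<lambda>q. h (inv_into U \<phi> (\<phi> q)))"
    by (rule continuous_on_compose2) (use chart_continuous[OF U(1)] in \<open>auto intro: continuous_on_subset\<close>)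
  then have "continuous_on (U \<inter> W) h"
    by (rule continuous_on_eq) (simp add: chart_inv[OF U(1)])
  moreover have "open (U \<inter> W)" using chart_open[OF U(1)] assms(1) by (rule open_Int)
  ultimately show "isCont h p" using p U by (auto simp: continuous_on_eq_continuous_at)
qed

section \<open>Germs of smooth functions\<close>

lemma smooth_nearE:
  assumes "smooth_near A p h"
  obtains W where "open W" "p \<in> W" "W \<subseteq> carrier_of A" "smooth_fun_on A W h"
  using assms by (auto simp: smooth_near_def)

lemma smooth_near_both:
  assumes "smooth_near A p h" "smooth_near A p k"
  obtains W where "open W" "p \<in> W" "W \<subseteq> carrier_of A" "smooth_fun_on A W h" "smooth_fun_on A W k"
proof -
  obtain V where V: "open V" "p \<in> V" "V \<subseteq> carrier_of A" "smooth_fun_on A V h"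
    using assms(1) by (rule smooth_nearE)
  obtain V' where V': "open V'" "p \<in> V'" "V' \<subseteq> carrier_of A" "smooth_fun_on A V' k"
    using assms(2) by (rule smooth_nearE)
  show ?thesis
    by (rule that[of "V \<inter> V'"]) (use V V' in \<open>auto intro: smooth_fun_on_subset\<close>)
qed

lemma smooth_near_add:
  assumes "smooth_near A p h" "smooth_near A p k" shows "smooth_near A p (\<lambda>q. h q + k q)"
proof -
  obtain W where W: "open W" "p \<in> W" "W \<subseteq> carrier_of A" "smooth_fun_on A W h" "smooth_fun_on A W k"
    using assms by (rule smooth_near_both)
  show ?thesis by (rule smooth_nearI[OF smooth_fun_on_add[OF W(1,4,5)] W(1-3)])
qed

lemma smooth_near_mult:
  assumes "smooth_near A p h" "smooth_near A p k" shows "smooth_near A p (\<lambda>q. h q * k q)"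
proof -
  obtain W where W: "open W" "p \<in> W" "W \<subseteq> carrier_of A" "smooth_fun_on A W h" "smooth_fun_on A W k"
    using assms by (rule smooth_near_both)
  show ?thesis by (rule smooth_nearI[OF smooth_fun_on_mult[OF W(1,4,5)] W(1-3)])
qed

text \<open>Tangent vectors and brackets branch on \<open>smooth_near\<close>, so a change of the
  function away from \<open>p\<close> must not change the branch.\<close>

lemma smooth_near_cong:
  assumes "open W" "p \<in> W" "\<And>q. q \<in> W \<Longrightarrow> h q = k q"
  shows "smooth_near A p h \<longleftrightarrow> smooth_near A p k"
proof -
  have "smooth_near A p k" if hk: "\<And>q. q \<in> W \<Longrightarrow> h q = k q" and h: "smooth_near A p h" for h k
  proof -
    obtain V where V: "open V" "p \<in> V" "V \<subseteq> carrier_of A" "smooth_fun_on A V h"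
      using h by (rule smooth_nearE)
    have "smooth_fun_on A (V \<inter> W) k"
      by (rule smooth_fun_on_cong[OF smooth_fun_on_subset[OF V(4)]]) (use V assms hk in auto)
    then show ?thesis by (rule smooth_nearI) (use V assms in auto)
  qed
  with assms(3) show ?thesis by metis
qed

lemma smooth_near_coordinate: "(U, \<phi>) \<in> A \<Longrightarrow> p \<in> U \<Longrightarrow> smooth_near A p (\<lambda>q. \<phi> q \<bullet> b)"
  using smooth_nearI[OF smooth_fun_on_coordinate chart_open] chart_subset_carrier by blast

lemma smooth_near_differentiable:
  assumes "smooth_near A p h" and U: "(U, \<phi>) \<in> A" "p \<in> U"
  shows "(\<lambda>x. h (inv_into U \<phi> x)) differentiable (at (\<phi> p))"
proof -
  obtain V where V: "open V" "p \<in> V" "smooth_fun_on A V h"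
    using assms(1) by (rule smooth_nearE)
  show ?thesis
    by (rule smooth_on_imp_differentiable[OF smooth_fun_onD[OF V(3) U(1)]]) (use V U in auto)
qed

section \<open>Tangent vectors in coordinates\<close>

lemma coordinate_vector_smooth:
  "smooth_near A p h \<Longrightarrow> coordinate_vector A (U, \<phi>) p u h
     = frechet_derivative (\<lambda>x. h (inv_into U \<phi> x)) (at (\<phi> p)) u"
  by (simp add: coordinate_vector_def)

lemma coordinate_vector_linear:
  assumes U: "(U, \<phi>) \<in> A" "p \<in> U"
  shows "linear (\<lambda>u. coordinate_vector A (U, \<phi>) p u h)"
proof (cases "smooth_near A p h")
  case True
  then show ?thesis
    using linear_frechet_derivative[OF smooth_near_differentiable[OF True U]]
    by (simp add: coordinate_vector_def)
next
  case False
  then show ?thesis by (simp add: coordinate_vector_def linear_zero)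
qed

lemma coordinate_vector_sum:
  assumes U: "(U, \<phi>) \<in> A" "p \<in> U"
  shows "coordinate_vector A (U, \<phi>) p (\<Sum>i\<in>B. c i *\<^sub>R u i) = (\<lambda>h. \<Sum>i\<in>B. c i * coordinate_vector A (U, \<phi>) p (u i) h)"
  by (simp add: fun_eq_iff linear_sum[OF coordinate_vector_linear[OF U]]
        linear_cmul[OF coordinate_vector_linear[OF U]])

text \<open>Chain rule through the transition map: components change by its Jacobian. This lets
  \<open>tangent_space\<close>, a union over all charts at \<open>p\<close>, be computed in any
  single one.\<close>

lemma coordinate_vector_change:
  assumes U: "(U, \<phi>) \<in> A" "p \<in> U" and V: "(V, \<psi>) \<in> A" "p \<in> V"
  shows "coordinate_vector A (U, \<phi>) p u =
    coordinate_vector A (V, \<psi>) p (frechet_derivative (\<lambda>x. \<psi> (inv_into U \<phi> x)) (at (\<phi> p)) u)"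
proof
  fix h
  show "coordinate_vector A (U, \<phi>) p u h =
    coordinate_vector A (V, \<psi>) p (frechet_derivative (\<lambda>x. \<psi> (inv_into U \<phi> x)) (at (\<phi> p)) u) h"
  proof (cases "smooth_near A p h")
    case True
    let ?\<tau> = "\<lambda>x. \<psi> (inv_into U \<phi> x)"
    have t: "(?\<tau> has_derivative frechet_derivative ?\<tau> (at (\<phi> p))) (at (\<phi> p))"
      unfolding frechet_derivative_works[symmetric]
      by (rule smooth_on_imp_differentiable[OF transition_smooth[OF U(1) V(1)]]) (use U V in auto)
    have tp: "?\<tau> (\<phi> p) = \<psi> p" using chart_inv U by simp
    have "((\<lambda>x. h (inv_into V \<psi> x)) has_derivative
        frechet_derivative (\<lambda>x. h (inv_into V \<psi> x)) (at (\<psi> p))) (at (?\<tau> (\<phi> p)))"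
      unfolding tp frechet_derivative_works[symmetric] by (rule smooth_near_differentiable[OF True V])
    from diff_chain_at[OF t this]
    have c: "((\<lambda>x. h (inv_into V \<psi> (?\<tau> x))) has_derivative
        (\<lambda>u. frechet_derivative (\<lambda>x. h (inv_into V \<psi> x)) (at (\<psi> p)) (frechet_derivative ?\<tau> (at (\<phi> p)) u))) (at (\<phi> p))"
      unfolding o_def .
    have "((\<lambda>x. h (inv_into U \<phi> x)) has_derivative
        (\<lambda>u. frechet_derivative (\<lambda>x. h (inv_into V \<psi> x)) (at (\<psi> p)) (frechet_derivative ?\<tau> (at (\<phi> p)) u))) (at (\<phi> p))"
      by (rule has_derivative_transform_within_open[OF c chart_image_open[OF U(1) chart_open[OF V(1)]]])
        (use U V in \<open>auto simp: chart_inv[OF U(1)] chart_inv[OF V(1)]\<close>)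
    then show ?thesis
      using True by (simp add: coordinate_vector_smooth frechet_derivative_eqI)
  next
    case False
    then show ?thesis by (simp add: coordinate_vector_def)
  qed
qed

lemma tangent_space_eq:
  assumes U: "(U, \<phi>) \<in> A" "p \<in> U"
  shows "TS p = range (coordinate_vector A (U, \<phi>) p)"
proof
  show "TS p \<subseteq> range (coordinate_vector A (U, \<phi>) p)"
  proof
    fix v assume "v \<in> TS p"
    then obtain c u where c: "c \<in> A" "p \<in> fst c" "v = coordinate_vector A c p u"
      by (auto simp: tangent_space_def)
    obtain V \<psi> where "c = (V, \<psi>)" by (cases c)
    with c coordinate_vector_change[of V \<psi> p U \<phi> u] U show "v \<in> range (coordinate_vector A (U, \<phi>) p)"
      by auto
  qed
  show "range (coordinate_vector A (U, \<phi>) p) \<subseteq> TS p"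
    using U by (force simp: tangent_space_def)
qed

lemma coordinate_vector_in_tangent_space:
  "(U, \<phi>) \<in> A \<Longrightarrow> p \<in> U \<Longrightarrow> coordinate_vector A (U, \<phi>) p u \<in> TS p"
  by (simp add: tangent_space_eq)

lemma tangentE:
  assumes "v \<in> TS p"
  obtains U \<phi> u where "(U, \<phi>) \<in> A" "p \<in> U" "v = coordinate_vector A (U, \<phi>) p u"
  using assms unfolding tangent_space_def by fastforce

lemma tangent_space_carrier: "v \<in> TS p \<Longrightarrow> p \<in> carrier_of A"
  by (elim tangentE) (use chart_subset_carrier in blast)

section \<open>Tangent vectors as derivations\<close>

lemma tangent_not_smooth: "v \<in> TS p \<Longrightarrow> \<not> smooth_near A p h \<Longrightarrow> v h = 0"
  by (elim tangentE) (simp add: coordinate_vector_def)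

lemma tangent_const: "v \<in> TS p \<Longrightarrow> v (\<lambda>q. c) = 0"
  by (elim tangentE) (simp add: coordinate_vector_def)

lemma tangent_add:
  assumes "v \<in> TS p" and h: "smooth_near A p h" and k: "smooth_near A p k"
  shows "v (\<lambda>q. h q + k q) = v h + v k"
proof -
  obtain U \<phi> u where U: "(U, \<phi>) \<in> A" "p \<in> U" and v: "v = coordinate_vector A (U, \<phi>) p u"
    using assms(1) by (rule tangentE)
  note D = smooth_near_differentiable[OF _ U, unfolded frechet_derivative_works]
  show ?thesis
    using frechet_derivative_eqI[OF has_derivative_add[OF D[OF h] D[OF k]]]
    by (simp add: v coordinate_vector_smooth smooth_near_add h k)
qed

lemma tangent_mult:
  assumes "v \<in> TS p" and h: "smooth_near A p h" and k: "smooth_near A p k"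
  shows "v (\<lambda>q. h q * k q) = h p * v k + v h * k p"
proof -
  obtain U \<phi> u where U: "(U, \<phi>) \<in> A" "p \<in> U" and v: "v = coordinate_vector A (U, \<phi>) p u"
    using assms(1) by (rule tangentE)
  note D = smooth_near_differentiable[OF _ U, unfolded frechet_derivative_works]
  show ?thesis
    using frechet_derivative_eqI[OF has_derivative_mult[OF D[OF h] D[OF k]]]
    by (simp add: v coordinate_vector_smooth smooth_near_mult h k chart_inv[OF U])
qed

text \<open>The value depends on the germ alone, whether or not it is smooth: on a germ that is not
  smooth both sides are 0 by the truncation.\<close>

lemma tangent_cong:
  assumes "v \<in> TS p" and W: "open W" "p \<in> W" and hk: "\<And>q. q \<in> W \<Longrightarrow> h q = k q"
  shows "v h = v k"
proof (cases "smooth_near A p h")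
  case True
  obtain U \<phi> u where U: "(U, \<phi>) \<in> A" "p \<in> U" and v: "v = coordinate_vector A (U, \<phi>) p u"
    using assms(1) by (rule tangentE)
  have "frechet_derivative (\<lambda>x. h (inv_into U \<phi> x)) (at (\<phi> p)) =
      frechet_derivative (\<lambda>x. k (inv_into U \<phi> x)) (at (\<phi> p))"
    by (rule frechet_derivative_transform_within_open[OF smooth_near_differentiable[OF True U]
          chart_image_open[OF U(1) W(1)]]) (use U W hk in \<open>auto simp: chart_inv[OF U(1)]\<close>)
  moreover have "smooth_near A p k" using smooth_near_cong[OF W, of h k] hk True by simp
  ultimately show ?thesis using True by (simp add: v coordinate_vector_smooth)
next
  case False
  moreover have "\<not> smooth_near A p k" using smooth_near_cong[OF W, of h k] hk False by simp
  ultimately show ?thesis using tangent_not_smooth[OF assms(1)] by simp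
qed

lemma tangent_lincomb:
  assumes u: "u \<in> TS p" and v: "v \<in> TS p"
  shows "(\<lambda>h. a * u h + b * v h) \<in> TS p"
proof -
  obtain U \<phi> u' where U: "(U, \<phi>) \<in> A" "p \<in> U" and u': "u = coordinate_vector A (U, \<phi>) p u'"
    using u by (rule tangentE)
  obtain v' where v': "v = coordinate_vector A (U, \<phi>) p v'" using v tangent_space_eq[OF U] by auto
  have "(\<lambda>h. a * u h + b * v h) = coordinate_vector A (U, \<phi>) p (a *\<^sub>R u' + b *\<^sub>R v')"
    by (simp add: fun_eq_iff u' v' linear_add[OF coordinate_vector_linear[OF U]]
        linear_cmul[OF coordinate_vector_linear[OF U]])
  then show ?thesis using coordinate_vector_in_tangent_space[OF U] by simp
qed

lemma tangent_zero: "p \<in> carrier_of A \<Longrightarrow> (\<lambda>h. 0) \<in> TS p"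
proof (elim carrierE)
  fix U \<phi> assume U: "(U, \<phi>) \<in> A" "p \<in> U"
  from tangent_lincomb[OF coordinate_vector_in_tangent_space[OF this] coordinate_vector_in_tangent_space[OF this], of 0 _ 0]
  show ?thesis by simp
qed

text \<open>Applying a tangent vector to the coordinate functions reads off its components. Hence
  the coordinates of a tangent vector in a chart are unique, and it can be rebuilt from finitely
  many of its values.\<close>

lemma coordinate_vector_coordinate:
  assumes U: "(U, \<phi>) \<in> A" "p \<in> U"
  shows "coordinate_vector A (U, \<phi>) p u (\<lambda>q. \<phi> q \<bullet> b) = u \<bullet> b"
proof -
  have "((\<lambda>x. x \<bullet> b) has_derivative (\<lambda>x. x \<bullet> b)) (at (\<phi> p))"
    by (rule bounded_linear_imp_has_derivative[OF bounded_linear_inner_left])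
  then have "((\<lambda>x. \<phi> (inv_into U \<phi> x) \<bullet> b) has_derivative (\<lambda>x. x \<bullet> b)) (at (\<phi> p))"
    by (rule has_derivative_transform_within_open[OF _ chart_image_open[OF U(1) open_UNIV]])
      (use U in \<open>auto simp: chart_inv[OF U(1)]\<close>)
  then show ?thesis
    by (simp add: coordinate_vector_smooth smooth_near_coordinate[OF U] frechet_derivative_eqI)
qed

lemma tangent_coordinate_expansion:
  assumes U: "(U, \<phi>) \<in> A" "p \<in> U" and v: "v \<in> TS p"
  shows "v = coordinate_vector A (U, \<phi>) p (\<Sum>b\<in>Basis. v (\<lambda>q. \<phi> q \<bullet> b) *\<^sub>R b)"
proof -
  obtain u where "v = coordinate_vector A (U, \<phi>) p u" using v tangent_space_eq[OF U] by auto
  then show ?thesis by (simp add: coordinate_vector_coordinate[OF U] euclidean_representation)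
qed

section \<open>Smooth vector fields as a module over smooth functions\<close>

lemma vector_field_tangent: "X \<in> VF W \<Longrightarrow> p \<in> W \<Longrightarrow> X p \<in> TS p"
  by (simp add: vector_fields_def)

lemma vector_field_smooth:
  "X \<in> VF W \<Longrightarrow> open V \<Longrightarrow> V \<subseteq> W \<Longrightarrow> smooth_fun_on A V h \<Longrightarrow> smooth_fun_on A V (\<lambda>p. X p h)"
  by (simp add: vector_fields_def)

lemma vector_fields_subset: "X \<in> VF W \<Longrightarrow> V \<subseteq> W \<Longrightarrow> X \<in> VF V"
  by (fastforce simp: vector_fields_def)

lemma vector_fields_cong:
  assumes "X \<in> VF W" "\<And>p. p \<in> W \<Longrightarrow> X p = Y p"
  shows "Y \<in> VF W"
  unfolding vector_fields_def
proof (intro CollectI conjI allI impI ballI)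
  show "Y p \<in> TS p" if "p \<in> W" for p
    using vector_field_tangent[OF assms(1) that] assms(2)[OF that] by simp
  show "smooth_fun_on A V (\<lambda>p. Y p h)" if "open V" "V \<subseteq> W" "smooth_fun_on A V h" for V h
    by (rule smooth_fun_on_cong[OF vector_field_smooth[OF assms(1) that]]) (use that assms(2) in auto)
qed

lemma vector_fields_local:
  assumes "\<And>p. p \<in> W \<Longrightarrow> \<exists>V. open V \<and> p \<in> V \<and> X \<in> VF V"
  shows "X \<in> VF W"
  unfolding vector_fields_def
proof (intro CollectI conjI allI impI ballI)
  show "X p \<in> TS p" if "p \<in> W" for p
    using assms[OF that] vector_field_tangent by blast
  fix V h assume V: "open V" "V \<subseteq> W" and h: "smooth_fun_on A V h"
  show "smooth_fun_on A V (\<lambda>p. X p h)"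
  proof (rule smooth_fun_on_local)
    fix p assume p: "p \<in> V"
    then obtain V' where V': "open V'" "p \<in> V'" "X \<in> VF V'" using assms V by blast
    have "smooth_fun_on A (V \<inter> V') (\<lambda>p. X p h)"
      by (rule vector_field_smooth[OF V'(3) _ _ smooth_fun_on_subset[OF h]]) (use V V' in auto)
    then show "\<exists>V. open V \<and> p \<in> V \<and> smooth_fun_on A V (\<lambda>p. X p h)"
      using V V' p by (intro exI[of _ "V \<inter> V'"]) auto
  qed
qed

lemma vf_add_closed:
  assumes "X \<in> VF W" "Y \<in> VF W"
  shows "vf_add X Y \<in> VF W"
  unfolding vector_fields_def
proof (intro CollectI conjI allI impI ballI)
  show "vf_add X Y p \<in> TS p" if "p \<in> W" for p
    using tangent_lincomb[OF assms[THEN vector_field_tangent, OF that], of 1 1]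
    by (simp add: vf_add_def)
  show "smooth_fun_on A V (\<lambda>p. vf_add X Y p h)" if "open V" "V \<subseteq> W" "smooth_fun_on A V h" for V h
    unfolding vf_add_def
    by (rule smooth_fun_on_add[OF that(1) assms[THEN vector_field_smooth, OF that]])
qed

lemma vf_scale_closed:
  assumes "X \<in> VF W" "smooth_fun_on A W k"
  shows "vf_scale k X \<in> VF W"
  unfolding vector_fields_def
proof (intro CollectI conjI allI impI ballI)
  show "vf_scale k X p \<in> TS p" if "p \<in> W" for p
    using tangent_lincomb[OF vector_field_tangent[OF assms(1) that] vector_field_tangent[OF assms(1) that], of "k p" 0]
    by (simp add: vf_scale_def)
  show "smooth_fun_on A V (\<lambda>p. vf_scale k X p h)" if "open V" "V \<subseteq> W" "smooth_fun_on A V h" for V h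
    unfolding vf_scale_def
    by (rule smooth_fun_on_mult[OF that(1) smooth_fun_on_subset[OF assms(2) that(2)] vector_field_smooth[OF assms(1) that]])
qed

lemma vf_zero_closed: "W \<subseteq> carrier_of A \<Longrightarrow> (\<lambda>p h. 0) \<in> VF W"
  by (auto simp: vector_fields_def smooth_fun_on_const intro: tangent_zero)

lemma vf_sum_closed:
  assumes "W \<subseteq> carrier_of A" "finite B" "\<And>i. i \<in> B \<Longrightarrow> X i \<in> VF W"
    "\<And>i. i \<in> B \<Longrightarrow> smooth_fun_on A W (a i)"
  shows "(\<lambda>p h. \<Sum>i\<in>B. a i p * X i p h) \<in> VF W"
  using assms(2-)
proof (induction B)
  case empty
  then show ?case by (simp add: vf_zero_closed[OF assms(1)])
next
  case (insert b B)
  then have "vf_add (vf_scale (a b) (X b)) (\<lambda>p h. \<Sum>i\<in>B. a i p * X i p h) \<in> VF W"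
    by (intro vf_add_closed vf_scale_closed) auto
  with insert.hyps show ?case by (simp add: vf_add_def vf_scale_def)
qed

lemma vector_field_smooth_near:
  assumes "X \<in> VF W" "open W" "p \<in> W" "smooth_near A p h"
  shows "smooth_near A p (\<lambda>q. X q h)"
proof -
  obtain V where V: "open V" "p \<in> V" "V \<subseteq> carrier_of A" "smooth_fun_on A V h"
    using assms(4) by (rule smooth_nearE)
  have "smooth_fun_on A (V \<inter> W) (\<lambda>q. X q h)"
    by (rule vector_field_smooth[OF assms(1) _ _ smooth_fun_on_subset[OF V(4)]]) (use V assms in auto)
  then show ?thesis by (rule smooth_nearI) (use V assms in auto)
qed

lemma coordinate_field:
  assumes U: "(U, \<phi>) \<in> A"
  shows "(\<lambda>p. coordinate_vector A (U, \<phi>) p u) \<in> VF U"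
  unfolding vector_fields_def
proof (intro CollectI conjI allI impI ballI)
  show "coordinate_vector A (U, \<phi>) p u \<in> TS p" if "p \<in> U" for p
    using U that by (rule coordinate_vector_in_tangent_space)
  fix V h assume V: "open V" "V \<subseteq> U" and h: "smooth_fun_on A V h"
  show "smooth_fun_on A V (\<lambda>p. coordinate_vector A (U, \<phi>) p u h)"
  proof (rule smooth_fun_on_chart[OF U V])
    have UV: "U \<inter> V = V" using V by auto
    have "smooth_on (\<phi> ` V) (\<lambda>x. frechet_derivative (\<lambda>x. h (inv_into U \<phi> x)) (at x) u)"
      using smooth_fun_onD[OF h U] by (intro smooth_on_frechet_derivative) (simp add: UV)
    moreover have "open (\<phi> ` V)" using chart_image_open[OF U V(1)] by (simp add: UV)
    moreover have "smooth_near A p h" if "p \<in> V" for p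
      by (rule smooth_nearI[OF h V(1) that]) (use V chart_subset_carrier[OF U] in auto)
    moreover have "inv_into U \<phi> (\<phi> p) = p" if "p \<in> V" for p
      using chart_inv[OF U] that V by auto
    ultimately show "smooth_on (\<phi> ` V) (\<lambda>x. coordinate_vector A (U, \<phi>) (inv_into U \<phi> x) u h)"
      by (elim smooth_on_cong[rotated 2]) (auto simp: coordinate_vector_smooth)
  qed
qed

end

section \<open>Orthonormal frames\<close>

locale metric_manifold = manifold A
  for A :: "('a::{t2_space, second_countable_topology}, 'e::euclidean_space) chart set" +
  fixes g :: "'a metric_tensor"
  assumes metric: "pseudo_riemannian A g"
begin

section \<open>Linear algebra of an indefinite metric\<close>

lemma metric_pointwise:
  assumes "p \<in> carrier_of A"
  shows "\<forall>u\<in>TS p. \<forall>v\<in>TS p. g p u v = g p v u"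
    "\<forall>u\<in>TS p. \<forall>v\<in>TS p. \<forall>w\<in>TS p. \<forall>a b.
           g p (\<lambda>h. a * u h + b * v h) w = a * g p u w + b * g p v w"
    "\<forall>u\<in>TS p. (\<forall>v\<in>TS p. g p u v = 0) \<longrightarrow> u = (\<lambda>h. 0)"
  using conjunct1[OF metric[unfolded pseudo_riemannian_def], rule_format, OF assms] by blast+

lemma metric_sym:
  "u \<in> TS p \<Longrightarrow> v \<in> TS p \<Longrightarrow> g p u v = g p v u"
  using metric_pointwise(1) tangent_space_carrier by blast

lemma metric_lincomb_left:
  "u \<in> TS p \<Longrightarrow> v \<in> TS p \<Longrightarrow> w \<in> TS p \<Longrightarrow>
    g p (\<lambda>h. a * u h + b * v h) w = a * g p u w + b * g p v w"
  by (drule (2) metric_pointwise(2)[OF tangent_space_carrier, rule_format, rotated 1]) auto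

lemma metric_lincomb_right:
  assumes "u \<in> TS p" "v \<in> TS p" "w \<in> TS p"
  shows "g p w (\<lambda>h. a * u h + b * v h) = a * g p w u + b * g p w v"
  using metric_lincomb_left[OF assms, of a b] metric_sym assms tangent_lincomb[OF assms(1,2)] by metis

lemma metric_nondegenerate:
  "u \<in> TS p \<Longrightarrow> (\<And>v. v \<in> TS p \<Longrightarrow> g p u v = 0) \<Longrightarrow> u = (\<lambda>h. 0)"
  using metric_pointwise(3)[OF tangent_space_carrier] by blast

lemma metric_smooth:
  "open W \<Longrightarrow> W \<subseteq> carrier_of A \<Longrightarrow> X \<in> VF W \<Longrightarrow> Y \<in> VF W \<Longrightarrow>
    smooth_fun_on A W (\<lambda>p. g p (X p) (Y p))"
  using conjunct2[OF metric[unfolded pseudo_riemannian_def]] by blast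

lemma metric_scale_left:
  assumes "u \<in> TS p" "w \<in> TS p"
  shows "g p (\<lambda>h. a * u h) w = a * g p u w"
  using metric_lincomb_left[OF assms(1,1,2), of a 0] by simp

lemma metric_scale_right:
  assumes "u \<in> TS p" "w \<in> TS p"
  shows "g p w (\<lambda>h. a * u h) = a * g p w u"
  using metric_lincomb_right[OF assms(1,1,2), of a 0] by simp

lemma metric_add_left:
  assumes "u \<in> TS p" "v \<in> TS p" "w \<in> TS p"
  shows "g p (\<lambda>h. u h + v h) w = g p u w + g p v w"
  using metric_lincomb_left[OF assms, of 1 1] by simp

lemma metric_add_right:
  assumes "u \<in> TS p" "v \<in> TS p" "w \<in> TS p"
  shows "g p w (\<lambda>h. u h + v h) = g p w u + g p w v"
  using metric_lincomb_right[OF assms, of 1 1] by simp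

lemma metric_zero_left:
  assumes "w \<in> TS p"
  shows "g p (\<lambda>h. 0) w = 0"
  using metric_scale_left[OF assms assms, of 0] by simp

lemma tangent_sum:
  assumes "p \<in> carrier_of A" "finite B" "\<And>i. i \<in> B \<Longrightarrow> v i \<in> TS p"
  shows "(\<lambda>h. \<Sum>i\<in>B. a i * v i h) \<in> TS p"
  using assms(2,3)
proof (induction B)
  case empty
  then show ?case by (simp add: tangent_zero assms(1))
next
  case (insert b B)
  then show ?case using tangent_lincomb[of "v b" p "\<lambda>h. \<Sum>i\<in>B. a i * v i h" "a b" 1] by simp
qed

lemma metric_sum_left:
  assumes "finite B" "\<And>i. i \<in> B \<Longrightarrow> v i \<in> TS p" "w \<in> TS p"
  shows "g p (\<lambda>h. \<Sum>i\<in>B. a i * v i h) w = (\<Sum>i\<in>B. a i * g p (v i) w)"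
  using assms(1,2)
proof (induction B)
  case empty
  then show ?case by (simp add: metric_zero_left assms(3))
next
  case (insert b B)
  have "(\<lambda>h. \<Sum>i\<in>B. a i * v i h) \<in> TS p"
    using insert tangent_space_carrier[OF assms(3)] by (intro tangent_sum) auto
  with insert show ?case
    using metric_lincomb_left[of "v b" p "\<lambda>h. \<Sum>i\<in>B. a i * v i h" w "a b" 1] assms(3) by simp
qed

section \<open>Orthonormal systems in one tangent space\<close>

definition orthonormal_at :: "'a \<Rightarrow> nat \<Rightarrow> (nat \<Rightarrow> 'a tangent_vector) \<Rightarrow> (nat \<Rightarrow> real) \<Rightarrow> bool" where
  "orthonormal_at p n e \<epsilon> \<longleftrightarrow> (\<forall>i<n. e i \<in> TS p \<and> \<epsilon> i \<in> {-1, 1} \<and>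
     (\<forall>j<n. g p (e i) (e j) = (if i = j then \<epsilon> i else 0)))"

lemma orthonormal_atD:
  assumes "orthonormal_at p n e \<epsilon>" "i < n"
  shows "e i \<in> TS p" "\<epsilon> i * \<epsilon> i = 1" "\<epsilon> i \<noteq> 0"
    "j < n \<Longrightarrow> g p (e i) (e j) = (if i = j then \<epsilon> i else 0)"
  using assms by (auto simp: orthonormal_at_def)

lemma orthonormal_component:
  assumes e: "orthonormal_at p n e \<epsilon>" and "j < n"
  shows "g p (\<lambda>h. \<Sum>i<n. c i * e i h) (e j) = c j * \<epsilon> j"
proof -
  have "g p (\<lambda>h. \<Sum>i<n. c i * e i h) (e j) = (\<Sum>i<n. c i * g p (e i) (e j))"
    using orthonormal_atD(1)[OF e] assms(2) by (intro metric_sum_left) auto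
  also have "\<dots> = (\<Sum>i<n. if i = j then c j * \<epsilon> j else 0)"
    using orthonormal_atD(4)[OF e _ assms(2)] by (intro sum.cong) auto
  finally show ?thesis using assms(2) by simp
qed

text \<open>Pairing a linear relation with \<open>e j\<close> isolates its coefficient times
  \<open>\<epsilon> j\<close>, which is nonzero; the vectors are therefore independent, and by their
  number they span. The same pairing yields the coefficients, with a factor
  \<open>\<epsilon> i\<close> from the signature.\<close>

lemma orthonormal_expansion:
  assumes e: "orthonormal_at p DIM('e) e \<epsilon>" and v: "v \<in> TS p"
  shows "v = (\<lambda>h. \<Sum>i<DIM('e). \<epsilon> i * g p v (e i) * e i h)"
proof -
  let ?n = "DIM('e)"
  obtain U \<phi> w where U: "(U, \<phi>) \<in> A" "p \<in> U" and w: "v = coordinate_vector A (U, \<phi>) p w"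
    using v by (rule tangentE)
  let ?c = "coordinate_vector A (U, \<phi>) p"
  \<comment> \<open>Independence and dimension are counted in the model space \<open>'e\<close>,
    where the library notions apply; tangent vectors themselves are functionals.\<close>
  have "\<forall>i<?n. \<exists>x. e i = ?c x"
    using orthonormal_atD(1)[OF e] tangent_space_eq[OF U] by blast
  then obtain u where u: "\<And>i. i < ?n \<Longrightarrow> e i = ?c (u i)" by metis
  have inj: "inj_on u {..<?n}"
  proof (rule inj_onI)
    fix i j assume ij: "i \<in> {..<?n}" "j \<in> {..<?n}" "u i = u j"
    then have "e i = e j" using u by simp
    then have "g p (e i) (e j) \<noteq> 0" using orthonormal_atD(3)[OF e, of i] orthonormal_atD(4)[OF e, of i i] ij by simp
    then show "i = j" using orthonormal_atD(4)[OF e, of i j] ij by (auto split: if_splits)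
  qed
  have comb: "?c (\<Sum>i<?n. k i *\<^sub>R u i) = (\<lambda>h. \<Sum>i<?n. k i * e i h)" for k
    unfolding coordinate_vector_sum[OF U] using u by (intro ext sum.cong) auto
  have "independent (u ` {..<?n})"
  proof (rule independent_if_scalars_zero)
    fix k x assume k: "(\<Sum>x\<in>u ` {..<?n}. k x *\<^sub>R x) = 0" and "x \<in> u ` {..<?n}"
    then obtain j where j: "j < ?n" "x = u j" by auto
    have "(\<Sum>i<?n. k (u i) *\<^sub>R u i) = 0" using k by (simp add: sum.reindex[OF inj] o_def)
    then have "(\<lambda>h. \<Sum>i<?n. k (u i) * e i h) = (\<lambda>h. 0)"
      using comb[of "\<lambda>i. k (u i)"] linear_0[OF coordinate_vector_linear[OF U]] by (simp add: fun_eq_iff)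
    then have "k (u j) * \<epsilon> j = 0"
      using orthonormal_component[OF e j(1), of "\<lambda>i. k (u i)"] metric_zero_left[OF orthonormal_atD(1)[OF e j(1)]]
      by simp
    then show "k x = 0" using orthonormal_atD(3)[OF e j(1)] j(2) by simp
  qed simp
  moreover have "card (u ` {..<?n}) = ?n" using inj by (simp add: card_image)
  ultimately have "span (u ` {..<?n}) = UNIV"
    using dim_eq_card_independent dim_eq_full by metis
  then have "w \<in> span (u ` {..<?n})" by simp
  then obtain k where "w = (\<Sum>x\<in>u ` {..<?n}. k x *\<^sub>R x)"
    by (subst (asm) span_finite) auto
  then have "w = (\<Sum>i<?n. k (u i) *\<^sub>R u i)" by (simp add: sum.reindex[OF inj] o_def)
  then have vk: "v = (\<lambda>h. \<Sum>i<?n. k (u i) * e i h)" using w comb[of "\<lambda>i. k (u i)"] by simp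
  have "\<epsilon> i * g p v (e i) = k (u i)" if "i < ?n" for i
    using orthonormal_component[OF e that, of "\<lambda>i. k (u i)"] orthonormal_atD(2)[OF e that]
    by (simp add: vk[symmetric] mult.left_commute[of "\<epsilon> i"])
  then show ?thesis by (subst vk) (intro ext sum.cong, auto)
qed

lemma orthonormal_eqI:
  assumes e: "orthonormal_at p DIM('e) e \<epsilon>" and v: "v \<in> TS p" "w \<in> TS p"
    and eq: "\<And>i. i < DIM('e) \<Longrightarrow> g p v (e i) = g p w (e i)"
  shows "v = w"
  by (subst orthonormal_expansion[OF e v(1)], subst orthonormal_expansion[OF e v(2)])
    (simp add: eq)

lemma orthogonal_complement_exists:
  assumes e: "orthonormal_at p k e \<epsilon>" and k: "k < DIM('e)" and p: "p \<in> carrier_of A"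
  obtains v where "v \<in> TS p" "\<And>i. i < k \<Longrightarrow> g p v (e i) = 0" "v \<noteq> (\<lambda>h. 0)"
proof -
  obtain U \<phi> where U: "(U, \<phi>) \<in> A" "p \<in> U" using p by (rule carrierE)
  let ?c = "coordinate_vector A (U, \<phi>) p"
  \<comment> \<open>\<open>a i\<close> represents the functional pairing with \<open>e i\<close>
    through the Euclidean inner product of the chart: the metric product of \<open>?c w\<close> with
    \<open>e i\<close> is \<open>w \<bullet> a i\<close>. Fewer than \<open>DIM('e)\<close> vectors
    leave a nonzero Euclidean orthogonal \<open>w\<close>.\<close>
  define a where "a i = (\<Sum>b\<in>Basis. g p (?c b) (e i) *\<^sub>R b)" for i
  have "dim (a ` {..<k}) \<le> card (a ` {..<k})" by (rule dim_le_card') simp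
  also have "\<dots> \<le> k" using card_image_le[of "{..<k}" a] by simp
  finally obtain w where w: "w \<noteq> 0" "\<And>y. y \<in> span (a ` {..<k}) \<Longrightarrow> orthogonal w y"
    using k orthogonal_to_subspace_exists[of "a ` {..<k}"] by (metis order.strict_trans1)
  have "g p (?c w) (e i) = 0" if i: "i < k" for i
  proof -
    have "?c w = (\<lambda>h. \<Sum>b\<in>Basis. (w \<bullet> b) * ?c b h)"
      using coordinate_vector_sum[OF U, of "\<lambda>b. w \<bullet> b" "\<lambda>b. b" Basis] by (simp add: euclidean_representation)
    then have "g p (?c w) (e i) = (\<Sum>b\<in>Basis. (w \<bullet> b) * g p (?c b) (e i))"
      using metric_sum_left[of Basis ?c p "e i" "\<lambda>b. w \<bullet> b"] coordinate_vector_in_tangent_space[OF U]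
        orthonormal_atD(1)[OF e i] by simp
    also have "\<dots> = w \<bullet> a i" by (simp add: a_def inner_sum_right mult.commute)
    also have "\<dots> = 0" using w(2)[OF span_base[of "a i"]] i by (simp add: orthogonal_def)
    finally show ?thesis .
  qed
  moreover have "?c w \<noteq> (\<lambda>h. 0)"
  proof
    assume "?c w = (\<lambda>h. 0)"
    then have "w \<bullet> w = 0" using coordinate_vector_coordinate[OF U, of w w] by simp
    then show False using w(1) by simp
  qed
  ultimately show ?thesis using that coordinate_vector_in_tangent_space[OF U] by blast
qed

text \<open>In indefinite signature a vector of the complement may be null and cannot be normalized.
  If all of them were null, polarization would make the metric vanish on the complement, and a
  nonzero vector there would be orthogonal to the whole tangent space, against
  nondegeneracy.\<close>

lemma nonnull_complement_exists:
  assumes e: "orthonormal_at p k e \<epsilon>" and k: "k < DIM('e)" and p: "p \<in> carrier_of A"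
  obtains v where "v \<in> TS p" "\<And>i. i < k \<Longrightarrow> g p v (e i) = 0" "g p v v \<noteq> 0"
proof (rule ccontr)
  assume "\<not> thesis"
  with that have null: "g p v v = 0" if "v \<in> TS p" "\<And>i. i < k \<Longrightarrow> g p v (e i) = 0" for v
    using that by blast
  obtain v where v: "v \<in> TS p" "\<And>i. i < k \<Longrightarrow> g p v (e i) = 0" "v \<noteq> (\<lambda>h. 0)"
    using orthogonal_complement_exists[OF assms] by blast
  have "g p v w = 0" if w: "w \<in> TS p" for w
  proof -
    let ?s = "\<lambda>h. \<Sum>i<k. (\<epsilon> i * g p w (e i)) * e i h"
    \<comment> \<open>\<open>w'\<close> is the projection of \<open>w\<close> to the complement of
      the \<open>e i\<close>. Since \<open>v\<close> is orthogonal to every \<open>e i\<close>,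
      pairing \<open>v\<close> with \<open>w\<close> or with \<open>w'\<close> gives the same
      number.\<close>
    define w' where "w' = (\<lambda>h. 1 * w h + (-1) * ?s h)"
    have s: "?s \<in> TS p" using orthonormal_atD(1)[OF e] by (intro tangent_sum p) auto
    have w': "w' \<in> TS p" unfolding w'_def using w s by (rule tangent_lincomb)
    have orth: "g p w' (e i) = 0" if "i < k" for i
      unfolding w'_def metric_lincomb_left[OF w s orthonormal_atD(1)[OF e that]]
        orthonormal_component[OF e that] using orthonormal_atD(2)[OF e that] by simp
    have vw': "(\<lambda>h. 1 * v h + 1 * w' h) \<in> TS p" using v(1) w' by (rule tangent_lincomb)
    have "g p (\<lambda>h. 1 * v h + 1 * w' h) (\<lambda>h. 1 * v h + 1 * w' h) = 0"
    proof (rule null[OF vw'])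
      show "g p (\<lambda>h. 1 * v h + 1 * w' h) (e i) = 0" if "i < k" for i
        unfolding metric_lincomb_left[OF v(1) w' orthonormal_atD(1)[OF e that]]
        using v(2) orth that by simp
    qed
    \<comment> \<open>Polarization: \<open>v\<close>, \<open>w'\<close> and their sum all lie in the
      complement and are null, so twice the mixed product vanishes.\<close>
    then have "g p v w' = 0"
      unfolding metric_lincomb_left[OF v(1) w' vw'] metric_lincomb_right[OF v(1) w' v(1)]
        metric_lincomb_right[OF v(1) w' w']
      using null[OF v(1,2)] null[OF w' orth] metric_sym[OF v(1) w'] by simp
    moreover have "g p v w' = g p v w - g p v ?s"
      unfolding w'_def metric_lincomb_right[OF w s v(1)] by simp
    moreover have "g p v ?s = 0"
    proof -
      have "g p ?s v = (\<Sum>i<k. (\<epsilon> i * g p w (e i)) * g p (e i) v)"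
        using orthonormal_atD(1)[OF e] v(1) by (intro metric_sum_left) auto
      also have "\<dots> = 0"
        using v(2) metric_sym[OF v(1) orthonormal_atD(1)[OF e]] by (intro sum.neutral) simp
      finally show ?thesis using metric_sym[OF v(1) s] by simp
    qed
    ultimately show ?thesis by simp
  qed
  with v metric_nondegenerate show False by blast
qed

section \<open>Gram-Schmidt on a neighbourhood\<close>

definition orthonormal_on :: "'a set \<Rightarrow> nat \<Rightarrow> (nat \<Rightarrow> 'a vector_field) \<Rightarrow> (nat \<Rightarrow> real) \<Rightarrow> bool" where
  "orthonormal_on W n E \<epsilon> \<longleftrightarrow> (\<forall>i<n. E i \<in> VF W) \<and> (\<forall>q\<in>W. orthonormal_at q n (\<lambda>i. E i q) \<epsilon>)
     \<and> (\<forall>i<n. \<epsilon> i \<in> {-1, 1})"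

text \<open>The separate sign clause of \<open>orthonormal_on\<close> makes this exact also for
  empty \<open>W\<close>, where the pointwise condition says nothing about
  \<open>\<epsilon>\<close>. The explicit length lets the construction induct on the number of
  fields.\<close>

lemma orthonormal_frame_on_iff: "orthonormal_frame_on A g W E \<epsilon> \<longleftrightarrow> orthonormal_on W DIM('e) E \<epsilon>"
  unfolding orthonormal_frame_on_def orthonormal_on_def orthonormal_at_def
  by (auto intro: vector_field_tangent)

lemma orthonormal_onD:
  assumes "orthonormal_on W n E \<epsilon>"
  shows "i < n \<Longrightarrow> E i \<in> VF W" "q \<in> W \<Longrightarrow> orthonormal_at q n (\<lambda>i. E i q) \<epsilon>"
    "i < n \<Longrightarrow> \<epsilon> i * \<epsilon> i = 1"
  using assms by (auto simp: orthonormal_on_def)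

lemma orthonormal_on_subset: "orthonormal_on W n E \<epsilon> \<Longrightarrow> V \<subseteq> W \<Longrightarrow> orthonormal_on V n E \<epsilon>"
  by (auto simp: orthonormal_on_def intro: vector_fields_subset)

text \<open>One Gram-Schmidt step for fields. A non-null vector orthogonal to the frame at
  \<open>p\<close> is extended to a field and projected; at \<open>p\<close> the projection changes
  nothing, so the square of the projected field is nonzero there and, by continuity, keeps its sign
  on a smaller neighbourhood.\<close>

lemma orthonormal_extend:
  assumes W: "open W" "p \<in> W" "W \<subseteq> carrier_of A" and E: "orthonormal_on W k E \<epsilon>" and k: "k < DIM('e)"
  obtains W' E' \<epsilon>' where "open W'" "p \<in> W'" "W' \<subseteq> W" "orthonormal_on W' (Suc k) E' \<epsilon>'"
proof -
  have p: "p \<in> carrier_of A" using W by auto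
  obtain v where v: "v \<in> TS p" "\<And>i. i < k \<Longrightarrow> g p v (E i p) = 0" "g p v v \<noteq> 0"
    using nonnull_complement_exists[OF orthonormal_onD(2)[OF E W(2)] k p] by blast
  obtain U \<phi> u where U: "(U, \<phi>) \<in> A" "p \<in> U" and u: "v = coordinate_vector A (U, \<phi>) p u"
    using v(1) by (rule tangentE)
  \<comment> \<open>The extension with constant components in the chart; it is smooth and takes the
    value \<open>v\<close> at \<open>p\<close>.\<close>
  define V where "V = (\<lambda>q. coordinate_vector A (U, \<phi>) q u)"
  define W1 where "W1 = W \<inter> U"
  have W1: "open W1" "p \<in> W1" "W1 \<subseteq> carrier_of A" "W1 \<subseteq> W"
    using W U chart_open by (auto simp: W1_def)
  have V: "V \<in> VF W1"
    unfolding V_def by (rule vector_fields_subset[OF coordinate_field[OF U(1)]]) (simp add: W1_def)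
  have E1: "orthonormal_on W1 k E \<epsilon>" using E W1(4) by (rule orthonormal_on_subset)
  let ?S = "\<lambda>q h. \<Sum>i<k. (\<epsilon> i * g q (V q) (E i q)) * E i q h"
  have S: "?S \<in> VF W1"
    using orthonormal_onD(1)[OF E1] V W1
    by (intro vf_sum_closed smooth_fun_on_mult smooth_fun_on_const metric_smooth) auto
  define N where "N = vf_add V (vf_scale (\<lambda>q. -1) ?S)"
  have N: "N \<in> VF W1"
    unfolding N_def by (intro vf_add_closed V vf_scale_closed S smooth_fun_on_const)
  have Nq: "N q = (\<lambda>h. 1 * V q h + (-1) * ?S q h)" for q by (simp add: N_def vf_add_def vf_scale_def)
  have orth: "g q (N q) (E i q) = 0" if q: "q \<in> W1" and i: "i < k" for q i
    unfolding Nq metric_lincomb_left[OF vector_field_tangent[OF V q] vector_field_tangent[OF S q]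
        vector_field_tangent[OF orthonormal_onD(1)[OF E1 i] q]]
      orthonormal_component[OF orthonormal_onD(2)[OF E1 q] i]
    using orthonormal_onD(3)[OF E1 i] by simp
  have Vp: "V p = v" by (simp add: V_def u)
  have "?S p = (\<lambda>h. 0)" using v(2) Vp by simp
  then have Sp: "?S p h = 0" for h by (rule fun_cong)
  have Np: "N p = v"
  proof
    fix h
    have "N p h = 1 * V p h + (-1) * ?S p h" by (rule fun_cong[OF Nq])
    also have "\<dots> = 1 * V p h + (-1) * 0" by (simp only: Sp)
    finally show "N p h = v h" by (simp add: Vp)
  qed
  define c where "c = (\<lambda>q. g q (N q) (N q))"
  have c: "smooth_fun_on A W1 c" unfolding c_def by (rule metric_smooth[OF W1(1,3) N N])
  \<comment> \<open>The causal character of the new vector. Near \<open>p\<close> the product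
    \<open>\<sigma> * c q\<close> is the absolute value of \<open>c q\<close>, but visibly
    smooth.\<close>
  define \<sigma> where "\<sigma> = sgn (c p)"
  have cp: "c p \<noteq> 0" using v(3) by (simp add: c_def Np)
  have \<sigma>: "\<sigma> * \<sigma> = 1" "\<sigma> \<in> {-1, 1}" using cp by (auto simp: \<sigma>_def sgn_if)
  have sc: "smooth_fun_on A W1 (\<lambda>q. \<sigma> * c q)"
    by (intro smooth_fun_on_mult smooth_fun_on_const c W1)
  define W' where "W' = W1 \<inter> (\<lambda>q. \<sigma> * c q) -` {0<..}"
  have W': "open W'" "W' \<subseteq> W1" "W' \<subseteq> carrier_of A"
    using continuous_open_preimage[OF smooth_fun_on_imp_continuous_on[OF W1(1,3) sc] W1(1) open_greaterThan]
      W1 by (auto simp: W'_def)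
  have pW': "p \<in> W'" using W1(2) cp by (auto simp: W'_def \<sigma>_def sgn_if)
  \<comment> \<open>Inverse square root of the absolute square; it scales the square of
    \<open>N\<close> from \<open>c q\<close> to \<open>\<sigma>\<close>.\<close>
  define r where "r = (\<lambda>q. (\<sigma> * c q) powr (-1/2))"
  have r: "smooth_fun_on A W' r"
    unfolding r_def
    by (rule smooth_fun_on_compose[OF W'(1) smooth_fun_on_subset[OF sc W'(2)] open_greaterThan smooth_on_powr])
      (auto simp: W'_def)
  have rc: "r q * (r q * c q) = \<sigma>" if "q \<in> W'" for q
  proof -
    have pos: "0 < \<sigma> * c q" using that by (simp add: W'_def)
    have "r q * r q = (\<sigma> * c q) powr (-1)" unfolding r_def powr_add[symmetric] by simp
    also have "\<dots> = 1 / (\<sigma> * c q)" using pos by (simp add: powr_minus divide_inverse)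
    finally have "r q * (r q * c q) = c q / (\<sigma> * c q)" by (simp add: mult.assoc[symmetric])
    also have "\<dots> = \<sigma>" using pos \<sigma> by auto
    finally show ?thesis .
  qed
  define E' where "E' = E(k := vf_scale r N)"
  define \<epsilon>' where "\<epsilon>' = \<epsilon>(k := \<sigma>)"
  have E2: "orthonormal_on W' k E \<epsilon>" using E1 W'(2) by (rule orthonormal_on_subset)
  have N2: "N \<in> VF W'" using N W'(2) by (rule vector_fields_subset)
  have Ek: "vf_scale r N \<in> VF W'" using N2 r by (rule vf_scale_closed)
  have rN: "g q (vf_scale r N q) w = r q * g q (N q) w" if "q \<in> W'" "w \<in> TS q" for q w
    unfolding vf_scale_def by (rule metric_scale_left[OF vector_field_tangent[OF N2 that(1)] that(2)])
  have kk: "g q (vf_scale r N q) (vf_scale r N q) = \<sigma>" if q: "q \<in> W'" for q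
    using rN[OF q vector_field_tangent[OF Ek q]] rN[OF q vector_field_tangent[OF N2 q]] rc[OF q]
      metric_sym[OF vector_field_tangent[OF N2 q] vector_field_tangent[OF Ek q]]
    by (simp add: c_def)
  have ki: "g q (vf_scale r N q) (E i q) = 0" "g q (E i q) (vf_scale r N q) = 0" if q: "q \<in> W'" and i: "i < k" for q i
    using rN[OF q vector_field_tangent[OF orthonormal_onD(1)[OF E2 i] q]] orth[of q i] q i W'(2)
      metric_sym[OF vector_field_tangent[OF orthonormal_onD(1)[OF E2 i] q] vector_field_tangent[OF Ek q]]
    by auto
  have E'_on: "orthonormal_on W' (Suc k) E' \<epsilon>'"
    unfolding orthonormal_on_def
  proof (intro conjI allI impI ballI)
    show "E' i \<in> VF W'" if "i < Suc k" for i
      using that Ek orthonormal_onD(1)[OF E2, of i] by (auto simp: E'_def less_Suc_eq)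
    show "\<epsilon>' i \<in> {-1, 1}" if "i < Suc k" for i
      using that \<sigma>(2) E2 by (auto simp: \<epsilon>'_def less_Suc_eq orthonormal_on_def)
    fix q assume q: "q \<in> W'"
    show "orthonormal_at q (Suc k) (\<lambda>i. E' i q) \<epsilon>'"
      unfolding orthonormal_at_def
    proof (intro allI impI conjI)
      fix i assume i: "i < Suc k"
      show "E' i q \<in> TS q"
        using i vector_field_tangent[OF Ek q] vector_field_tangent[OF orthonormal_onD(1)[OF E2] q]
        by (auto simp: E'_def less_Suc_eq)
      show "\<epsilon>' i \<in> {-1, 1}"
        using i \<sigma>(2) E2 by (auto simp: \<epsilon>'_def less_Suc_eq orthonormal_on_def)
      fix j assume j: "j < Suc k"
      show "g q (E' i q) (E' j q) = (if i = j then \<epsilon>' i else 0)"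
        using i j kk[OF q] ki[OF q] orthonormal_atD(4)[OF orthonormal_onD(2)[OF E2 q], of i j]
        by (auto simp: E'_def \<epsilon>'_def less_Suc_eq)
    qed
  qed
  show ?thesis by (rule that[OF W'(1) pW' order_trans[OF W'(2) W1(4)] E'_on])
qed

lemma orthonormal_frame_exists:
  assumes p: "p \<in> carrier_of A"
  obtains W E \<epsilon> where "open W" "p \<in> W" "W \<subseteq> carrier_of A" "orthonormal_frame_on A g W E \<epsilon>"
proof -
  have "\<exists>W E \<epsilon>. open W \<and> p \<in> W \<and> W \<subseteq> carrier_of A \<and> orthonormal_on W k E \<epsilon>" if "k \<le> DIM('e)" for k
    using that
  proof (induction k)
    case 0
    have "orthonormal_on (carrier_of A) 0 E \<epsilon>" for E \<epsilon>
      by (simp add: orthonormal_on_def orthonormal_at_def)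
    then show ?case using open_carrier p by blast
  next
    case (Suc k)
    then obtain W E \<epsilon> where W: "open W" "p \<in> W" "W \<subseteq> carrier_of A" and E: "orthonormal_on W k E \<epsilon>"
      by auto
    have "k < DIM('e)" using Suc.prems by simp
    from orthonormal_extend[OF W E this] obtain W' E' \<epsilon>'
      where "open W'" "p \<in> W'" "W' \<subseteq> W" "orthonormal_on W' (Suc k) E' \<epsilon>'" by metis
    with W show ?case by blast
  qed
  from this[of "DIM('e)"] that show ?thesis by (auto simp: orthonormal_frame_on_iff)
qed

lemma local_frameE:
  assumes p: "p \<in> carrier_of A"
  obtains W E \<epsilon> where "open W" "p \<in> W" "W \<subseteq> carrier_of A" "orthonormal_on W DIM('e) E \<epsilon>"
    "local_frame A g p = (E, \<epsilon>)"
proof -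
  obtain W E \<epsilon> where "open W" "p \<in> W" "W \<subseteq> carrier_of A" "orthonormal_frame_on A g W E \<epsilon>"
    using p by (rule orthonormal_frame_exists)
  then have "\<exists>x. (\<lambda>(E, \<epsilon>). \<exists>W. open W \<and> p \<in> W \<and> W \<subseteq> carrier_of A \<and> orthonormal_frame_on A g W E \<epsilon>) x"
    by (intro exI[of _ "(E, \<epsilon>)"]) auto
  from someI_ex[OF this]
  have "case local_frame A g p of (E, \<epsilon>) \<Rightarrow>
      \<exists>W. open W \<and> p \<in> W \<and> W \<subseteq> carrier_of A \<and> orthonormal_on W DIM('e) E \<epsilon>"
    unfolding local_frame_def orthonormal_frame_on_iff .
  with that show ?thesis by (cases "local_frame A g p") auto
qed

section \<open>Tensorial functionals and traces over frames\<close>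

definition tensorial :: "'a set \<Rightarrow> 'a \<Rightarrow> ('a vector_field \<Rightarrow> real) \<Rightarrow> bool" where
  "tensorial W p F \<longleftrightarrow>
     (\<forall>X\<in>VF W. \<forall>Y\<in>VF W. F (vf_add X Y) = F X + F Y) \<and>
     (\<forall>X\<in>VF W. \<forall>k. smooth_fun_on A W k \<longrightarrow> F (vf_scale k X) = k p * F X) \<and>
     (\<forall>X\<in>VF W. \<forall>Y\<in>VF W. (\<forall>q\<in>W. X q = Y q) \<longrightarrow> F X = F Y)"

lemma tensorialD:
  assumes "tensorial W p F" "X \<in> VF W"
  shows "Y \<in> VF W \<Longrightarrow> F (vf_add X Y) = F X + F Y"
    "smooth_fun_on A W k \<Longrightarrow> F (vf_scale k X) = k p * F X"
    "Y \<in> VF W \<Longrightarrow> (\<And>q. q \<in> W \<Longrightarrow> X q = Y q) \<Longrightarrow> F X = F Y"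
proof -
  note F = assms(1)[unfolded tensorial_def]
  show "Y \<in> VF W \<Longrightarrow> F (vf_add X Y) = F X + F Y"
    by (rule bspec[OF bspec[OF conjunct1[OF F] assms(2)]])
  show "smooth_fun_on A W k \<Longrightarrow> F (vf_scale k X) = k p * F X"
    by (rule bspec[OF conjunct1[OF conjunct2[OF F]] assms(2), rule_format])
  show "Y \<in> VF W \<Longrightarrow> (\<And>q. q \<in> W \<Longrightarrow> X q = Y q) \<Longrightarrow> F X = F Y"
    by (rule bspec[OF conjunct2[OF conjunct2[OF F]] assms(2), rule_format])
qed

lemma tensorialI:
  assumes "\<And>X Y. X \<in> VF W \<Longrightarrow> Y \<in> VF W \<Longrightarrow> F (vf_add X Y) = F X + F Y"
    "\<And>X k. X \<in> VF W \<Longrightarrow> smooth_fun_on A W k \<Longrightarrow> F (vf_scale k X) = k p * F X"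
    "\<And>X Y. X \<in> VF W \<Longrightarrow> Y \<in> VF W \<Longrightarrow> (\<And>q. q \<in> W \<Longrightarrow> X q = Y q) \<Longrightarrow> F X = F Y"
  shows "tensorial W p F"
  unfolding tensorial_def
proof (intro conjI ballI allI impI)
  fix X Y assume "X \<in> VF W" "Y \<in> VF W"
  then show "F (vf_add X Y) = F X + F Y" by (rule assms(1))
next
  fix X k assume "X \<in> VF W" "smooth_fun_on A W k"
  then show "F (vf_scale k X) = k p * F X" by (rule assms(2))
next
  fix X Y assume XY: "X \<in> VF W" "Y \<in> VF W" and eq: "\<forall>q\<in>W. X q = Y q"
  show "F X = F Y" by (rule assms(3)[OF XY bspec[OF eq]])
qed

lemma tensorial_sum:
  assumes F: "tensorial W p F" and W: "W \<subseteq> carrier_of A" and B: "finite B"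
    and X: "\<And>i. i \<in> B \<Longrightarrow> X i \<in> VF W" and a: "\<And>i. i \<in> B \<Longrightarrow> smooth_fun_on A W (a i)"
  shows "F (\<lambda>q h. \<Sum>i\<in>B. a i q * X i q h) = (\<Sum>i\<in>B. a i p * F (X i))"
  using B X a
proof (induction B)
  case empty
  have "F (vf_scale (\<lambda>q. 0) (\<lambda>q h. 0)) = 0 * F (\<lambda>q h. 0)"
    by (rule tensorialD(2)[OF F vf_zero_closed[OF W] smooth_fun_on_const])
  then show ?case by (simp add: vf_scale_def)
next
  case (insert b B)
  let ?R = "\<lambda>q h. \<Sum>i\<in>B. a i q * X i q h"
  have "?R \<in> VF W" using insert by (intro vf_sum_closed W) auto
  moreover have b: "X b \<in> VF W" "smooth_fun_on A W (a b)" using insert by auto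
  ultimately have "F (vf_add (vf_scale (a b) (X b)) ?R) = F (vf_scale (a b) (X b)) + F ?R"
    by (intro tensorialD(1)[OF F] vf_scale_closed)
  also have "F (vf_scale (a b) (X b)) = a b p * F (X b)"
    using b by (rule tensorialD(2)[OF F])
  finally show ?case using insert by (simp add: vf_add_def vf_scale_def)
qed

text \<open>The frame expansion of \<open>X\<close> holds on all of \<open>W\<close> with smooth
  coefficients, so tensoriality over \<open>W\<close> moves these outside, evaluated at
  \<open>p\<close>. Since field and expansion agree only on \<open>W\<close>, the extensionality
  clause of \<open>tensorial\<close> is what replaces one by the other.\<close>

lemma tensorial_expansion:
  assumes F: "tensorial W p F" and W: "open W" "W \<subseteq> carrier_of A"
    and E: "orthonormal_on W DIM('e) E \<epsilon>" and X: "X \<in> VF W"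
  shows "F X = (\<Sum>i<DIM('e). \<epsilon> i * g p (X p) (E i p) * F (E i))"
proof -
  let ?S = "\<lambda>q h. \<Sum>i<DIM('e). (\<epsilon> i * g q (X q) (E i q)) * E i q h"
  have a: "smooth_fun_on A W (\<lambda>q. \<epsilon> i * g q (X q) (E i q))" if "i < DIM('e)" for i
    using orthonormal_onD(1)[OF E that] W X
    by (intro smooth_fun_on_mult smooth_fun_on_const metric_smooth)
  have S: "?S \<in> VF W"
    using orthonormal_onD(1)[OF E] a W by (intro vf_sum_closed) auto
  have "X q = ?S q" if "q \<in> W" for q
    by (rule orthonormal_expansion[OF orthonormal_onD(2)[OF E that] vector_field_tangent[OF X that]])
  then have "F X = F ?S" by (rule tensorialD(3)[OF F X S])
  also have "\<dots> = (\<Sum>i<DIM('e). \<epsilon> i * g p (X p) (E i p) * F (E i))"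
    using orthonormal_onD(1)[OF E] a by (intro tensorial_sum[OF F W(2)]) auto
  finally show ?thesis .
qed

text \<open>Both arguments of \<open>B\<close> are expanded in the second frame, which gives a
  double sum with the matrix \<open>?a\<close> of mixed products. That matrix is pseudo-orthogonal,
  and its orthogonality relation collapses the double sum to the diagonal.\<close>

lemma frame_trace_eq:
  fixes E E' :: "nat \<Rightarrow> 'a vector_field"
  assumes W: "open W" "W \<subseteq> carrier_of A" "p \<in> W"
    and B1: "\<And>Y. Y \<in> VF W \<Longrightarrow> tensorial W p (\<lambda>X. B X Y)"
    and B2: "\<And>X. X \<in> VF W \<Longrightarrow> tensorial W p (\<lambda>Y. B X Y)"
    and E: "orthonormal_on W DIM('e) E \<epsilon>" and E': "orthonormal_on W DIM('e) E' \<epsilon>'"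
  shows "(\<Sum>i<DIM('e). \<epsilon> i * B (E i) (E i)) = (\<Sum>i<DIM('e). \<epsilon>' i * B (E' i) (E' i))"
proof -
  let ?n = "DIM('e)"
  note EV = orthonormal_onD(1)[OF E] and EV' = orthonormal_onD(1)[OF E']
  note ET = vector_field_tangent[OF EV W(3)] and ET' = vector_field_tangent[OF EV' W(3)]
  let ?a = "\<lambda>i j. g p (E i p) (E' j p)"
  have 1: "B (E i) (E i) = (\<Sum>j<?n. \<Sum>m<?n. \<epsilon>' j * \<epsilon>' m * (?a i j * ?a i m) * B (E' j) (E' m))" if i: "i < ?n" for i
  proof -
    have "B (E i) (E i) = (\<Sum>j<?n. \<epsilon>' j * ?a i j * B (E' j) (E i))"
      by (rule tensorial_expansion[OF B1[OF EV[OF i]] W(1,2) E' EV[OF i]])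
    also have "\<dots> = (\<Sum>j<?n. \<epsilon>' j * ?a i j * (\<Sum>m<?n. \<epsilon>' m * ?a i m * B (E' j) (E' m)))"
    proof (intro sum.cong refl)
      fix j assume "j \<in> {..<?n}"
      then have "B (E' j) (E i) = (\<Sum>m<?n. \<epsilon>' m * ?a i m * B (E' j) (E' m))"
        by (intro tensorial_expansion[OF B2[OF EV'] W(1,2) E' EV[OF i]]) simp
      then show "\<epsilon>' j * ?a i j * B (E' j) (E i) = \<epsilon>' j * ?a i j * (\<Sum>m<?n. \<epsilon>' m * ?a i m * B (E' j) (E' m))"
        by simp
    qed
    finally show ?thesis by (simp add: sum_distrib_left mult_ac)
  qed
  \<comment> \<open>The relation comes from expanding \<open>E' j p\<close> in the first frame and
    pairing it with \<open>E' m p\<close>.\<close>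
  have 2: "(\<Sum>i<?n. \<epsilon> i * (?a i j * ?a i m)) = (if j = m then \<epsilon>' j else 0)" if jm: "j < ?n" "m < ?n" for j m
  proof -
    have "E' j p = (\<lambda>h. \<Sum>i<?n. \<epsilon> i * g p (E' j p) (E i p) * E i p h)"
      by (rule orthonormal_expansion[OF orthonormal_onD(2)[OF E W(3)] ET'[OF jm(1)]])
    then have "g p (E' j p) (E' m p) = g p (\<lambda>h. \<Sum>i<?n. \<epsilon> i * g p (E' j p) (E i p) * E i p h) (E' m p)"
      by (rule arg_cong)
    also have "\<dots> = (\<Sum>i<?n. \<epsilon> i * g p (E' j p) (E i p) * g p (E i p) (E' m p))"
      using ET ET'[OF jm(2)] by (intro metric_sum_left) auto
    also have "\<dots> = (\<Sum>i<?n. \<epsilon> i * (?a i j * ?a i m))"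
      using metric_sym[OF ET'[OF jm(1)] ET] by (intro sum.cong) (auto simp: mult.assoc)
    finally show ?thesis
      using orthonormal_atD(4)[OF orthonormal_onD(2)[OF E' W(3)] jm] by simp
  qed
  have "(\<Sum>i<?n. \<epsilon> i * B (E i) (E i)) =
      (\<Sum>i<?n. \<Sum>j<?n. \<Sum>m<?n. \<epsilon>' j * \<epsilon>' m * B (E' j) (E' m) * (\<epsilon> i * (?a i j * ?a i m)))"
    using 1 by (intro sum.cong refl) (simp add: sum_distrib_left mult_ac)
  also have "\<dots> = (\<Sum>j<?n. \<Sum>m<?n. \<epsilon>' j * \<epsilon>' m * B (E' j) (E' m) * (\<Sum>i<?n. \<epsilon> i * (?a i j * ?a i m)))"
    unfolding sum_distrib_left
    by (subst sum.swap, rule sum.cong[OF refl], subst sum.swap, rule refl)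
  also have "\<dots> = (\<Sum>j<?n. \<Sum>m<?n. if j = m then \<epsilon>' j * \<epsilon>' m * B (E' j) (E' m) * \<epsilon>' j else 0)"
    using 2 by (intro sum.cong refl) simp
  also have "\<dots> = (\<Sum>j<?n. \<epsilon>' j * B (E' j) (E' j))"
    using orthonormal_onD(3)[OF E'] by (intro sum.cong refl) (simp add: mult_ac)
  finally show ?thesis .
qed

end

section \<open>Curvature as a tensor\<close>

text \<open>Bracket closure is an assumption because the locale also serves a connection with
  torsion, which cannot supply it. Both instances obtain it from the Levi-Civita connection of the
  same metric.\<close>

locale connection_manifold = metric_manifold A g
  for A :: "('a::{t2_space, second_countable_topology}, 'e::euclidean_space) chart set" and g +
  fixes nab :: "'a connection"
  assumes affine: "affine_connection A nab"
    and bracket_closed: "\<And>W X Y. open W \<Longrightarrow> W \<subseteq> carrier_of A \<Longrightarrow> X \<in> VF W \<Longrightarrow>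
      Y \<in> VF W \<Longrightarrow> lie_bracket A X Y \<in> VF W"
begin

lemma affine_rules:
  assumes "open W" "W \<subseteq> carrier_of A" "X \<in> VF W" "Y \<in> VF W"
  shows nab_closed: "nab X Y \<in> VF W"
    and "\<forall>X'\<in>VF W. \<forall>Y'\<in>VF W.
        (\<forall>p\<in>W. X' p = X p \<and> Y' p = Y p) \<longrightarrow> (\<forall>p\<in>W. nab X' Y' p = nab X Y p)"
    and "\<forall>Z\<in>VF W. \<forall>p\<in>W.
        nab (vf_add X Z) Y p = vf_add (nab X Y) (nab Z Y) p \<and>
        nab X (vf_add Y Z) p = vf_add (nab X Y) (nab X Z) p"
    and "\<forall>k. smooth_fun_on A W k \<longrightarrow> (\<forall>p\<in>W. nab (vf_scale k X) Y p = vf_scale k (nab X Y) p \<and>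
        nab X (vf_scale k Y) p = vf_add (vf_scale (\<lambda>q. X q k) Y) (vf_scale k (nab X Y)) p)"
proof -
  have "\<forall>X\<in>VF W. \<forall>Y\<in>VF W.
          nab X Y \<in> VF W \<and>
          (\<forall>X'\<in>VF W. \<forall>Y'\<in>VF W.
             (\<forall>p\<in>W. X' p = X p \<and> Y' p = Y p) \<longrightarrow> (\<forall>p\<in>W. nab X' Y' p = nab X Y p)) \<and>
          (\<forall>Z\<in>VF W. \<forall>p\<in>W.
             nab (vf_add X Z) Y p = vf_add (nab X Y) (nab Z Y) p \<and>
             nab X (vf_add Y Z) p = vf_add (nab X Y) (nab X Z) p) \<and>
          (\<forall>k. smooth_fun_on A W k \<longrightarrow> (\<forall>p\<in>W.
             nab (vf_scale k X) Y p = vf_scale k (nab X Y) p \<and>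
             nab X (vf_scale k Y) p
               = vf_add (vf_scale (\<lambda>q. X q k) Y) (vf_scale k (nab X Y)) p))"
    using affine[unfolded affine_connection_def, rule_format, OF assms(1,2)] by (intro ballI) 
  note * = bspec[OF bspec[OF this assms(3)] assms(4)]
  show "nab X Y \<in> VF W" using * by (elim conjE)
  show "\<forall>X'\<in>VF W. \<forall>Y'\<in>VF W.
        (\<forall>p\<in>W. X' p = X p \<and> Y' p = Y p) \<longrightarrow> (\<forall>p\<in>W. nab X' Y' p = nab X Y p)" using * by (elim conjE)
  show "\<forall>Z\<in>VF W. \<forall>p\<in>W.
        nab (vf_add X Z) Y p = vf_add (nab X Y) (nab Z Y) p \<and>
        nab X (vf_add Y Z) p = vf_add (nab X Y) (nab X Z) p" using * by (elim conjE)
  show "\<forall>k. smooth_fun_on A W k \<longrightarrow> (\<forall>p\<in>W. nab (vf_scale k X) Y p = vf_scale k (nab X Y) p \<and>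
        nab X (vf_scale k Y) p = vf_add (vf_scale (\<lambda>q. X q k) Y) (vf_scale k (nab X Y)) p)" using * by (elim conjE)
qed

text \<open>The double trace of \<open>scalar_curvature\<close>, with an explicit frame in place of
  the arbitrary \<open>local_frame\<close>.\<close>

definition scalar_sum :: "'a \<Rightarrow> (nat \<Rightarrow> 'a vector_field) \<Rightarrow> (nat \<Rightarrow> real) \<Rightarrow> real" where
  "scalar_sum p E \<epsilon> = (\<Sum>i<DIM('e). \<epsilon> i * (\<Sum>k<DIM('e). \<epsilon> k * g p (curvature A nab (E i) (E k) (E i) p) (E k p)))"

section \<open>Connection and bracket over a fixed open set\<close>

context
  fixes W assumes W: "open W" "W \<subseteq> carrier_of A"
begin

lemmas closed = nab_closed[OF W]

lemma nab_cong:
  assumes "X \<in> VF W" "Y \<in> VF W" "X' \<in> VF W" "Y' \<in> VF W"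
    "\<And>q. q \<in> W \<Longrightarrow> X' q = X q" "\<And>q. q \<in> W \<Longrightarrow> Y' q = Y q" "p \<in> W"
  shows "nab X' Y' p = nab X Y p"
  using affine_rules(2)[OF W assms(1,2)] assms(3-) by blast

lemma nab_add_left:
  "X \<in> VF W \<Longrightarrow> Z \<in> VF W \<Longrightarrow> Y \<in> VF W \<Longrightarrow> p \<in> W \<Longrightarrow>
    nab (vf_add X Z) Y p = vf_add (nab X Y) (nab Z Y) p"
  using affine_rules(3)[OF W] by blast

lemma nab_add_right:
  "X \<in> VF W \<Longrightarrow> Y \<in> VF W \<Longrightarrow> Z \<in> VF W \<Longrightarrow> p \<in> W \<Longrightarrow>
    nab X (vf_add Y Z) p = vf_add (nab X Y) (nab X Z) p"
  using affine_rules(3)[OF W] by blast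

lemma nab_scale_left:
  "X \<in> VF W \<Longrightarrow> Y \<in> VF W \<Longrightarrow> smooth_fun_on A W k \<Longrightarrow> p \<in> W \<Longrightarrow>
    nab (vf_scale k X) Y p = vf_scale k (nab X Y) p"
  using affine_rules(4)[OF W] by blast

lemma nab_scale_right:
  "X \<in> VF W \<Longrightarrow> Y \<in> VF W \<Longrightarrow> smooth_fun_on A W k \<Longrightarrow> p \<in> W \<Longrightarrow>
    nab X (vf_scale k Y) p = vf_add (vf_scale (\<lambda>q. X q k) Y) (vf_scale k (nab X Y)) p"
  using affine_rules(4)[OF W] by blast

lemma smooth_near_in: "smooth_fun_on A W k \<Longrightarrow> p \<in> W \<Longrightarrow> smooth_near A p k"
  using W by (auto intro: smooth_nearI)

lemma lie_bracket_add_left: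
  assumes X: "X \<in> VF W" "Y \<in> VF W" "Z \<in> VF W" and p: "p \<in> W"
  shows "lie_bracket A (vf_add X Y) Z p = vf_add (lie_bracket A X Z) (lie_bracket A Y Z) p"
proof
  fix h
  show "lie_bracket A (vf_add X Y) Z p h = vf_add (lie_bracket A X Z) (lie_bracket A Y Z) p h"
  proof (cases "smooth_near A p h")
    case True
    have "Z p (\<lambda>q. X q h + Y q h) = Z p (\<lambda>q. X q h) + Z p (\<lambda>q. Y q h)"
      by (rule tangent_add[OF vector_field_tangent[OF X(3) p] vector_field_smooth_near[OF X(1) W(1) p True]
            vector_field_smooth_near[OF X(2) W(1) p True]])
    then show ?thesis by (simp add: lie_bracket_def vf_add_def)
  qed (simp add: lie_bracket_def vf_add_def)
qed

lemma lie_bracket_scale_left: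
  assumes X: "X \<in> VF W" "Y \<in> VF W" and k: "smooth_fun_on A W k" and p: "p \<in> W"
  shows "lie_bracket A (vf_scale k X) Y p =
    vf_add (vf_scale k (lie_bracket A X Y)) (vf_scale (\<lambda>q. - 1 * Y q k) X) p"
proof
  fix h
  show "lie_bracket A (vf_scale k X) Y p h =
    vf_add (vf_scale k (lie_bracket A X Y)) (vf_scale (\<lambda>q. - 1 * Y q k) X) p h"
  proof (cases "smooth_near A p h")
    case True
    have "Y p (\<lambda>q. k q * X q h) = k p * Y p (\<lambda>q. X q h) + Y p k * X p h"
      by (rule tangent_mult[OF vector_field_tangent[OF X(2) p] smooth_near_in[OF k p]
            vector_field_smooth_near[OF X(1) W(1) p True]])
    then show ?thesis using True by (simp add: lie_bracket_def vf_add_def vf_scale_def algebra_simps)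
  next
    \<comment> \<open>On such \<open>h\<close> the bracket is 0 by definition, and the correction
      term vanishes because \<open>X p\<close> is a tangent vector.\<close>
    case False
    then show ?thesis using tangent_not_smooth[OF vector_field_tangent[OF X(1) p] False]
      by (simp add: lie_bracket_def vf_add_def vf_scale_def)
  qed
qed

lemma lie_bracket_antisym: "lie_bracket A X Y = vf_scale (\<lambda>q. -1) (lie_bracket A Y X)"
  by (simp add: lie_bracket_def vf_scale_def fun_eq_iff)

section \<open>Linearity of the curvature over functions\<close>

lemmas bracket = bracket_closed[OF W]

text \<open>Transfers linearity from the first slot to the second.\<close>

lemma curvature_antisym:
  assumes X: "X \<in> VF W" "Y \<in> VF W" "Z \<in> VF W" and p: "p \<in> W"
  shows "curvature A nab X Y Z p = (\<lambda>h. - 1 * curvature A nab Y X Z p h)"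
  unfolding curvature_def lie_bracket_antisym[of X Y]
    nab_scale_left[OF bracket[OF X(2,1)] X(3) smooth_fun_on_const p]
  by (simp add: vf_scale_def fun_eq_iff)

lemma curvature_add_left:
  assumes X: "X \<in> VF W" "X' \<in> VF W" and Y: "Y \<in> VF W"
    and Z: "Z \<in> VF W" and p: "p \<in> W"
  shows "curvature A nab (vf_add X X') Y Z p = (\<lambda>h. curvature A nab X Y Z p h + curvature A nab X' Y Z p h)"
proof -
  note XX = vf_add_closed[OF X]
  have 1: "nab (vf_add X X') (nab Y Z) p = vf_add (nab X (nab Y Z)) (nab X' (nab Y Z)) p"
    by (rule nab_add_left[OF X closed[OF Y Z] p])
  have "nab Y (nab (vf_add X X') Z) p = nab Y (vf_add (nab X Z) (nab X' Z)) p"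
    by (rule nab_cong[OF Y vf_add_closed[OF closed[OF X(1) Z] closed[OF X(2) Z]] Y closed[OF XX Z] refl
          nab_add_left[OF X Z] p])
  also have "\<dots> = vf_add (nab Y (nab X Z)) (nab Y (nab X' Z)) p"
    by (rule nab_add_right[OF Y closed[OF X(1) Z] closed[OF X(2) Z] p])
  finally have 2: "nab Y (nab (vf_add X X') Z) p = vf_add (nab Y (nab X Z)) (nab Y (nab X' Z)) p" .
  have "nab (lie_bracket A (vf_add X X') Y) Z p = nab (vf_add (lie_bracket A X Y) (lie_bracket A X' Y)) Z p"
    by (rule nab_cong[OF vf_add_closed[OF bracket[OF X(1) Y] bracket[OF X(2) Y]] Z bracket[OF XX Y] Z
          lie_bracket_add_left[OF X Y] refl p])
  also have "\<dots> = vf_add (nab (lie_bracket A X Y) Z) (nab (lie_bracket A X' Y) Z) p"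
    by (rule nab_add_left[OF bracket[OF X(1) Y] bracket[OF X(2) Y] Z p])
  finally have 3: "nab (lie_bracket A (vf_add X X') Y) Z p =
    vf_add (nab (lie_bracket A X Y) Z) (nab (lie_bracket A X' Y) Z) p" .
  show ?thesis unfolding curvature_def 1 2 3 by (simp add: vf_add_def fun_eq_iff)
qed

text \<open>The second covariant derivative and the bracket each contribute a term with the
  derivative of \<open>k\<close> along \<open>Y\<close> times \<open>nab X Z\<close>; they
  cancel.\<close>

lemma curvature_scale_left:
  assumes X: "X \<in> VF W" and Y: "Y \<in> VF W"
    and Z: "Z \<in> VF W" and k: "smooth_fun_on A W k" and p: "p \<in> W"
  shows "curvature A nab (vf_scale k X) Y Z p = (\<lambda>h. k p * curvature A nab X Y Z p h)"
proof -
  note kX = vf_scale_closed[OF X k]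
  have Yk: "smooth_fun_on A W (\<lambda>q. - 1 * Y q k)"
    by (intro smooth_fun_on_mult smooth_fun_on_const vector_field_smooth[OF Y W(1) order_refl k] W)
  have 1: "nab (vf_scale k X) (nab Y Z) p = vf_scale k (nab X (nab Y Z)) p"
    by (rule nab_scale_left[OF X closed[OF Y Z] k p])
  have "nab Y (nab (vf_scale k X) Z) p = nab Y (vf_scale k (nab X Z)) p"
    by (rule nab_cong[OF Y vf_scale_closed[OF closed[OF X Z] k] Y closed[OF kX Z] refl
          nab_scale_left[OF X Z k] p])
  also have "\<dots> = vf_add (vf_scale (\<lambda>q. Y q k) (nab X Z)) (vf_scale k (nab Y (nab X Z))) p"
    by (rule nab_scale_right[OF Y closed[OF X Z] k p])
  finally have 2: "nab Y (nab (vf_scale k X) Z) p =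
    vf_add (vf_scale (\<lambda>q. Y q k) (nab X Z)) (vf_scale k (nab Y (nab X Z))) p" .
  note b = vf_scale_closed[OF bracket[OF X Y] k] vf_scale_closed[OF X Yk]
  have "nab (lie_bracket A (vf_scale k X) Y) Z p =
      nab (vf_add (vf_scale k (lie_bracket A X Y)) (vf_scale (\<lambda>q. - 1 * Y q k) X)) Z p"
    by (rule nab_cong[OF vf_add_closed[OF b] Z bracket[OF kX Y] Z lie_bracket_scale_left[OF X Y k] refl p])
  also have "\<dots> = vf_add (nab (vf_scale k (lie_bracket A X Y)) Z) (nab (vf_scale (\<lambda>q. - 1 * Y q k) X) Z) p"
    by (rule nab_add_left[OF b Z p])
  also have "\<dots> = vf_add (vf_scale k (nab (lie_bracket A X Y) Z)) (vf_scale (\<lambda>q. - 1 * Y q k) (nab X Z)) p"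
    unfolding vf_add_def nab_scale_left[OF bracket[OF X Y] Z k p] nab_scale_left[OF X Z Yk p] ..
  finally have 3: "nab (lie_bracket A (vf_scale k X) Y) Z p =
    vf_add (vf_scale k (nab (lie_bracket A X Y) Z)) (vf_scale (\<lambda>q. - 1 * Y q k) (nab X Z)) p" .
  show ?thesis unfolding curvature_def 1 2 3
    by (simp add: vf_add_def vf_scale_def fun_eq_iff algebra_simps)
qed

lemma curvature_add_right:
  assumes X: "X \<in> VF W" and Y: "Y \<in> VF W"
    and Z: "Z \<in> VF W" "Z' \<in> VF W" and p: "p \<in> W"
  shows "curvature A nab X Y (vf_add Z Z') p = (\<lambda>h. curvature A nab X Y Z p h + curvature A nab X Y Z' p h)"
proof -
  have twice: "nab X (nab Y (vf_add Z Z')) p = vf_add (nab X (nab Y Z)) (nab X (nab Y Z')) p"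
    if X: "X \<in> VF W" and Y: "Y \<in> VF W" for X Y
  proof -
    have "nab X (nab Y (vf_add Z Z')) p = nab X (vf_add (nab Y Z) (nab Y Z')) p"
      by (rule nab_cong[OF X vf_add_closed[OF closed[OF Y Z(1)] closed[OF Y Z(2)]] X
            closed[OF Y vf_add_closed[OF Z]] refl nab_add_right[OF Y Z] p])
    also have "\<dots> = vf_add (nab X (nab Y Z)) (nab X (nab Y Z')) p"
      by (rule nab_add_right[OF X closed[OF Y Z(1)] closed[OF Y Z(2)] p])
    finally show ?thesis .
  qed
  show ?thesis
    unfolding curvature_def twice[OF X Y] twice[OF Y X] nab_add_right[OF bracket[OF X Y] Z p]
    by (simp add: vf_add_def fun_eq_iff)
qed

text \<open>The terms with one derivative of \<open>k\<close> are symmetric in \<open>X\<close> and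
  \<open>Y\<close> and drop out of the commutator; those with two derivatives form the bracket
  applied to \<open>k\<close>, which the last term of the curvature removes.\<close>

lemma curvature_scale_right:
  assumes X: "X \<in> VF W" and Y: "Y \<in> VF W"
    and Z: "Z \<in> VF W" and k: "smooth_fun_on A W k" and p: "p \<in> W"
  shows "curvature A nab X Y (vf_scale k Z) p = (\<lambda>h. k p * curvature A nab X Y Z p h)"
proof -
  have twice: "nab X (nab Y (vf_scale k Z)) p = (\<lambda>h. X p (\<lambda>q. Y q k) * Z p h + Y p k * nab X Z p h
      + X p k * nab Y Z p h + k p * nab X (nab Y Z) p h)"
    if X: "X \<in> VF W" and Y: "Y \<in> VF W" for X Y
  proof -
    have Yk: "smooth_fun_on A W (\<lambda>q. Y q k)" by (rule vector_field_smooth[OF Y W(1) order_refl k])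
    note s = vf_scale_closed[OF Z Yk] vf_scale_closed[OF closed[OF Y Z] k]
    have "nab X (nab Y (vf_scale k Z)) p = nab X (vf_add (vf_scale (\<lambda>q. Y q k) Z) (vf_scale k (nab Y Z))) p"
      by (rule nab_cong[OF X vf_add_closed[OF s] X closed[OF Y vf_scale_closed[OF Z k]] refl
            nab_scale_right[OF Y Z k] p])
    also have "\<dots> = vf_add (nab X (vf_scale (\<lambda>q. Y q k) Z)) (nab X (vf_scale k (nab Y Z))) p"
      by (rule nab_add_right[OF X s p])
    also have "\<dots> = (\<lambda>h. X p (\<lambda>q. Y q k) * Z p h + Y p k * nab X Z p h
      + X p k * nab Y Z p h + k p * nab X (nab Y Z) p h)"
      unfolding vf_add_def nab_scale_right[OF X Z Yk p] nab_scale_right[OF X closed[OF Y Z] k p]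
      by (simp add: vf_scale_def fun_eq_iff)
    finally show ?thesis .
  qed
  \<comment> \<open>The bracket is given by the commutator only on functions smooth near
    \<open>p\<close>, as \<open>k\<close> is.\<close>
  have b: "lie_bracket A X Y p k = X p (\<lambda>q. Y q k) - Y p (\<lambda>q. X q k)"
    using smooth_near_in[OF k p] by (simp add: lie_bracket_def)
  show ?thesis
    unfolding curvature_def twice[OF X Y] twice[OF Y X] nab_scale_right[OF bracket[OF X Y] Z k p]
    by (simp add: b vf_add_def vf_scale_def fun_eq_iff algebra_simps)
qed

lemma curvature_cong:
  assumes X: "X \<in> VF W" "X' \<in> VF W" "\<And>q. q \<in> W \<Longrightarrow> X' q = X q"
    and Y: "Y \<in> VF W"
    and Z: "Z \<in> VF W" "Z' \<in> VF W" "\<And>q. q \<in> W \<Longrightarrow> Z' q = Z q" and p: "p \<in> W"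
  shows "curvature A nab X' Y Z' p = curvature A nab X Y Z p"
proof -
  have 1: "nab X' (nab Y Z') p = nab X (nab Y Z) p"
    by (rule nab_cong[OF X(1) closed[OF Y Z(1)] X(2) closed[OF Y Z(2)] X(3) nab_cong[OF Y Z(1) Y Z(2) refl Z(3)] p])
  have 2: "nab Y (nab X' Z') p = nab Y (nab X Z) p"
    by (rule nab_cong[OF Y closed[OF X(1) Z(1)] Y closed[OF X(2) Z(2)] refl nab_cong[OF X(1) Z(1) X(2) Z(2) X(3) Z(3)] p])
  have "lie_bracket A X' Y q = lie_bracket A X Y q" if q: "q \<in> W" for q
  proof
    fix h
    have "Y q (\<lambda>r. X' r h) = Y q (\<lambda>r. X r h)"
      by (rule tangent_cong[OF vector_field_tangent[OF Y q] W(1) q]) (simp add: X(3))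
    then show "lie_bracket A X' Y q h = lie_bracket A X Y q h"
      by (simp add: lie_bracket_def X(3)[OF q])
  qed
  then have 3: "nab (lie_bracket A X' Y) Z' p = nab (lie_bracket A X Y) Z p"
    by (rule nab_cong[OF bracket[OF X(1) Y] Z(1) bracket[OF X(2) Y] Z(2) _ Z(3) p])
  show ?thesis unfolding curvature_def 1 2 3 ..
qed

lemma curvature_tangent:
  assumes X: "X \<in> VF W" and Y: "Y \<in> VF W"
    and Z: "Z \<in> VF W" and p: "p \<in> W"
  shows "curvature A nab X Y Z p \<in> TS p"
proof -
  note t = vector_field_tangent[OF _ p]
  have "(\<lambda>h. 1 * (\<lambda>h. 1 * nab X (nab Y Z) p h + (-1) * nab Y (nab X Z) p h) h + (-1) * nab (lie_bracket A X Y) Z p h)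
    \<in> TS p"
    by (intro tangent_lincomb t closed bracket X Y Z)
  then show ?thesis by (simp add: curvature_def)
qed

text \<open>The slot \<open>Y\<close> is reduced to the slot \<open>X\<close> by antisymmetry; for
  this reason fact \<open>1\<close> is kept general in its \<open>Y\<close>.\<close>

lemma tensorial_curvature:
  assumes X: "X \<in> VF W" and Y: "Y \<in> VF W" and p: "p \<in> W"
    and Z: "Z \<in> VF W" and V: "V \<in> VF W"
  shows "tensorial W p (\<lambda>X. g p (curvature A nab X Y Z p) (V p))"
    and "tensorial W p (\<lambda>Z. g p (curvature A nab X Y Z p) (V p))"
    and "tensorial W p (\<lambda>V. g p (curvature A nab X Y Z p) (V p))"
    and "tensorial W p (\<lambda>Y. g p (curvature A nab X Y Z p) (V p))"
proof -
  note t = vector_field_tangent[OF V p]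
  note r = curvature_tangent[OF _ _ _ p]
  have 1: "tensorial W p (\<lambda>X. g p (curvature A nab X Y Z p) (V p))" if Y: "Y \<in> VF W" for Y
  proof (rule tensorialI)
    fix X X' assume X: "X \<in> VF W" "X' \<in> VF W"
    show "g p (curvature A nab (vf_add X X') Y Z p) (V p) =
      g p (curvature A nab X Y Z p) (V p) + g p (curvature A nab X' Y Z p) (V p)"
      unfolding curvature_add_left[OF X Y Z p] by (rule metric_add_left[OF r[OF X(1) Y Z] r[OF X(2) Y Z] t])
    show "g p (curvature A nab X Y Z p) (V p) = g p (curvature A nab X' Y Z p) (V p)"
      if "\<And>q. q \<in> W \<Longrightarrow> X q = X' q"
      using curvature_cong[OF X that[symmetric] Y Z Z refl p] by simp
  next
    fix X k assume X: "X \<in> VF W" and k: "smooth_fun_on A W k"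
    show "g p (curvature A nab (vf_scale k X) Y Z p) (V p) = k p * g p (curvature A nab X Y Z p) (V p)"
      unfolding curvature_scale_left[OF X Y Z k p] by (rule metric_scale_left[OF r[OF X Y Z] t])
  qed
  show "tensorial W p (\<lambda>X. g p (curvature A nab X Y Z p) (V p))" using Y by (rule 1)
  show "tensorial W p (\<lambda>Z. g p (curvature A nab X Y Z p) (V p))"
  proof (rule tensorialI)
    fix Z Z' assume Z: "Z \<in> VF W" "Z' \<in> VF W"
    show "g p (curvature A nab X Y (vf_add Z Z') p) (V p) =
      g p (curvature A nab X Y Z p) (V p) + g p (curvature A nab X Y Z' p) (V p)"
      unfolding curvature_add_right[OF X Y Z p] by (rule metric_add_left[OF r[OF X Y Z(1)] r[OF X Y Z(2)] t])
    show "g p (curvature A nab X Y Z p) (V p) = g p (curvature A nab X Y Z' p) (V p)"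
      if "\<And>q. q \<in> W \<Longrightarrow> Z q = Z' q"
      using curvature_cong[OF X X refl Y Z that[symmetric] p] by simp
  next
    fix Z k assume Z: "Z \<in> VF W" and k: "smooth_fun_on A W k"
    show "g p (curvature A nab X Y (vf_scale k Z) p) (V p) = k p * g p (curvature A nab X Y Z p) (V p)"
      unfolding curvature_scale_right[OF X Y Z k p] by (rule metric_scale_left[OF r[OF X Y Z] t])
  qed
  show "tensorial W p (\<lambda>V. g p (curvature A nab X Y Z p) (V p))"
  proof (rule tensorialI)
    fix V V' assume V: "V \<in> VF W" "V' \<in> VF W"
    show "g p (curvature A nab X Y Z p) (vf_add V V' p) =
      g p (curvature A nab X Y Z p) (V p) + g p (curvature A nab X Y Z p) (V' p)"
      unfolding vf_add_def
      by (rule metric_add_right[OF vector_field_tangent[OF V(1) p] vector_field_tangent[OF V(2) p] r[OF X Y Z]])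
    show "g p (curvature A nab X Y Z p) (V p) = g p (curvature A nab X Y Z p) (V' p)"
      if "\<And>q. q \<in> W \<Longrightarrow> V q = V' q"
      using that[OF p] by simp
  next
    fix V k assume V: "V \<in> VF W" and k: "smooth_fun_on A W k"
    show "g p (curvature A nab X Y Z p) (vf_scale k V p) = k p * g p (curvature A nab X Y Z p) (V p)"
      unfolding vf_scale_def by (rule metric_scale_right[OF vector_field_tangent[OF V p] r[OF X Y Z]])
  qed
  have anti: "g p (curvature A nab X Y Z p) (V p) = - 1 * g p (curvature A nab Y X Z p) (V p)"
    if Y: "Y \<in> VF W" for Y
    unfolding curvature_antisym[OF X Y Z p] by (rule metric_scale_left[OF r[OF Y X Z] t])
  show "tensorial W p (\<lambda>Y. g p (curvature A nab X Y Z p) (V p))"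
  proof (rule tensorialI)
    fix Y Y' assume Y: "Y \<in> VF W" "Y' \<in> VF W"
    show "g p (curvature A nab X (vf_add Y Y') Z p) (V p) =
      g p (curvature A nab X Y Z p) (V p) + g p (curvature A nab X Y' Z p) (V p)"
      unfolding anti[OF Y(1)] anti[OF Y(2)] anti[OF vf_add_closed[OF Y]] tensorialD(1)[OF 1[OF X] Y] by simp
    show "g p (curvature A nab X Y Z p) (V p) = g p (curvature A nab X Y' Z p) (V p)"
      if "\<And>q. q \<in> W \<Longrightarrow> Y q = Y' q"
      using tensorialD(3)[OF 1[OF X] Y that] by (simp add: anti[OF Y(1)] anti[OF Y(2)])
  next
    fix Y k assume Y: "Y \<in> VF W" and k: "smooth_fun_on A W k"
    show "g p (curvature A nab X (vf_scale k Y) Z p) (V p) = k p * g p (curvature A nab X Y Z p) (V p)"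
      unfolding anti[OF Y] anti[OF vf_scale_closed[OF Y k]] tensorialD(2)[OF 1[OF X] Y k] by simp
  qed
qed

text \<open>The double trace contracts slot 1 with slot 3 and slot 2 with slot 4. The frames are
  exchanged one contraction at a time: with the outer field fixed the inner sum is a trace in slots
  2 and 4, and after swapping the sums the other one is a trace in slots 1 and 3.\<close>

lemma scalar_sum_eq:
  assumes p: "p \<in> W"
    and E: "orthonormal_on W DIM('e) E \<epsilon>" and E': "orthonormal_on W DIM('e) E' \<epsilon>'"
  shows "scalar_sum p E \<epsilon> = scalar_sum p E' \<epsilon>'"
proof -
  let ?Q = "\<lambda>X Y Z V. g p (curvature A nab X Y Z p) (V p)"
  have "scalar_sum p E \<epsilon> = (\<Sum>i<DIM('e). \<epsilon> i * (\<Sum>k<DIM('e). \<epsilon>' k * ?Q (E i) (E' k) (E i) (E' k)))"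
    unfolding scalar_sum_def
  proof (rule sum.cong[OF refl], rule arg_cong[where f = "(*) _"])
    fix i assume "i \<in> {..<DIM('e)}"
    then have i: "E i \<in> VF W" using orthonormal_onD(1)[OF E] by simp
    show "(\<Sum>k<DIM('e). \<epsilon> k * ?Q (E i) (E k) (E i) (E k)) = (\<Sum>k<DIM('e). \<epsilon>' k * ?Q (E i) (E' k) (E i) (E' k))"
      by (rule frame_trace_eq[OF W p _ _ E E', where B = "\<lambda>Y V. ?Q (E i) Y (E i) V"])
        (rule tensorial_curvature[OF i _ p i], assumption+)+
  qed
  also have "\<dots> = (\<Sum>k<DIM('e). \<epsilon>' k * (\<Sum>i<DIM('e). \<epsilon> i * ?Q (E i) (E' k) (E i) (E' k)))"
    unfolding sum_distrib_left by (subst sum.swap) (simp add: mult_ac)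
  also have "\<dots> = (\<Sum>k<DIM('e). \<epsilon>' k * (\<Sum>i<DIM('e). \<epsilon>' i * ?Q (E' i) (E' k) (E' i) (E' k)))"
  proof (rule sum.cong[OF refl], rule arg_cong[where f = "(*) _"])
    fix k assume "k \<in> {..<DIM('e)}"
    then have k: "E' k \<in> VF W" using orthonormal_onD(1)[OF E'] by simp
    show "(\<Sum>i<DIM('e). \<epsilon> i * ?Q (E i) (E' k) (E i) (E' k)) = (\<Sum>i<DIM('e). \<epsilon>' i * ?Q (E' i) (E' k) (E' i) (E' k))"
      by (rule frame_trace_eq[OF W p _ _ E E', where B = "\<lambda>X Z. ?Q X (E' k) Z (E' k)"])
        (rule tensorial_curvature[OF _ k p _ k], assumption+)+
  qed
  also have "\<dots> = scalar_sum p E' \<epsilon>'"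
    unfolding scalar_sum_def sum_distrib_left by (subst sum.swap) (simp add: mult_ac)
  finally show ?thesis .
qed

end

text \<open>The chosen frame lives on an unknown neighbourhood \<open>V\<close>, so both frames are
  restricted to \<open>V \<inter> W\<close> before they are compared.\<close>

lemma scalar_curvature_frame:
  assumes W: "open W" "W \<subseteq> carrier_of A" "p \<in> W" and E: "orthonormal_on W DIM('e) E \<epsilon>"
  shows "scalar_curvature A g nab p = scalar_sum p E \<epsilon>"
proof -
  obtain V E' \<epsilon>' where V: "open V" "p \<in> V" "V \<subseteq> carrier_of A" "orthonormal_on V DIM('e) E' \<epsilon>'"
    and l: "local_frame A g p = (E', \<epsilon>')"
  proof (rule local_frameE)
    show "p \<in> carrier_of A" using W by auto
  qed
  have "scalar_curvature A g nab p = scalar_sum p E' \<epsilon>'"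
    by (simp add: scalar_curvature_def ricci_def scalar_sum_def l)
  also have "\<dots> = scalar_sum p E \<epsilon>"
    by (rule scalar_sum_eq[of "V \<inter> W"]) (use V W E in \<open>auto intro: orthonormal_on_subset\<close>)
  finally show ?thesis .
qed

end

section \<open>Levi-Civita connections and the Koszul formula\<close>

locale levi_civita_manifold = metric_manifold A g
  for A :: "('a::{t2_space, second_countable_topology}, 'e::euclidean_space) chart set" and g +
  fixes nab :: "'a connection"
  assumes levi_civita: "levi_civita A g nab"
begin

lemma torsion_free:
  assumes "open W" "W \<subseteq> carrier_of A" "X \<in> VF W" "Y \<in> VF W" "p \<in> W"
  shows "nab X Y p h - nab Y X p h = lie_bracket A X Y p h"
    and "\<forall>Z\<in>VF W. X p (\<lambda>q. g q (Y q) (Z q)) = g p (nab X Y p) (Z p) + g p (Y p) (nab X Z p)"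
proof -
  note 1 = conjunct2[OF levi_civita[unfolded levi_civita_def], THEN spec, THEN mp, OF assms(1), THEN mp, OF assms(2)]
  note 2 = bspec[OF bspec[OF bspec[OF 1 assms(3)] assms(4)] assms(5)]
  show "nab X Y p h - nab Y X p h = lie_bracket A X Y p h"
    by (rule spec[OF conjunct1[OF 2]])
  show "\<forall>Z\<in>VF W. X p (\<lambda>q. g q (Y q) (Z q)) = g p (nab X Y p) (Z p) + g p (Y p) (nab X Z p)"
    by (rule conjunct2[OF 2])
qed

lemma metric_compatible:
  assumes "open W" "W \<subseteq> carrier_of A" "X \<in> VF W" "Y \<in> VF W"
    "Z \<in> VF W" "p \<in> W"
  shows "X p (\<lambda>q. g q (Y q) (Z q)) = g p (nab X Y p) (Z p) + g p (Y p) (nab X Z p)"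
  by (rule bspec[OF torsion_free(2)[OF assms(1-4,6)] assms(5)])

lemma levi_civita_affine: "affine_connection A nab"
  using levi_civita by (simp add: levi_civita_def)

lemma levi_civita_closed:
  assumes "open W" "W \<subseteq> carrier_of A" "X \<in> VF W" "Y \<in> VF W"
  shows "nab X Y \<in> VF W"
  using levi_civita_affine assms unfolding affine_connection_def by blast

text \<open>Since the torsion-free connection is given, no symmetry of second derivatives is needed to see
  that the bracket takes values in the tangent spaces.\<close>

lemma levi_civita_bracket_closed:
  assumes "open W" "W \<subseteq> carrier_of A" "X \<in> VF W" "Y \<in> VF W"
  shows "lie_bracket A X Y \<in> VF W"
proof (rule vector_fields_cong)
  show "vf_add (nab X Y) (vf_scale (\<lambda>q. -1) (nab Y X)) \<in> VF W"
    using levi_civita_closed assms by (intro vf_add_closed vf_scale_closed smooth_fun_on_const) auto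
  show "vf_add (nab X Y) (vf_scale (\<lambda>q. -1) (nab Y X)) p = lie_bracket A X Y p" if "p \<in> W" for p
    using torsion_free(1)[OF assms that] by (simp add: fun_eq_iff vf_add_def vf_scale_def)
qed

sublocale connection_manifold A g nab
  by unfold_locales (fact levi_civita_affine, rule levi_civita_bracket_closed)

text \<open>Three instances of metric compatibility, with the torsion expressed by brackets. Used on
  the fibre and on the product: the product connection enters as given data, and this formula is how
  its values become computable.\<close>

lemma koszul:
  assumes W: "open W" "W \<subseteq> carrier_of A" and X: "X \<in> VF W" and Y: "Y \<in> VF W"
    and Z: "Z \<in> VF W" and p: "p \<in> W"
  shows "2 * g p (nab X Y p) (Z p) =
    X p (\<lambda>q. g q (Y q) (Z q)) + Y p (\<lambda>q. g q (X q) (Z q)) - Z p (\<lambda>q. g q (X q) (Y q))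
    + g p (lie_bracket A X Y p) (Z p) - g p (lie_bracket A X Z p) (Y p) - g p (lie_bracket A Y Z p) (X p)"
proof -
  note t = vector_field_tangent[OF _ p]
  have b: "g p (lie_bracket A X Y p) (Z p) = g p (nab X Y p) (Z p) - g p (nab Y X p) (Z p)"
    if X: "X \<in> VF W" and Y: "Y \<in> VF W" and Z: "Z \<in> VF W" for X Y Z
  proof -
    have "lie_bracket A X Y p = (\<lambda>h. 1 * nab X Y p h + (-1) * nab Y X p h)"
      using torsion_free(1)[OF W X Y p] by (simp add: fun_eq_iff)
    then show ?thesis
      using metric_lincomb_left[OF t[OF levi_civita_closed[OF W X Y]] t[OF levi_civita_closed[OF W Y X]] t[OF Z], of 1 "-1"]
      by simp
  qed
  have s: "g p (X p) (nab Y Z p) = g p (nab Y Z p) (X p)"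
    if X: "X \<in> VF W" and Y: "Y \<in> VF W" and Z: "Z \<in> VF W" for X Y Z
    by (rule metric_sym[OF t[OF X] t[OF levi_civita_closed[OF W Y Z]]])
  show ?thesis
    unfolding b[OF X Y Z] b[OF X Z Y] b[OF Y Z X] metric_compatible[OF W X Y Z p] metric_compatible[OF W Y X Z p]
      metric_compatible[OF W Z X Y p] s[OF Y X Z] s[OF X Y Z] s[OF X Z Y]
    by simp
qed

end

section \<open>The product manifold\<close>

locale product_manifold = manifold A
  for A :: "('a::{t2_space, second_countable_topology}, 'e::euclidean_space) chart set" +
  fixes I :: "real set"
  assumes I_open: "open I" and I_nonempty: "I \<noteq> {}"
begin

abbreviation M :: "(real \<times> 'a, real \<times> 'e) chart set" where "M \<equiv> product_atlas I A"

abbreviation pchart :: "('a \<Rightarrow> 'e) \<Rightarrow> real \<times> 'a \<Rightarrow> real \<times> 'e" where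
  "pchart \<phi> \<equiv> \<lambda>(t, p). (t, \<phi> p)"

section \<open>Charts of the product\<close>

lemma product_chart: "(U, \<phi>) \<in> A \<Longrightarrow> (I \<times> U, pchart \<phi>) \<in> M"
  unfolding product_atlas_def by (rule rev_image_eqI) auto

lemma product_chartE:
  assumes "(U', \<phi>') \<in> M"
  obtains U \<phi> where "(U, \<phi>) \<in> A" "U' = I \<times> U" "\<phi>' = pchart \<phi>"
  using assms by (auto simp: product_atlas_def)

lemma product_carrier: "carrier_of M = I \<times> carrier_of A"
  unfolding carrier_of_def product_atlas_def by fastforce

lemma product_carrierE:
  assumes "q \<in> carrier_of M"
  obtains U \<phi> where "(U, \<phi>) \<in> A" "q \<in> I \<times> U"
proof -
  have q: "fst q \<in> I" "snd q \<in> carrier_of A" using assms by (auto simp: product_carrier)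
  obtain U \<phi> where "(U, \<phi>) \<in> A" "snd q \<in> U" using q(2) by (rule carrierE)
  with q(1) that show ?thesis by (simp add: mem_Times_iff)
qed

lemma pchart_image: "pchart \<phi> ` (I \<times> W) = I \<times> \<phi> ` W"
  by force

lemma pchart_inj: "(U, \<phi>) \<in> A \<Longrightarrow> inj_on (pchart \<phi>) (I \<times> U)"
  using chart_inj by (auto simp: inj_on_def)

lemma pchart_inv:
  assumes "(U, \<phi>) \<in> A" "t \<in> I" "x \<in> \<phi> ` U"
  shows "inv_into (I \<times> U) (pchart \<phi>) (t, x) = (t, inv_into U \<phi> x)"
  by (rule inv_into_f_eq[OF pchart_inj[OF assms(1)]])
    (use assms in \<open>auto simp: chart_inv\<close>)

lemma product_manifold: "smooth_manifold M"
proof -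
  have 1: "carrier_of M \<noteq> {}"
    using I_nonempty manifold[unfolded smooth_manifold_def] by (simp add: product_carrier)
  have 2: "open U' \<and> open (\<phi>' ` U') \<and> (\<exists>\<psi>. homeomorphism U' (\<phi>' ` U') \<phi>' \<psi>)"
    if "(U', \<phi>') \<in> M" for U' \<phi>'
  proof -
    from that obtain U \<phi> where U: "(U, \<phi>) \<in> A" and e: "U' = I \<times> U" "\<phi>' = pchart \<phi>" by (rule product_chartE)
    obtain \<psi> where h: "homeomorphism U (\<phi> ` U) \<phi> \<psi>" using chart_homeomorphism[OF U] by blast
    have "homeomorphism (I \<times> U) (I \<times> \<phi> ` U) (pchart \<phi>) (\<lambda>(t, x). (t, \<psi> x))"
      unfolding homeomorphism_def case_prod_unfold
    proof (intro conjI ballI)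
      show "continuous_on (I \<times> U) (\<lambda>q. (fst q, \<phi> (snd q)))"
        using h by (intro continuous_intros continuous_on_compose2[of U \<phi> _ snd]) (auto simp: homeomorphism_def)
      show "continuous_on (I \<times> \<phi> ` U) (\<lambda>q. (fst q, \<psi> (snd q)))"
        using h by (intro continuous_intros continuous_on_compose2[of "\<phi> ` U" \<psi> _ snd]) (auto simp: homeomorphism_def)
      show "(\<lambda>q. (fst q, \<phi> (snd q))) ` (I \<times> U) = I \<times> \<phi> ` U" by force
      have "\<psi> ` \<phi> ` U = U" using h by (simp add: homeomorphism_def)
      moreover have "(\<lambda>q. (fst q, \<psi> (snd q))) ` (I \<times> S) = I \<times> \<psi> ` S" for S by force
      ultimately show "(\<lambda>q. (fst q, \<psi> (snd q))) ` (I \<times> \<phi> ` U) = I \<times> U" by (simp only:)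
      show "(fst (fst q, \<phi> (snd q)), \<psi> (snd (fst q, \<phi> (snd q)))) = q" if "q \<in> I \<times> U" for q
        using h that by (auto simp: homeomorphism_def)
      show "(fst (fst y, \<psi> (snd y)), \<phi> (snd (fst y, \<psi> (snd y)))) = y" if "y \<in> I \<times> \<phi> ` U" for y
        using h that by (auto simp: homeomorphism_def)
    qed
    then show ?thesis
      unfolding e pchart_image using chart_properties(1,2)[OF U] I_open by (intro conjI open_Times exI)
  qed
  have 3: "smooth_on (\<phi>' ` (U' \<inter> V')) (\<lambda>x. \<psi>' (inv_into U' \<phi>' x))"
    if c: "(U', \<phi>') \<in> M" "(V', \<psi>') \<in> M" for U' \<phi>' V' \<psi>'
  proof -
    from c(1) obtain U \<phi> where U: "(U, \<phi>) \<in> A" and e: "U' = I \<times> U" "\<phi>' = pchart \<phi>" by (rule product_chartE)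
    from c(2) obtain V \<psi> where V: "(V, \<psi>) \<in> A" and e': "V' = I \<times> V" "\<psi>' = pchart \<psi>" by (rule product_chartE)
    have im: "pchart \<phi> ` (I \<times> U \<inter> I \<times> V) = I \<times> \<phi> ` (U \<inter> V)" by force
    have o: "open (\<phi> ` (U \<inter> V))" "open (I \<times> \<phi> ` (U \<inter> V))"
      using chart_image_open[OF U chart_open[OF V]] I_open by (auto intro: open_Times)
    have "smooth_on (I \<times> \<phi> ` (U \<inter> V)) (\<lambda>y. (fst y, \<psi> (inv_into U \<phi> (snd y))))"
    proof (rule smooth_on_Pair[OF o(2) smooth_on_bounded_linear[OF bounded_linear_fst]])
      show "smooth_on (I \<times> \<phi> ` (U \<inter> V)) (\<lambda>y. \<psi> (inv_into U \<phi> (snd y)))"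
        by (rule smooth_on_compose[OF o(2,1) _ smooth_on_bounded_linear[OF bounded_linear_snd] transition_smooth[OF U V]]) auto
    qed
    then show ?thesis
      unfolding e e' im
      by (rule smooth_on_cong[OF o(2), rotated]) (auto simp: pchart_inv[OF U] chart_inv[OF U])
  qed
  show ?thesis
    unfolding smooth_manifold_def Ball_def split_paired_All prod.case using 1 2 3 by simp
qed

sublocale M: manifold M
  by unfold_locales (rule product_manifold)

section \<open>Smooth functions on the product and its factors\<close>

lemma smooth_fun_on_fst:
  fixes k :: "real \<Rightarrow> real"
  assumes "smooth_on I k"
  shows "smooth_fun_on M (carrier_of M) (\<lambda>q. k (fst q))"
proof (rule M.smooth_fun_on_local)
  fix q assume "q \<in> carrier_of M"
  then obtain U \<phi> where U: "(U, \<phi>) \<in> A" and q: "q \<in> I \<times> U" by (rule product_carrierE)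
  have o: "open (I \<times> \<phi> ` U)" using chart_properties[OF U] I_open by (auto intro: open_Times)
  have "smooth_on (I \<times> \<phi> ` U) (\<lambda>y. k (fst y))"
    by (rule smooth_on_compose[OF o I_open _ smooth_on_bounded_linear[OF bounded_linear_fst] assms]) auto
  then have "smooth_on (pchart \<phi> ` (I \<times> U)) (\<lambda>y. k (fst (inv_into (I \<times> U) (pchart \<phi>) y)))"
    unfolding pchart_image by (rule smooth_on_cong[OF o, rotated]) (auto simp: pchart_inv[OF U])
  then have "smooth_fun_on M (I \<times> U) (\<lambda>q. k (fst q))"
    by (intro M.smooth_fun_on_chart[OF product_chart[OF U] M.chart_open[OF product_chart[OF U]] order_refl])
  then show "\<exists>V. open V \<and> q \<in> V \<and> smooth_fun_on M V (\<lambda>q. k (fst q))"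
    using q M.chart_open[OF product_chart[OF U]] by blast
qed

lemma smooth_fun_on_snd:
  assumes W: "open W" and h: "smooth_fun_on A W h"
  shows "smooth_fun_on M (I \<times> W) (\<lambda>q. h (snd q))"
proof (rule M.smooth_fun_onI)
  fix U' \<phi>' assume "(U', \<phi>') \<in> M"
  then obtain U \<phi> where U: "(U, \<phi>) \<in> A" and e: "U' = I \<times> U" "\<phi>' = pchart \<phi>" by (rule product_chartE)
  have im: "pchart \<phi> ` (I \<times> U \<inter> I \<times> W) = I \<times> \<phi> ` (U \<inter> W)" by force
  have o: "open (\<phi> ` (U \<inter> W))" "open (I \<times> \<phi> ` (U \<inter> W))"
    using chart_image_open[OF U W] I_open by (auto intro: open_Times)
  have "smooth_on (I \<times> \<phi> ` (U \<inter> W)) (\<lambda>y. h (inv_into U \<phi> (snd y)))"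
    by (rule smooth_on_compose[OF o(2,1) _ smooth_on_bounded_linear[OF bounded_linear_snd] smooth_fun_onD[OF h U]]) auto
  then show "smooth_on (\<phi>' ` (U' \<inter> I \<times> W)) (\<lambda>x. h (snd (inv_into U' \<phi>' x)))"
    unfolding e im by (rule smooth_on_cong[OF o(2), rotated]) (auto simp: pchart_inv[OF U])
qed

lemma smooth_near_fst:
  fixes k :: "real \<Rightarrow> real"
  shows "smooth_on I k \<Longrightarrow> q \<in> carrier_of M \<Longrightarrow> smooth_near M q (\<lambda>q. k (fst q))"
  by (rule smooth_nearI[OF smooth_fun_on_fst M.open_carrier]) auto

lemma smooth_near_snd:
  assumes "smooth_near A (snd q) h" "fst q \<in> I"
  shows "smooth_near M q (\<lambda>q. h (snd q))"
proof -
  obtain W where W: "open W" "snd q \<in> W" "W \<subseteq> carrier_of A" "smooth_fun_on A W h"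
    using assms(1) by (rule smooth_nearE)
  show ?thesis
    by (rule smooth_nearI[OF smooth_fun_on_snd[OF W(1,4)]])
      (use W assms(2) I_open in \<open>auto simp: product_carrier mem_Times_iff intro: open_Times\<close>)
qed

text \<open>In charts this is composition with the affine inclusion of a slice of constant
  \<open>t\<close>. It lets fibre vectors act on functions of the product.\<close>

lemma smooth_near_slice:
  assumes "smooth_near M (t, p) h"
  shows "smooth_near A p (\<lambda>p. h (t, p))"
proof -
  obtain V where V: "open V" "(t, p) \<in> V" "V \<subseteq> carrier_of M" "smooth_fun_on M V h"
    using assms by (rule M.smooth_nearE)
  have t: "t \<in> I" using V by (auto simp: product_carrier)
  let ?W = "Pair t -` V"
  have W: "open ?W" by (rule open_vimage[OF V(1)]) (intro continuous_intros)
  have "smooth_fun_on A ?W (\<lambda>p. h (t, p))"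
  proof (rule smooth_fun_onI)
    fix U \<phi> assume U: "(U, \<phi>) \<in> A"
    note o = chart_image_open[OF U W] M.chart_image_open[OF product_chart[OF U] V(1)]
    have "bounded_linear (\<lambda>x::'e. (0::real, x))"
      by (rule bounded_linear_Pair[OF bounded_linear_zero bounded_linear_ident])
    then have "smooth_on (\<phi> ` (U \<inter> ?W)) (\<lambda>x. (t, 0) + (0, x))"
      by (intro smooth_on_add[OF o(1) smooth_on_const] smooth_on_bounded_linear)
    then have s: "smooth_on (\<phi> ` (U \<inter> ?W)) (\<lambda>x. (t, x))" by simp
    have im: "(\<lambda>x. (t, x)) ` \<phi> ` (U \<inter> ?W) \<subseteq> pchart \<phi> ` (I \<times> U \<inter> V)"
      using t by force
    have "smooth_on (\<phi> ` (U \<inter> ?W)) (\<lambda>x. h (inv_into (I \<times> U) (pchart \<phi>) (t, x)))"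
      by (rule smooth_on_compose[OF o im s M.smooth_fun_onD[OF V(4) product_chart[OF U]]])
    then show "smooth_on (\<phi> ` (U \<inter> ?W)) (\<lambda>x. h (t, inv_into U \<phi> x))"
      by (rule smooth_on_cong[OF o(1), rotated]) (use t in \<open>auto simp: pchart_inv[OF U]\<close>)
  qed
  then show ?thesis
    by (rule smooth_nearI) (use V W in \<open>auto simp: product_carrier\<close>)
qed

section \<open>Coordinate vectors along the factors\<close>

lemma coordinate_vector_Pair_zero:
  assumes U: "(U, \<phi>) \<in> A" and t: "t \<in> I" and p: "p \<in> U" and h: "smooth_near M (t, p) h"
  shows "coordinate_vector M (I \<times> U, pchart \<phi>) (t, p) (0, u) h = coordinate_vector A (U, \<phi>) p u (\<lambda>p. h (t, p))"
proof -
  let ?H = "\<lambda>y. h (inv_into (I \<times> U) (pchart \<phi>) y)"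
  have "?H differentiable (at (t, \<phi> p))"
    using M.smooth_near_differentiable[OF h product_chart[OF U]] t p by simp
  then have D: "(?H has_derivative frechet_derivative ?H (at (t, \<phi> p))) (at (t, \<phi> p))"
    by (simp only: frechet_derivative_works)
  have "((\<lambda>x. (t, x)) has_derivative (\<lambda>x. (0, x))) (at (\<phi> p))"
    by (intro has_derivative_Pair has_derivative_const has_derivative_ident)
  from diff_chain_at[OF this D]
  have "((\<lambda>x. ?H (t, x)) has_derivative (\<lambda>x. frechet_derivative ?H (at (t, \<phi> p)) (0, x))) (at (\<phi> p))"
    unfolding o_def .
  then have "((\<lambda>x. h (t, inv_into U \<phi> x)) has_derivative
      (\<lambda>x. frechet_derivative ?H (at (t, \<phi> p)) (0, x))) (at (\<phi> p))"
    by (rule has_derivative_transform_within_open[OF _ chart_properties(2)[OF U]])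
      (use p t in \<open>auto simp: pchart_inv[OF U]\<close>)
  then show ?thesis
    by (simp add: coordinate_vector_smooth[OF smooth_near_slice[OF h]] M.coordinate_vector_smooth[OF h]
        frechet_derivative_eqI)
qed

text \<open>\<open>ddt\<close> is defined by a bare one-variable derivative. As the coordinate
  vector of (1, 0) it becomes a tangent vector and a smooth field, to which the derivation rules
  apply.\<close>

lemma ddt_coordinate_vector:
  assumes U: "(U, \<phi>) \<in> A" and t: "t \<in> I" and p: "p \<in> U"
  shows "ddt I A (t, p) = coordinate_vector M (I \<times> U, pchart \<phi>) (t, p) (1, 0)"
proof
  fix h
  show "ddt I A (t, p) h = coordinate_vector M (I \<times> U, pchart \<phi>) (t, p) (1, 0) h"
  proof (cases "smooth_near M (t, p) h")
    case True
    let ?H = "\<lambda>y. h (inv_into (I \<times> U) (pchart \<phi>) y)"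
    have "?H differentiable (at (t, \<phi> p))"
      using M.smooth_near_differentiable[OF True product_chart[OF U]] t p by simp
    then have D: "(?H has_derivative frechet_derivative ?H (at (t, \<phi> p))) (at (t, \<phi> p))"
      by (simp only: frechet_derivative_works)
    have "((\<lambda>s. (s, \<phi> p)) has_derivative (\<lambda>s. (s, 0))) (at t)"
      by (intro has_derivative_Pair has_derivative_const has_derivative_ident)
    from diff_chain_at[OF this D]
    have "((\<lambda>s. ?H (s, \<phi> p)) has_derivative (\<lambda>s. frechet_derivative ?H (at (t, \<phi> p)) (s, 0))) (at t)"
      unfolding o_def .
    then have d: "((\<lambda>s. h (s, p)) has_derivative (\<lambda>s. frechet_derivative ?H (at (t, \<phi> p)) (s, 0))) (at t)"
      by (rule has_derivative_transform_within_open[OF _ I_open t])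
        (use p in \<open>auto simp: pchart_inv[OF U] chart_inv[OF U]\<close>)
    have "deriv (\<lambda>s. h (s, p)) t = frechet_derivative ?H (at (t, \<phi> p)) (1, 0)"
      using deriv_eq_frechet_derivative[OF Derivative.differentiableI[OF d]] frechet_derivative_eqI[OF d] by simp
    then show ?thesis by (simp add: ddt_def True M.coordinate_vector_smooth[OF True])
  next
    case False
    then show ?thesis by (simp add: ddt_def coordinate_vector_def)
  qed
qed

lemma ddt_vector_field:
  assumes "W \<subseteq> carrier_of M"
  shows "ddt I A \<in> M.VF W"
proof (rule M.vector_fields_local)
  fix q assume "q \<in> W"
  then have "q \<in> carrier_of M" using assms by blast
  then obtain U \<phi> where U: "(U, \<phi>) \<in> A" and q: "q \<in> I \<times> U" by (rule product_carrierE)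
  have "ddt I A \<in> M.VF (I \<times> U)"
    by (rule M.vector_fields_cong[OF M.coordinate_field[OF product_chart[OF U], of "(1, 0)"]])
      (auto simp: ddt_coordinate_vector[OF U])
  then show "\<exists>V. open V \<and> q \<in> V \<and> ddt I A \<in> M.VF V"
    using q M.chart_open[OF product_chart[OF U]] by blast
qed

text \<open>The differential at \<open>snd q\<close> of the inclusion of the slice through
  \<open>q\<close>, cut off on germs that are not smooth so as to respect the convention for tangent
  vectors.\<close>

definition lift_vector :: "real \<times> 'a \<Rightarrow> 'a tangent_vector \<Rightarrow> (real \<times> 'a) tangent_vector" where
  "lift_vector q v = (\<lambda>h. if smooth_near M q h then v (\<lambda>p. h (fst q, p)) else 0)"

definition lift :: "'a vector_field \<Rightarrow> (real \<times> 'a) vector_field" where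
  "lift X = (\<lambda>q. lift_vector q (X (snd q)))"

lemma lift_vector_coordinate:
  assumes U: "(U, \<phi>) \<in> A" and t: "t \<in> I" and p: "p \<in> U"
  shows "lift_vector (t, p) (coordinate_vector A (U, \<phi>) p u) = coordinate_vector M (I \<times> U, pchart \<phi>) (t, p) (0, u)"
proof
  fix h
  show "lift_vector (t, p) (coordinate_vector A (U, \<phi>) p u) h = coordinate_vector M (I \<times> U, pchart \<phi>) (t, p) (0, u) h"
    using coordinate_vector_Pair_zero[OF assms, of h u]
    by (cases "smooth_near M (t, p) h") (simp_all add: lift_vector_def coordinate_vector_def)
qed

lemma lift_vector_tangent:
  assumes "v \<in> TS (snd q)" "fst q \<in> I"
  shows "lift_vector q v \<in> M.TS q"
proof -
  obtain U \<phi> u where U: "(U, \<phi>) \<in> A" "snd q \<in> U" and u: "v = coordinate_vector A (U, \<phi>) (snd q) u"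
    using assms(1) by (rule tangentE)
  have "lift_vector (fst q, snd q) v = coordinate_vector M (I \<times> U, pchart \<phi>) (fst q, snd q) (0, u)"
    unfolding u by (rule lift_vector_coordinate[OF U(1) assms(2) U(2)])
  then show ?thesis
    using M.coordinate_vector_in_tangent_space[OF product_chart[OF U(1)], of q] U assms
    by (simp add: mem_Times_iff)
qed

lemma lift_vector_field:
  assumes X: "X \<in> VF W" and W: "open W" "W \<subseteq> carrier_of A"
  shows "lift X \<in> M.VF (I \<times> W)"
proof (rule M.vector_fields_local)
  fix q assume q: "q \<in> I \<times> W"
  then have "q \<in> carrier_of M" using W by (auto simp: product_carrier)
  then obtain U \<phi> where U: "(U, \<phi>) \<in> A" and "q \<in> I \<times> U" by (rule product_carrierE)
  with q have q: "q \<in> I \<times> (U \<inter> W)" by auto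
  let ?W = "U \<inter> W"
  let ?c = "(I \<times> U, pchart \<phi>)"
  have o: "open ?W" using chart_open[OF U] W(1) by (rule open_Int)
  \<comment> \<open>The chart components of \<open>X\<close>, pulled back along \<open>snd\<close>,
    are smooth on the product, and the coordinate fields of the product chart are smooth. Near
    \<open>q\<close> the lift is this combination.\<close>
  let ?S = "\<lambda>q h. \<Sum>b\<in>Basis. X (snd q) (\<lambda>p. \<phi> p \<bullet> b) * coordinate_vector M ?c q (0, b) h"
  have "?S \<in> M.VF (I \<times> ?W)"
  proof (rule M.vf_sum_closed)
    show "I \<times> ?W \<subseteq> carrier_of M" using W by (auto simp: product_carrier)
    show "(\<lambda>q. coordinate_vector M ?c q (0, b)) \<in> M.VF (I \<times> ?W)" for b
      by (rule M.vector_fields_subset[OF M.coordinate_field[OF product_chart[OF U]]]) auto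
    show "smooth_fun_on M (I \<times> ?W) (\<lambda>q. X (snd q) (\<lambda>p. \<phi> p \<bullet> b))" for b
      by (rule smooth_fun_on_snd[OF o vector_field_smooth[OF X o _ smooth_fun_on_subset[OF smooth_fun_on_coordinate[OF U]]]]) auto
  qed simp
  moreover have "?S r = lift X r" if r: "r \<in> I \<times> ?W" for r
  proof -
    obtain t p where tp: "r = (t, p)" "t \<in> I" "p \<in> U" "p \<in> W" using r by auto
    have e: "X p = coordinate_vector A (U, \<phi>) p (\<Sum>b\<in>Basis. X p (\<lambda>q. \<phi> q \<bullet> b) *\<^sub>R b)"
      by (rule tangent_coordinate_expansion[OF U tp(3) vector_field_tangent[OF X tp(4)]])
    have "lift X r = coordinate_vector M ?c (t, p) (0, \<Sum>b\<in>Basis. X p (\<lambda>q. \<phi> q \<bullet> b) *\<^sub>R b)"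
      unfolding lift_def tp(1) snd_conv by (subst e) (rule lift_vector_coordinate[OF U tp(2,3)])
    also have "(0::real, \<Sum>b\<in>Basis. X p (\<lambda>q. \<phi> q \<bullet> b) *\<^sub>R b) = (\<Sum>b\<in>Basis. X p (\<lambda>q. \<phi> q \<bullet> b) *\<^sub>R (0, b))"
      by (simp add: prod_eq_iff fst_sum snd_sum)
    also have "coordinate_vector M ?c (t, p) \<dots> =
        (\<lambda>h. \<Sum>b\<in>Basis. X p (\<lambda>q. \<phi> q \<bullet> b) * coordinate_vector M ?c (t, p) (0, b) h)"
      by (rule M.coordinate_vector_sum[OF product_chart[OF U]]) (use tp in auto)
    finally show ?thesis by (simp add: tp(1))
  qed
  ultimately have "lift X \<in> M.VF (I \<times> ?W)" by (rule M.vector_fields_cong)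
  then show "\<exists>V. open V \<and> q \<in> V \<and> lift X \<in> M.VF V"
    using q open_Times[OF I_open o] by blast
qed

section \<open>Splitting of the tangent space of the product\<close>

lemma product_tangentE:
  assumes v: "v \<in> M.TS q"
  obtains U \<phi> a u where "(U, \<phi>) \<in> A" "snd q \<in> U" "fst q \<in> I"
    "v = coordinate_vector M (I \<times> U, pchart \<phi>) q (a, u)"
proof -
  obtain U' \<phi>' y where U': "(U', \<phi>') \<in> M" "q \<in> U'" "v = coordinate_vector M (U', \<phi>') q y"
    using v by (rule M.tangentE)
  obtain U \<phi> where U: "(U, \<phi>) \<in> A" "U' = I \<times> U" "\<phi>' = pchart \<phi>" using U'(1) by (rule product_chartE)
  show ?thesis by (rule that[of U \<phi> "fst y" "snd y"]) (use U U' in auto)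
qed

lemma coordinate_vector_fst:
  assumes U: "(U, \<phi>) \<in> A" and q: "q \<in> I \<times> U"
  shows "coordinate_vector M (I \<times> U, pchart \<phi>) q (a, u) fst = a"
proof -
  have "(\<lambda>q. pchart \<phi> q \<bullet> (1, 0)) = fst" by (auto simp: fun_eq_iff)
  then show ?thesis
    using M.coordinate_vector_coordinate[OF product_chart[OF U] q, of "(a, u)" "(1, 0)"] by simp
qed

lemma pushforward_coordinate_vector:
  assumes U: "(U, \<phi>) \<in> A" and q: "q \<in> I \<times> U"
  shows "pushforward A snd q (coordinate_vector M (I \<times> U, pchart \<phi>) q (a, u)) = coordinate_vector A (U, \<phi>) (snd q) u"
proof
  fix h
  let ?c = "coordinate_vector M (I \<times> U, pchart \<phi>) q"
  show "pushforward A snd q (?c (a, u)) h = coordinate_vector A (U, \<phi>) (snd q) u h"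
  proof (cases "smooth_near A (snd q) h")
    case True
    obtain t p where tp: "q = (t, p)" "t \<in> I" "p \<in> U" using q by auto
    have s: "smooth_near M (t, p) (\<lambda>q. h (snd q))" using smooth_near_snd[of q h] True tp by simp
    note l = M.coordinate_vector_linear[OF product_chart[OF U] q, of "\<lambda>q. h (snd q)"]
    \<comment> \<open>The base part of the vector is a multiple of \<open>ddt\<close>, which
      annihilates functions of \<open>snd\<close>; only the fibre part survives the
      projection.\<close>
    have "?c (a, u) (\<lambda>q. h (snd q)) = ?c (a *\<^sub>R (1, 0) + (0, u)) (\<lambda>q. h (snd q))" by simp
    also have "\<dots> = a * ?c (1, 0) (\<lambda>q. h (snd q)) + ?c (0, u) (\<lambda>q. h (snd q))"
      by (simp only: linear_add[OF l] linear_cmul[OF l] real_scaleR_def)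
    also have "?c (1, 0) = ddt I A q" unfolding tp(1) by (rule ddt_coordinate_vector[OF U tp(2,3), symmetric])
    also have "ddt I A q (\<lambda>q. h (snd q)) = 0" by (simp add: ddt_def)
    also have "?c (0, u) (\<lambda>q. h (snd q)) = coordinate_vector A (U, \<phi>) p u h"
      unfolding tp(1) using coordinate_vector_Pair_zero[OF U tp(2,3) s, of u] by simp
    finally show ?thesis using True by (simp add: pushforward_def tp)
  next
    case False
    then show ?thesis by (simp add: pushforward_def coordinate_vector_def)
  qed
qed

lemma pushforward_tangent: "v \<in> M.TS q \<Longrightarrow> pushforward A snd q v \<in> TS (snd q)"
  by (elim product_tangentE)
    (simp add: pushforward_coordinate_vector mem_Times_iff coordinate_vector_in_tangent_space)

lemma pushforward_lincomb:
  "pushforward A snd q (\<lambda>h. a * u h + b * v h) = (\<lambda>h. a * pushforward A snd q u h + b * pushforward A snd q v h)"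
  by (simp add: pushforward_def fun_eq_iff)

lemma pushforward_lift_vector:
  assumes "v \<in> TS (snd q)" "fst q \<in> I"
  shows "pushforward A snd q (lift_vector q v) = v"
proof
  fix h
  show "pushforward A snd q (lift_vector q v) h = v h"
    using tangent_not_smooth[OF assms(1)] smooth_near_snd[OF _ assms(2)]
    by (cases "smooth_near A (snd q) h") (simp_all add: pushforward_def lift_vector_def)
qed

lemma pushforward_ddt: "pushforward A snd q (ddt I A q) = (\<lambda>h. 0)"
  by (simp add: pushforward_def ddt_def fun_eq_iff)

lemma ddt_fst:
  assumes "q \<in> carrier_of M"
  shows "ddt I A q fst = 1"
proof -
  obtain U \<phi> where U: "(U, \<phi>) \<in> A" and q: "q \<in> I \<times> U" using assms by (rule product_carrierE)
  have "ddt I A (fst q, snd q) = coordinate_vector M (I \<times> U, pchart \<phi>) (fst q, snd q) (1, 0)"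
    by (rule ddt_coordinate_vector[OF U]) (use q in auto)
  then show ?thesis using coordinate_vector_fst[OF U q] by simp
qed

lemma lift_vector_fst: "v \<in> TS (snd q) \<Longrightarrow> lift_vector q v fst = 0"
  by (simp add: lift_vector_def tangent_const)

end

section \<open>The Levi-Civita connection of the warped product\<close>

context product_manifold
begin

lemma pushforward_smooth:
  "smooth_near A (snd q) h \<Longrightarrow> pushforward A snd q v h = v (\<lambda>q. h (snd q))"
  by (simp add: pushforward_def)

text \<open>The maps dt and d(snd) are jointly injective, since together they read off all
  coordinates in a product chart. Brackets and metric identities on the product are compared through
  these two components.\<close>

lemma product_tangent_eqI:
  assumes v: "v \<in> M.TS q" and w: "w \<in> M.TS q"
    and eq: "v fst = w fst" "pushforward A snd q v = pushforward A snd q w"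
  shows "v = w"
proof -
  obtain U \<phi> a u where U: "(U, \<phi>) \<in> A" "snd q \<in> U" "fst q \<in> I"
    and v': "v = coordinate_vector M (I \<times> U, pchart \<phi>) q (a, u)" using v by (rule product_tangentE)
  have q: "q \<in> I \<times> U" using U by (simp add: mem_Times_iff)
  obtain y where w': "w = coordinate_vector M (I \<times> U, pchart \<phi>) q (fst y, snd y)"
    using w M.tangent_space_eq[OF product_chart[OF U(1)] q] by auto
  have a: "a = fst y" using eq(1) unfolding v' w' coordinate_vector_fst[OF U(1) q] .
  have c: "coordinate_vector A (U, \<phi>) (snd q) u = coordinate_vector A (U, \<phi>) (snd q) (snd y)"
    using eq(2) unfolding v' w' pushforward_coordinate_vector[OF U(1) q] .
  have "u = snd y"
  proof (rule euclidean_eqI)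
    fix b :: 'e
    show "u \<bullet> b = snd y \<bullet> b"
      using fun_cong[OF c, of "\<lambda>q. \<phi> q \<bullet> b"] unfolding coordinate_vector_coordinate[OF U(1,2)] .
  qed
  with a show ?thesis by (simp add: v' w')
qed

lemma product_open: "open W \<Longrightarrow> open (I \<times> W)"
  using I_open by (rule open_Times)

lemma product_subset: "W \<subseteq> carrier_of A \<Longrightarrow> I \<times> W \<subseteq> carrier_of M"
  by (auto simp: product_carrier)

section \<open>Derivatives of functions along the base and along lifts\<close>

lemma ddt_tangent: "q \<in> carrier_of M \<Longrightarrow> ddt I A q \<in> M.TS q"
  using M.vector_field_tangent[OF ddt_vector_field[OF order_refl]] .

lemma ddt_fst_comp:
  fixes k :: "real \<Rightarrow> real"
  assumes "smooth_on I k" "q \<in> carrier_of M"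
  shows "ddt I A q (\<lambda>r. k (fst r)) = deriv k (fst q)"
  using smooth_near_fst[OF assms] by (simp add: ddt_def)

lemma ddt_snd_comp: "ddt I A q (\<lambda>r. h (snd r)) = 0"
  by (simp add: ddt_def)

lemma ddt_mult_comp:
  fixes k :: "real \<Rightarrow> real"
  assumes "smooth_on I k" "q \<in> carrier_of M" "smooth_near A (snd q) h"
  shows "ddt I A q (\<lambda>r. k (fst r) * h (snd r)) = deriv k (fst q) * h (snd q)"
proof -
  have "fst q \<in> I" using assms(2) by (auto simp: product_carrier)
  then show ?thesis
    using M.tangent_mult[OF ddt_tangent[OF assms(2)] smooth_near_fst[OF assms(1,2)] smooth_near_snd[OF assms(3)]]
    by (simp add: ddt_fst_comp[OF assms(1,2)] ddt_snd_comp)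
qed

context
  fixes W X assumes W: "open W" "W \<subseteq> carrier_of A" and X: "X \<in> VF W"
begin

lemma lift_tangent: "q \<in> I \<times> W \<Longrightarrow> lift X q \<in> M.TS q"
  using M.vector_field_tangent[OF lift_vector_field[OF X W]] .

lemma lift_fst: "q \<in> I \<times> W \<Longrightarrow> lift X q fst = 0"
  unfolding lift_def by (rule lift_vector_fst) (auto intro: vector_field_tangent[OF X])

lemma lift_pushforward: "q \<in> I \<times> W \<Longrightarrow> pushforward A snd q (lift X q) = X (snd q)"
  unfolding lift_def by (rule pushforward_lift_vector) (auto intro: vector_field_tangent[OF X])

lemma lift_fst_comp: "q \<in> I \<times> W \<Longrightarrow> lift X q (\<lambda>r. k (fst r)) = 0"
  using tangent_const[OF vector_field_tangent[OF X]] by (auto simp: lift_def lift_vector_def)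

lemma lift_snd_comp:
  "q \<in> I \<times> W \<Longrightarrow> smooth_near A (snd q) h \<Longrightarrow> lift X q (\<lambda>r. h (snd r)) = X (snd q) h"
  using smooth_near_snd by (auto simp: lift_def lift_vector_def)

lemma lift_mult_comp:
  fixes k :: "real \<Rightarrow> real"
  assumes "smooth_on I k" "q \<in> I \<times> W" "smooth_near A (snd q) h"
  shows "lift X q (\<lambda>r. k (fst r) * h (snd r)) = k (fst q) * X (snd q) h"
proof -
  have q: "q \<in> carrier_of M" "fst q \<in> I" using assms(2) W by (auto simp: product_carrier)
  show ?thesis
    using M.tangent_mult[OF lift_tangent[OF assms(2)] smooth_near_fst[OF assms(1) q(1)] smooth_near_snd[OF assms(3) q(2)]]
    by (simp add: lift_fst_comp[OF assms(2)] lift_snd_comp[OF assms(2,3)])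
qed

end

end

section \<open>The warped metric\<close>

locale warped_product = product_manifold A I + levi_civita_manifold A gF nabF
  for A :: "('a::{t2_space, second_countable_topology}, 'e::euclidean_space) chart set"
    and I and gF and nabF +
  fixes f :: "real \<Rightarrow> real"
  assumes f_smooth: "smooth_on I f" and f_pos: "\<And>t. t \<in> I \<Longrightarrow> f t > 0"
begin

abbreviation gM :: "(real \<times> 'a) metric_tensor" where "gM \<equiv> warped_metric A f gF"

abbreviation D :: "(real \<times> 'a) vector_field" where "D \<equiv> ddt I A"

lemma metric_zero_right: "w \<in> TS p \<Longrightarrow> gF p w (\<lambda>h. 0) = 0"
  using metric_sym[of w p "\<lambda>h. 0"] metric_zero_left tangent_zero[OF tangent_space_carrier] by simp

lemma warped_ddt_right: "q \<in> carrier_of M \<Longrightarrow> v \<in> M.TS q \<Longrightarrow> gM q v (D q) = - v fst"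
  by (simp add: warped_metric_def pushforward_ddt ddt_fst metric_zero_right pushforward_tangent)

lemma warped_lift_vector_right:
  "fst q \<in> I \<Longrightarrow> w \<in> TS (snd q) \<Longrightarrow>
    gM q v (lift_vector q w) = (f (fst q))\<^sup>2 * gF (snd q) (pushforward A snd q v) w"
  by (simp add: warped_metric_def pushforward_lift_vector lift_vector_fst)

text \<open>A general field on the product does not project to a field on the fibre, so smoothness
  of \<open>gF\<close> on fields cannot be applied to it. Its projection is expanded in coordinate
  fields of the fibre: the coefficients are smooth on the product, and \<open>gF\<close> is
  evaluated only on honest fibre fields.\<close>

lemma warped_metric_smooth:
  assumes W: "open W" "W \<subseteq> carrier_of M" and X: "X \<in> M.VF W" and Y: "Y \<in> M.VF W"
  shows "smooth_fun_on M W (\<lambda>q. gM q (X q) (Y q))"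
proof (rule M.smooth_fun_on_local)
  fix q assume q: "q \<in> W"
  then have "q \<in> carrier_of M" using W by blast
  then obtain U \<phi> where U: "(U, \<phi>) \<in> A" and qU: "q \<in> I \<times> U" by (rule product_carrierE)
  let ?V = "W \<inter> I \<times> U"
  let ?c = "\<lambda>b p. coordinate_vector A (U, \<phi>) p b"
  have V: "open ?V" "?V \<subseteq> carrier_of M" using W product_open[OF chart_open[OF U]] by auto
  have fstm: "smooth_fun_on M ?V fst"
    using smooth_fun_on_subset[OF smooth_fun_on_fst[OF smooth_on_bounded_linear[OF bounded_linear_ident]] V(2)] by simp
  have f2: "smooth_fun_on M ?V (\<lambda>q. f (fst q) * f (fst q))"
    by (intro M.smooth_fun_on_mult[OF V(1)] smooth_fun_on_subset[OF smooth_fun_on_fst[OF f_smooth] V(2)])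
  have co: "smooth_fun_on M ?V (\<lambda>q. Z q (\<lambda>r. \<phi> (snd r) \<bullet> b))" if "Z \<in> M.VF W" for Z b
    by (rule M.vector_field_smooth[OF that V(1) _ smooth_fun_on_subset[OF smooth_fun_on_snd[OF chart_open[OF U] smooth_fun_on_coordinate[OF U]]]]) auto
  have cf: "smooth_fun_on M ?V (\<lambda>q. gF (snd q) (?c b (snd q)) (?c b' (snd q)))" for b b'
    by (rule smooth_fun_on_subset[OF smooth_fun_on_snd[OF chart_open[OF U]
      metric_smooth[OF chart_open[OF U] chart_subset_carrier[OF U] coordinate_field[OF U] coordinate_field[OF U]]]]) auto
  have push: "pushforward A snd r (Z r) = (\<lambda>h. \<Sum>b\<in>Basis. Z r (\<lambda>q. \<phi> (snd q) \<bullet> b) * ?c b (snd r) h)"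
    if Z: "Z \<in> M.VF W" and r: "r \<in> ?V" for Z r
  proof -
    have sU: "snd r \<in> U" using r by auto
    have "pushforward A snd r (Z r) = ?c (\<Sum>b\<in>Basis. pushforward A snd r (Z r) (\<lambda>q. \<phi> q \<bullet> b) *\<^sub>R b) (snd r)"
      by (rule tangent_coordinate_expansion[OF U sU pushforward_tangent[OF M.vector_field_tangent[OF Z]]]) (use r in auto)
    then show ?thesis
      unfolding coordinate_vector_sum[OF U sU] pushforward_smooth[OF smooth_near_coordinate[OF U sU]] .
  qed
  have ct: "?c b (snd r) \<in> TS (snd r)" if "r \<in> ?V" for b r
    by (rule coordinate_vector_in_tangent_space[OF U]) (use that in auto)
  have gg: "gF (snd r) (pushforward A snd r (X r)) (pushforward A snd r (Y r)) =
      (\<Sum>b\<in>Basis. X r (\<lambda>q. \<phi> (snd q) \<bullet> b) * (\<Sum>b'\<in>Basis. Y r (\<lambda>q. \<phi> (snd q) \<bullet> b') *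
        gF (snd r) (?c b' (snd r)) (?c b (snd r))))" if r: "r \<in> ?V" for r
  proof -
    have Yt: "pushforward A snd r (Y r) \<in> TS (snd r)"
      by (rule pushforward_tangent[OF M.vector_field_tangent[OF Y]]) (use r in auto)
    have "gF (snd r) (pushforward A snd r (X r)) (pushforward A snd r (Y r)) =
      (\<Sum>b\<in>Basis. X r (\<lambda>q. \<phi> (snd q) \<bullet> b) * gF (snd r) (?c b (snd r)) (pushforward A snd r (Y r)))"
      unfolding push[OF X r] by (rule metric_sum_left[OF finite_Basis ct[OF r] Yt])
    also have "\<dots> = (\<Sum>b\<in>Basis. X r (\<lambda>q. \<phi> (snd q) \<bullet> b) * gF (snd r) (pushforward A snd r (Y r)) (?c b (snd r)))"
      by (intro sum.cong refl arg_cong[where f = "(*) _"] metric_sym[OF ct[OF r] Yt])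
    also have "\<dots> = (\<Sum>b\<in>Basis. X r (\<lambda>q. \<phi> (snd q) \<bullet> b) * (\<Sum>b'\<in>Basis. Y r (\<lambda>q. \<phi> (snd q) \<bullet> b') *
        gF (snd r) (?c b' (snd r)) (?c b (snd r))))"
      unfolding push[OF Y r]
      by (intro sum.cong refl arg_cong[where f = "(*) _"] metric_sum_left[OF finite_Basis ct[OF r] ct[OF r]])
    finally show ?thesis .
  qed
  have "smooth_fun_on M ?V (\<lambda>r. (- 1) * (X r fst * Y r fst) + (f (fst r) * f (fst r)) *
      (\<Sum>b\<in>Basis. X r (\<lambda>q. \<phi> (snd q) \<bullet> b) * (\<Sum>b'\<in>Basis. Y r (\<lambda>q. \<phi> (snd q) \<bullet> b') *
        gF (snd r) (?c b' (snd r)) (?c b (snd r)))))"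
    by (intro M.smooth_fun_on_add[OF V(1)] M.smooth_fun_on_mult[OF V(1)] M.smooth_fun_on_sum[OF V(1)]
        smooth_fun_on_const f2 cf co X Y M.vector_field_smooth[OF X V(1) _ fstm] M.vector_field_smooth[OF Y V(1) _ fstm]) auto
  then have "smooth_fun_on M ?V (\<lambda>q. gM q (X q) (Y q))"
    by (rule M.smooth_fun_on_cong[OF _ V(1)]) (simp add: warped_metric_def gg power2_eq_square)
  then show "\<exists>V. open V \<and> q \<in> V \<and> smooth_fun_on M V (\<lambda>q. gM q (X q) (Y q))"
    using q qU V(1) by blast
qed

lemma warped_pseudo_riemannian: "pseudo_riemannian M gM"
  unfolding pseudo_riemannian_def
proof (intro conjI ballI allI impI)
  fix q u v assume u: "u \<in> M.TS q" and v: "v \<in> M.TS q"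
  show "gM q u v = gM q v u"
    unfolding warped_metric_def
    using metric_sym[OF pushforward_tangent[OF u] pushforward_tangent[OF v]] by simp
next
  fix q u v w a b
  assume u: "u \<in> M.TS q" and v: "v \<in> M.TS q" and w: "w \<in> M.TS q"
  show "gM q (\<lambda>h. a * u h + b * v h) w = a * gM q u w + b * gM q v w"
    unfolding warped_metric_def pushforward_lincomb
      metric_lincomb_left[OF pushforward_tangent[OF u] pushforward_tangent[OF v] pushforward_tangent[OF w]]
    by (simp add: algebra_simps)
next
  fix q v assume q: "q \<in> carrier_of M" and v: "v \<in> M.TS q" and z: "\<forall>w\<in>M.TS q. gM q v w = 0"
  have qI: "fst q \<in> I" "snd q \<in> carrier_of A" using q by (auto simp: product_carrier)
  have zt: "(\<lambda>h. 0) \<in> M.TS q" using q by (rule M.tangent_zero)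
  show "v = (\<lambda>h. 0)"
  proof (rule product_tangent_eqI[OF v zt])
    have "gM q v (D q) = 0" using z ddt_tangent[OF q] by blast
    then show "v fst = 0" unfolding warped_ddt_right[OF q v] by simp
    \<comment> \<open>Lifted vectors test the fibre component: the factor \<open>f\<close> squared
      is positive, so nondegeneracy of \<open>gF\<close> applies.\<close>
    have "pushforward A snd q v = (\<lambda>h. 0)"
    proof (rule metric_nondegenerate[OF pushforward_tangent[OF v]])
      fix w assume w: "w \<in> TS (snd q)"
      have "gM q v (lift_vector q w) = 0" using z lift_vector_tangent[OF w qI(1)] by blast
      then show "gF (snd q) (pushforward A snd q v) w = 0"
        unfolding warped_lift_vector_right[OF qI(1) w] using f_pos[OF qI(1)] by simp
    qed
    then show "pushforward A snd q v = pushforward A snd q (\<lambda>h. 0)" by (simp add: pushforward_def)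
  qed
next
  fix W X Y assume "open W" "W \<subseteq> carrier_of M" "X \<in> M.VF W" "Y \<in> M.VF W"
  then show "smooth_fun_on M W (\<lambda>q. gM q (X q) (Y q))" by (rule warped_metric_smooth)
qed

end

locale warped_levi_civita = warped_product A I gF nabF f
  for A :: "('a::{t2_space, second_countable_topology}, 'e::euclidean_space) chart set"
    and I and gF and nabF and f +
  fixes nab :: "(real \<times> 'a) connection"
  assumes warped_levi_civita: "levi_civita M gM nab"
begin

sublocale M: levi_civita_manifold M gM nab
  by unfold_locales (rule warped_pseudo_riemannian, rule warped_levi_civita)

abbreviation H :: "real \<Rightarrow> real" where "H \<equiv> \<lambda>t. deriv f t / f t"

end

text \<open>All computations take place over \<open>I \<times> W\<close>, where \<open>W\<close>
  carries an orthonormal fibre frame. The frame provides finitely many lifts against which a vector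
  on the product can be tested.\<close>

locale framed_warped_product = warped_levi_civita A I gF nabF f nab
  for A :: "('a::{t2_space, second_countable_topology}, 'e::euclidean_space) chart set"
    and I and gF and nabF and f and nab +
  fixes W E \<epsilon>
  assumes W: "open W" "W \<subseteq> carrier_of A" and E: "orthonormal_on W DIM('e) E \<epsilon>"
begin

lemma MW: "open (I \<times> W)" "I \<times> W \<subseteq> carrier_of M"
  using product_open[OF W(1)] product_subset[OF W(2)] .

lemma in_MW: "q \<in> I \<times> W \<Longrightarrow> q \<in> carrier_of M" "q \<in> I \<times> W \<Longrightarrow> fst q \<in> I" "q \<in> I \<times> W \<Longrightarrow> snd q \<in> W"
  using MW(2) by auto

lemma D_field: "D \<in> M.VF (I \<times> W)"
  by (rule ddt_vector_field[OF MW(2)])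

lemma lift_field: "X \<in> VF W \<Longrightarrow> lift X \<in> M.VF (I \<times> W)"
  using lift_vector_field W by blast

lemmas M_tangent = M.vector_field_tangent[OF D_field] M.vector_field_tangent[OF lift_field]

lemma metric_D_right: "q \<in> I \<times> W \<Longrightarrow> v \<in> M.TS q \<Longrightarrow> gM q v (D q) = - v fst"
  by (rule warped_ddt_right[OF in_MW(1)])

lemma metric_lift_right:
  assumes "q \<in> I \<times> W" "X \<in> VF W"
  shows "gM q v (lift X q) = (f (fst q))\<^sup>2 * gF (snd q) (pushforward A snd q v) (X (snd q))"
  unfolding lift_def
  by (rule warped_lift_vector_right[OF in_MW(2)[OF assms(1)] vector_field_tangent[OF assms(2) in_MW(3)[OF assms(1)]]])

lemma metric_DD: "q \<in> I \<times> W \<Longrightarrow> gM q (D q) (D q) = - 1"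
  by (simp add: metric_D_right M_tangent ddt_fst in_MW)

lemma metric_lift_D: "q \<in> I \<times> W \<Longrightarrow> X \<in> VF W \<Longrightarrow> gM q (lift X q) (D q) = 0"
  by (simp add: metric_D_right M_tangent lift_fst[OF W])

lemma metric_D_lift: "q \<in> I \<times> W \<Longrightarrow> X \<in> VF W \<Longrightarrow> gM q (D q) (lift X q) = 0"
  using M.metric_sym[OF M_tangent] metric_lift_D by simp

lemma metric_lift_lift:
  "q \<in> I \<times> W \<Longrightarrow> X \<in> VF W \<Longrightarrow> Y \<in> VF W \<Longrightarrow>
    gM q (lift X q) (lift Y q) = (f (fst q))\<^sup>2 * gF (snd q) (X (snd q)) (Y (snd q))"
  by (simp add: metric_lift_right lift_pushforward[OF W])

text \<open>The Koszul formula yields only inner products. Pairing with \<open>D\<close> recovers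
  the component along the base up to sign, and pairing with the lifted frame recovers the fibre
  component up to the nonzero factor \<open>f\<close> squared.\<close>

lemma M_tangent_eqI:
  assumes q: "q \<in> I \<times> W" and v: "v \<in> M.TS q" "w \<in> M.TS q"
    and eq: "gM q v (D q) = gM q w (D q)"
      "\<And>i. i < DIM('e) \<Longrightarrow> gM q v (lift (E i) q) = gM q w (lift (E i) q)"
  shows "v = w"
proof (rule product_tangent_eqI[OF v])
  show "v fst = w fst" using eq(1) metric_D_right[OF q] v by simp
  have "f (fst q) \<noteq> 0" using f_pos[OF in_MW(2)[OF q]] by simp
  then show "pushforward A snd q v = pushforward A snd q w"
    using eq(2) metric_lift_right[OF q orthonormal_onD(1)[OF E]]
    by (intro orthonormal_eqI[OF orthonormal_onD(2)[OF E in_MW(3)[OF q]] pushforward_tangent[OF v(1)] pushforward_tangent[OF v(2)]])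
      simp
qed

section \<open>Brackets of the base field and of lifts\<close>

lemma bracket_pushforward:
  assumes h: "smooth_near A (snd q) h" and q: "q \<in> I \<times> W"
  shows "pushforward A snd q (lie_bracket M X Y q) h =
    X q (\<lambda>r. Y r (\<lambda>r. h (snd r))) - Y q (\<lambda>r. X r (\<lambda>r. h (snd r)))"
  using smooth_near_snd[OF h in_MW(2)[OF q]] by (simp add: pushforward_smooth[OF h] lie_bracket_def)

text \<open>Each field applied to the coordinate \<open>fst\<close> gives a function constant on
  \<open>I \<times> W\<close>, and the other field kills it.\<close>

lemma bracket_fst:
  assumes q: "q \<in> I \<times> W" and X: "X \<in> M.VF (I \<times> W)" "\<And>r. r \<in> I \<times> W \<Longrightarrow> X r fst = a"
    and Y: "Y \<in> M.VF (I \<times> W)" "\<And>r. r \<in> I \<times> W \<Longrightarrow> Y r fst = b"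
  shows "lie_bracket M X Y q fst = 0"
proof -
  note t = M.vector_field_tangent[OF _ q]
  have "smooth_near M q fst"
    using smooth_near_fst[OF smooth_on_bounded_linear[OF bounded_linear_ident] in_MW(1)[OF q]] by simp
  moreover have "X q (\<lambda>r. Y r fst) = X q (\<lambda>r. b)"
    by (rule M.tangent_cong[OF t[OF X(1)] MW(1) q Y(2)])
  moreover have "Y q (\<lambda>r. X r fst) = Y q (\<lambda>r. a)"
    by (rule M.tangent_cong[OF t[OF Y(1)] MW(1) q X(2)])
  ultimately show ?thesis
    by (simp add: lie_bracket_def M.tangent_const[OF t[OF X(1)]] M.tangent_const[OF t[OF Y(1)]])
qed

text \<open>A lift acts on a function of \<open>snd\<close> like the fibre field only at points
  where the function is smooth, that is near \<open>q\<close>; being tangent, \<open>v\<close> sees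
  no more than that.\<close>

lemma lift_snd_comp_cong:
  assumes q: "q \<in> I \<times> W" and v: "v \<in> M.TS q" and X: "X \<in> VF W"
    and h: "smooth_near A (snd q) h"
  shows "v (\<lambda>r. lift X r (\<lambda>r. h (snd r))) = v (\<lambda>r. X (snd r) h)"
proof -
  obtain V where V: "open V" "snd q \<in> V" "V \<subseteq> carrier_of A" "smooth_fun_on A V h"
    using h by (rule smooth_nearE)
  show ?thesis
  proof (rule M.tangent_cong[OF v])
    show "open (I \<times> (V \<inter> W))" using product_open V(1) W(1) by blast
    show "q \<in> I \<times> (V \<inter> W)" using q V by auto
    show "lift X r (\<lambda>r. h (snd r)) = X (snd r) h" if "r \<in> I \<times> (V \<inter> W)" for r
      using that smooth_nearI[OF V(4,1) _ V(3)] by (intro lift_snd_comp[OF W X]) auto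
  qed
qed

lemma bracket_D_lift:
  assumes q: "q \<in> I \<times> W" and X: "X \<in> VF W"
  shows "lie_bracket M D (lift X) q = (\<lambda>h. 0)"
proof (rule product_tangent_eqI)
  show "lie_bracket M D (lift X) q \<in> M.TS q"
    by (rule M.vector_field_tangent[OF M.levi_civita_bracket_closed[OF MW D_field lift_field[OF X]] q])
  show "(\<lambda>h. 0) \<in> M.TS q" by (rule M.tangent_zero[OF in_MW(1)[OF q]])
  show "lie_bracket M D (lift X) q fst = 0"
    by (rule bracket_fst[OF q D_field _ lift_field[OF X]]) (auto simp: ddt_fst in_MW lift_fst[OF W X])
  show "pushforward A snd q (lie_bracket M D (lift X) q) = pushforward A snd q (\<lambda>h. 0)"
  proof
    fix h
    show "pushforward A snd q (lie_bracket M D (lift X) q) h = pushforward A snd q (\<lambda>h. 0) h"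
    proof (cases "smooth_near A (snd q) h")
      case True
      show ?thesis
        unfolding bracket_pushforward[OF True q] lift_snd_comp_cong[OF q M_tangent(1)[OF q] X True] ddt_snd_comp[of _ h]
          ddt_snd_comp[of q "\<lambda>p. X p h"]
        using M.tangent_const[OF M_tangent(2)[OF X q]] by (simp add: pushforward_def)
    qed (simp add: pushforward_def)
  qed
qed

lemma bracket_lift_lift:
  assumes q: "q \<in> I \<times> W" and X: "X \<in> VF W" and Y: "Y \<in> VF W"
  shows "lie_bracket M (lift X) (lift Y) q = lift (lie_bracket A X Y) q"
proof (rule product_tangent_eqI)
  note b = levi_civita_bracket_closed[OF W X Y]
  have p: "snd q \<in> W" using in_MW(3)[OF q] .
  show "lie_bracket M (lift X) (lift Y) q \<in> M.TS q"
    by (rule M.vector_field_tangent[OF M.levi_civita_bracket_closed[OF MW lift_field[OF X] lift_field[OF Y]] q])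
  show "lift (lie_bracket A X Y) q \<in> M.TS q" by (rule M_tangent(2)[OF b q])
  show "lie_bracket M (lift X) (lift Y) q fst = lift (lie_bracket A X Y) q fst"
    unfolding lift_fst[OF W b q]
    by (rule bracket_fst[OF q lift_field[OF X] _ lift_field[OF Y]]) (auto simp: lift_fst[OF W X] lift_fst[OF W Y])
  show "pushforward A snd q (lie_bracket M (lift X) (lift Y) q) = pushforward A snd q (lift (lie_bracket A X Y) q)"
    unfolding lift_pushforward[OF W b q]
  proof
    fix h
    show "pushforward A snd q (lie_bracket M (lift X) (lift Y) q) h = lie_bracket A X Y (snd q) h"
    proof (cases "smooth_near A (snd q) h")
      case True
      show ?thesis
        unfolding bracket_pushforward[OF True q] lift_snd_comp_cong[OF q M_tangent(2)[OF X q] Y True]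
          lift_snd_comp_cong[OF q M_tangent(2)[OF Y q] X True]
          lift_snd_comp[OF W X q vector_field_smooth_near[OF Y W(1) p True]]
          lift_snd_comp[OF W Y q vector_field_smooth_near[OF X W(1) p True]]
        using True by (simp add: lie_bracket_def)
    qed (simp add: pushforward_def lie_bracket_def)
  qed
qed

lemma bracket_lift_D:
  assumes "q \<in> I \<times> W" "X \<in> VF W"
  shows "lie_bracket M (lift X) D q = (\<lambda>h. 0)"
  unfolding M.lie_bracket_antisym[OF MW, of "lift X" D] vf_scale_def bracket_D_lift[OF assms] by simp

lemma bracket_D_D: "lie_bracket M D D q = (\<lambda>h. 0)"
  by (simp add: lie_bracket_def fun_eq_iff)

section \<open>Derivatives of metric products in the Koszul formula\<close>

lemma f2_smooth: "smooth_on I (\<lambda>t. (f t)\<^sup>2)"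
  unfolding power2_eq_square by (intro smooth_on_mult I_open f_smooth)

lemma f_deriv: "t \<in> I \<Longrightarrow> (f has_real_derivative deriv f t) (at t)"
  using smooth_on_imp_differentiable[OF f_smooth] by (simp add: DERIV_deriv_iff_real_differentiable)

lemma deriv_f2: "t \<in> I \<Longrightarrow> deriv (\<lambda>t. (f t)\<^sup>2) t = 2 * f t * deriv f t"
  by (rule DERIV_imp_deriv) (auto intro!: derivative_eq_intros f_deriv)

lemma metric_near:
  "X \<in> VF W \<Longrightarrow> Y \<in> VF W \<Longrightarrow> p \<in> W \<Longrightarrow> smooth_near A p (\<lambda>p. gF p (X p) (Y p))"
  using smooth_nearI[OF metric_smooth[OF W] W(1) _ W(2)] by blast

context
  fixes q v assumes q: "q \<in> I \<times> W" and v: "v \<in> M.TS q"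
begin

lemma koszul_DD: "v (\<lambda>r. gM r (D r) (D r)) = 0"
proof -
  have "v (\<lambda>r. gM r (D r) (D r)) = v (\<lambda>r. - 1)"
    by (rule M.tangent_cong[OF v MW(1) q metric_DD])
  then show ?thesis by (simp add: M.tangent_const[OF v])
qed

lemma koszul_D_lift:
  assumes X: "X \<in> VF W"
  shows "v (\<lambda>r. gM r (D r) (lift X r)) = 0" "v (\<lambda>r. gM r (lift X r) (D r)) = 0"
proof -
  have "v (\<lambda>r. gM r (D r) (lift X r)) = v (\<lambda>r. 0)" "v (\<lambda>r. gM r (lift X r) (D r)) = v (\<lambda>r. 0)"
    by (rule M.tangent_cong[OF v MW(1) q metric_D_lift[OF _ X]], assumption,
        rule M.tangent_cong[OF v MW(1) q metric_lift_D[OF _ X]], assumption)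
  then show "v (\<lambda>r. gM r (D r) (lift X r)) = 0" "v (\<lambda>r. gM r (lift X r) (D r)) = 0"
    by (simp_all add: M.tangent_const[OF v])
qed

lemma koszul_lift_lift:
  assumes X: "X \<in> VF W" and Y: "Y \<in> VF W"
  shows "v (\<lambda>r. gM r (lift X r) (lift Y r)) =
    v (\<lambda>r. (f (fst r))\<^sup>2 * (\<lambda>p. gF p (X p) (Y p)) (snd r))"
  by (rule M.tangent_cong[OF v MW(1) q]) (simp add: metric_lift_lift[OF _ X Y])

end

lemma D_metric_lift:
  assumes q: "q \<in> I \<times> W" and X: "X \<in> VF W" and Y: "Y \<in> VF W"
  shows "D q (\<lambda>r. gM r (lift X r) (lift Y r)) = 2 * f (fst q) * deriv f (fst q) * gF (snd q) (X (snd q)) (Y (snd q))"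
  unfolding koszul_lift_lift[OF q M_tangent(1)[OF q] X Y]
    ddt_mult_comp[OF f2_smooth in_MW(1)[OF q] metric_near[OF X Y in_MW(3)[OF q]]]
    deriv_f2[OF in_MW(2)[OF q]] ..

lemma lift_metric_lift:
  assumes q: "q \<in> I \<times> W" and X: "X \<in> VF W" and Y: "Y \<in> VF W" and Z: "Z \<in> VF W"
  shows "lift Z q (\<lambda>r. gM r (lift X r) (lift Y r)) = (f (fst q))\<^sup>2 * Z (snd q) (\<lambda>p. gF p (X p) (Y p))"
  unfolding koszul_lift_lift[OF q M_tangent(2)[OF Z q] X Y]
  by (rule lift_mult_comp[OF W Z f2_smooth q metric_near[OF X Y in_MW(3)[OF q]]])

lemma metric_M_zero: "q \<in> I \<times> W \<Longrightarrow> w \<in> M.TS q \<Longrightarrow> gM q (\<lambda>h. 0) w = 0"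
  using M.metric_zero_left by blast

lemma nab_field:
  "X \<in> M.VF (I \<times> W) \<Longrightarrow> Y \<in> M.VF (I \<times> W) \<Longrightarrow> q \<in> I \<times> W \<Longrightarrow> nab X Y q \<in> M.TS q"
  using M.vector_field_tangent[OF M.levi_civita_closed[OF MW]] by blast

section \<open>Levi-Civita derivatives of the base field and of lifts\<close>

lemma nab_D_D:
  assumes q: "q \<in> I \<times> W"
  shows "nab D D q = (\<lambda>h. 0)"
proof (rule M_tangent_eqI[OF q nab_field[OF D_field D_field q] M.tangent_zero[OF in_MW(1)[OF q]]])
  note t = M_tangent(1)[OF q]
  show "gM q (nab D D q) (D q) = gM q (\<lambda>h. 0) (D q)"
    using M.koszul[OF MW D_field D_field D_field q]
    by (simp add: koszul_DD[OF q t] bracket_D_D metric_M_zero[OF q t])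
  fix i assume "i < DIM('e)"
  then have i: "E i \<in> VF W" by (rule orthonormal_onD(1)[OF E])
  show "gM q (nab D D q) (lift (E i) q) = gM q (\<lambda>h. 0) (lift (E i) q)"
    using M.koszul[OF MW D_field D_field lift_field[OF i] q]
    by (simp add: koszul_DD[OF q M_tangent(2)[OF i q]] koszul_D_lift[OF q t i] bracket_D_D bracket_D_lift[OF q i]
        metric_M_zero[OF q t] metric_M_zero[OF q M_tangent(2)[OF i q]])
qed

text \<open>Paired with a lift, the only surviving Koszul term is the \<open>D\<close>-derivative of
  \<open>f\<close> squared times the fibre product; it equals twice \<open>H\<close> times the
  warped product of the two lifts.\<close>

lemma nab_D_lift:
  assumes q: "q \<in> I \<times> W" and X: "X \<in> VF W"
  shows "nab D (lift X) q = (\<lambda>h. H (fst q) * lift X q h)"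
proof (rule M_tangent_eqI[OF q nab_field[OF D_field lift_field[OF X] q]])
  note t = M_tangent(1)[OF q]
  note lX = M_tangent(2)[OF X q]
  show "(\<lambda>h. H (fst q) * lift X q h) \<in> M.TS q"
    using M.tangent_lincomb[OF lX lX, of "H (fst q)" 0] by simp
  show "gM q (nab D (lift X) q) (D q) = gM q (\<lambda>h. H (fst q) * lift X q h) (D q)"
    unfolding M.metric_scale_left[OF lX t] metric_lift_D[OF q X]
    using M.koszul[OF MW D_field lift_field[OF X] D_field q]
    by (simp add: koszul_DD[OF q lX] koszul_D_lift[OF q t X] bracket_D_D bracket_D_lift[OF q X] bracket_lift_D[OF q X]
        metric_M_zero[OF q t] metric_M_zero[OF q lX])
  fix i assume "i < DIM('e)"
  then have i: "E i \<in> VF W" by (rule orthonormal_onD(1)[OF E])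
  note lE = M_tangent(2)[OF i q]
  show "gM q (nab D (lift X) q) (lift (E i) q) = gM q (\<lambda>h. H (fst q) * lift X q h) (lift (E i) q)"
    unfolding M.metric_scale_left[OF lX lE] metric_lift_lift[OF q X i]
    using M.koszul[OF MW D_field lift_field[OF X] lift_field[OF i] q] f_pos[OF in_MW(2)[OF q]]
    by (simp add: D_metric_lift[OF q X i] koszul_D_lift[OF q lX i] koszul_D_lift[OF q lE X]
        bracket_D_lift[OF q X] bracket_D_lift[OF q i] bracket_lift_lift[OF q X i]
        metric_lift_D[OF q levi_civita_bracket_closed[OF W X i]]
        metric_M_zero[OF q lX] metric_M_zero[OF q lE] power2_eq_square)
qed

lemma nab_lift_D:
  assumes q: "q \<in> I \<times> W" and X: "X \<in> VF W"
  shows "nab (lift X) D q = (\<lambda>h. H (fst q) * lift X q h)"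
  using M.torsion_free(1)[OF MW D_field lift_field[OF X] q]
  unfolding bracket_D_lift[OF q X] nab_D_lift[OF q X] by (simp add: fun_eq_iff)

lemma nab_lift_lift:
  assumes q: "q \<in> I \<times> W" and X: "X \<in> VF W" and Y: "Y \<in> VF W"
  shows "nab (lift X) (lift Y) q = (\<lambda>h. 1 * lift (nabF X Y) q h
    + (f (fst q) * deriv f (fst q) * gF (snd q) (X (snd q)) (Y (snd q))) * D q h)"
proof (rule M_tangent_eqI[OF q nab_field[OF lift_field[OF X] lift_field[OF Y] q]])
  note t = M_tangent(1)[OF q]
  note lX = M_tangent(2)[OF X q] and lY = M_tangent(2)[OF Y q]
  note n = levi_civita_closed[OF W X Y]
  note ln = M_tangent(2)[OF n q]
  show "(\<lambda>h. 1 * lift (nabF X Y) q h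
    + (f (fst q) * deriv f (fst q) * gF (snd q) (X (snd q)) (Y (snd q))) * D q h) \<in> M.TS q"
    by (rule M.tangent_lincomb[OF ln t])
  \<comment> \<open>The Koszul formula gives minus half the \<open>D\<close>-derivative of the
    product of the lifts; as \<open>D\<close> has square -1, its coefficient comes out with a plus
    sign.\<close>
  show "gM q (nab (lift X) (lift Y) q) (D q) = gM q (\<lambda>h. 1 * lift (nabF X Y) q h
    + (f (fst q) * deriv f (fst q) * gF (snd q) (X (snd q)) (Y (snd q))) * D q h) (D q)"
    unfolding M.metric_lincomb_left[OF ln t t] metric_lift_D[OF q n] metric_DD[OF q]
    using M.koszul[OF MW lift_field[OF X] lift_field[OF Y] D_field q]
    by (simp add: D_metric_lift[OF q X Y] koszul_D_lift[OF q lX Y] koszul_D_lift[OF q lY X]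
        bracket_lift_D[OF q X] bracket_lift_D[OF q Y] bracket_lift_lift[OF q X Y]
        metric_lift_D[OF q levi_civita_bracket_closed[OF W X Y]]
        metric_M_zero[OF q lX] metric_M_zero[OF q lY])
  fix i assume "i < DIM('e)"
  then have i: "E i \<in> VF W" by (rule orthonormal_onD(1)[OF E])
  note b = levi_civita_bracket_closed[OF W]
  show "gM q (nab (lift X) (lift Y) q) (lift (E i) q) = gM q (\<lambda>h. 1 * lift (nabF X Y) q h
    + (f (fst q) * deriv f (fst q) * gF (snd q) (X (snd q)) (Y (snd q))) * D q h) (lift (E i) q)"
    unfolding M.metric_lincomb_left[OF ln t M_tangent(2)[OF i q]] metric_lift_lift[OF q n i] metric_D_lift[OF q i]
  proof -
    \<comment> \<open>Derivatives along lifts and brackets of lifts all live on the fibre, so the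
      right side is \<open>f\<close> squared times the Koszul expression of the fibre.\<close>
    have "2 * gM q (nab (lift X) (lift Y) q) (lift (E i) q) =
      (f (fst q))\<^sup>2 * (2 * gF (snd q) (nabF X Y (snd q)) (E i (snd q)))"
      unfolding M.koszul[OF MW lift_field[OF X] lift_field[OF Y] lift_field[OF i] q]
        koszul[OF W X Y i in_MW(3)[OF q]] bracket_lift_lift[OF q X Y] bracket_lift_lift[OF q X i] bracket_lift_lift[OF q Y i]
        lift_metric_lift[OF q Y i X] lift_metric_lift[OF q X i Y] lift_metric_lift[OF q X Y i]
        metric_lift_lift[OF q b[OF X Y] i] metric_lift_lift[OF q b[OF X i] Y] metric_lift_lift[OF q b[OF Y i] X]
      by (simp only: algebra_simps)
    then show "gM q (nab (lift X) (lift Y) q) (lift (E i) q) =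
      1 * ((f (fst q))\<^sup>2 * gF (snd q) (nabF X Y (snd q)) (E i (snd q))) +
      f (fst q) * deriv f (fst q) * gF (snd q) (X (snd q)) (Y (snd q)) * 0" by simp
  qed
qed

end

section \<open>The quarter-symmetric connection\<close>

context connection_manifold
begin

lemma metric_curvature:
  assumes W: "open W" "W \<subseteq> carrier_of A" and X: "X \<in> VF W" and Y: "Y \<in> VF W"
    and Z: "Z \<in> VF W" and p: "p \<in> W" and v: "v \<in> TS p"
  shows "g p (curvature A nab X Y Z p) v =
    g p (nab X (nab Y Z) p) v - g p (nab Y (nab X Z) p) v - g p (nab (lie_bracket A X Y) Z p) v"
proof -
  note t = vector_field_tangent[OF _ p]
  note 1 = t[OF nab_closed[OF W X nab_closed[OF W Y Z]]]
  note 2 = t[OF nab_closed[OF W Y nab_closed[OF W X Z]]]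
  note 3 = t[OF nab_closed[OF W bracket_closed[OF W X Y] Z]]
  have eq: "curvature A nab X Y Z p = (\<lambda>h. 1 * (\<lambda>h. 1 * nab X (nab Y Z) p h + (-1) * nab Y (nab X Z) p h) h
      + (-1) * nab (lie_bracket A X Y) Z p h)"
    by (simp add: curvature_def)
  show ?thesis
    unfolding eq metric_lincomb_left[OF tangent_lincomb[OF 1 2] 3 v] metric_lincomb_left[OF 1 2 v] by simp
qed

text \<open>The two added terms are smooth and linear over functions in both arguments, so they
  respect locality and leave the Leibniz rule to \<open>nab\<close>.\<close>

lemma quarter_symmetric_affine:
  assumes P: "P \<in> VF (carrier_of A)"
  shows "affine_connection A (quarter_symmetric g nab P a b)"
  unfolding affine_connection_def
proof (intro allI impI ballI)
  fix W X Y
  assume W: "open W" "W \<subseteq> carrier_of A" and X: "X \<in> VF W" and Y: "Y \<in> VF W"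
  let ?Q = "quarter_symmetric g nab P a b"
  have PW: "P \<in> VF W" using P W(2) by (rule vector_fields_subset)
  note t = vector_field_tangent
  have Qp: "?Q X Y p = (\<lambda>h. nab X Y p h + a * g p (Y p) (P p) * X p h - b * g p (X p) (Y p) * P p h)" for X Y p
    by (simp add: quarter_symmetric_def)
  have s: "smooth_fun_on A W (\<lambda>p. a * g p (Y p) (P p))" "smooth_fun_on A W (\<lambda>p. - b * g p (X p) (Y p))"
    by (intro smooth_fun_on_mult smooth_fun_on_const metric_smooth W X Y PW)+
  have closed: "?Q X Y \<in> VF W"
  proof (rule vector_fields_cong)
    show "vf_add (vf_add (nab X Y) (vf_scale (\<lambda>p. a * g p (Y p) (P p)) X)) (vf_scale (\<lambda>p. - b * g p (X p) (Y p)) P)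
      \<in> VF W"
      by (intro vf_add_closed vf_scale_closed nab_closed[OF W X Y] s X PW)
  qed (simp add: Qp vf_add_def vf_scale_def fun_eq_iff)
  have cong: "\<forall>p\<in>W. ?Q X' Y' p = ?Q X Y p"
    if "X' \<in> VF W" "Y' \<in> VF W" and eq: "\<forall>p\<in>W. X' p = X p \<and> Y' p = Y p" for X' Y'
  proof
    fix p assume p: "p \<in> W"
    have "nab X' Y' p = nab X Y p"
      by (rule nab_cong[OF W X Y that(1,2) _ _ p]) (use eq in auto)
    then show "?Q X' Y' p = ?Q X Y p" using eq p by (simp add: Qp)
  qed
  have add: "?Q (vf_add X Z) Y p = vf_add (?Q X Y) (?Q Z Y) p \<and> ?Q X (vf_add Y Z) p = vf_add (?Q X Y) (?Q X Z) p"
    if Z: "Z \<in> VF W" and p: "p \<in> W" for Z p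
  proof -
    have "g p (vf_add X Z p) (Y p) = g p (X p) (Y p) + g p (Z p) (Y p)"
      "g p (X p) (vf_add Y Z p) = g p (X p) (Y p) + g p (X p) (Z p)"
      "g p (vf_add Y Z p) (P p) = g p (Y p) (P p) + g p (Z p) (P p)"
      unfolding vf_add_def
      by (rule metric_add_left[OF t[OF X p] t[OF Z p] t[OF Y p]] metric_add_right[OF t[OF Y p] t[OF Z p] t[OF X p]]
          metric_add_left[OF t[OF Y p] t[OF Z p] t[OF PW p]])+
    then show ?thesis
      unfolding Qp nab_add_left[OF W X Z Y p] nab_add_right[OF W X Y Z p]
      by (simp add: vf_add_def Qp fun_eq_iff algebra_simps)
  qed
  have scale: "?Q (vf_scale k X) Y p = vf_scale k (?Q X Y) p \<and>
      ?Q X (vf_scale k Y) p = vf_add (vf_scale (\<lambda>q. X q k) Y) (vf_scale k (?Q X Y)) p"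
    if k: "smooth_fun_on A W k" and p: "p \<in> W" for k p
  proof -
    have "g p (vf_scale k X p) (Y p) = k p * g p (X p) (Y p)" "g p (X p) (vf_scale k Y p) = k p * g p (X p) (Y p)"
      "g p (vf_scale k Y p) (P p) = k p * g p (Y p) (P p)"
      unfolding vf_scale_def
      by (rule metric_scale_left[OF t[OF X p] t[OF Y p]] metric_scale_right[OF t[OF Y p] t[OF X p]]
          metric_scale_left[OF t[OF Y p] t[OF PW p]])+
    then show ?thesis
      unfolding Qp nab_scale_left[OF W X Y k p] nab_scale_right[OF W X Y k p]
      by (simp add: vf_add_def vf_scale_def Qp fun_eq_iff algebra_simps)
  qed
  show "?Q X Y \<in> VF W \<and>
          (\<forall>X'\<in>VF W. \<forall>Y'\<in>VF W.
             (\<forall>p\<in>W. X' p = X p \<and> Y' p = Y p) \<longrightarrow> (\<forall>p\<in>W. ?Q X' Y' p = ?Q X Y p)) \<and>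
          (\<forall>Z\<in>VF W. \<forall>p\<in>W.
             ?Q (vf_add X Z) Y p = vf_add (?Q X Y) (?Q Z Y) p \<and>
             ?Q X (vf_add Y Z) p = vf_add (?Q X Y) (?Q X Z) p) \<and>
          (\<forall>k. smooth_fun_on A W k \<longrightarrow> (\<forall>p\<in>W.
             ?Q (vf_scale k X) Y p = vf_scale k (?Q X Y) p \<and>
             ?Q X (vf_scale k Y) p
               = vf_add (vf_scale (\<lambda>q. X q k) Y) (vf_scale k (?Q X Y)) p))"
    by (intro conjI closed ballI allI impI; (rule cong | rule conjunct1[OF add] | rule conjunct2[OF add]
        | rule conjunct1[OF scale] | rule conjunct2[OF scale] | (rule cong[THEN bspec])); assumption)
qed

end

section \<open>Coefficient functions of the connection and of its curvature\<close>

locale framed_quarter_symmetric = framed_warped_product A I gF nabF f nab W E \<epsilon>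
  for A :: "('a::{t2_space, second_countable_topology}, 'e::euclidean_space) chart set"
    and I and gF and nabF and f and nab and W and E and \<epsilon> +
  fixes lam1 lam2 :: real
begin

abbreviation Q :: "(real \<times> 'a) connection" where "Q \<equiv> quarter_symmetric gM nab D lam1 lam2"

sublocale Q: connection_manifold M gM Q
  by unfold_locales (rule M.quarter_symmetric_affine[OF ddt_vector_field[OF order_refl]], rule M.levi_civita_bracket_closed)

lemma inverse_f_smooth: "smooth_on I (\<lambda>t. 1 / f t)"
proof (rule smooth_on_cong[OF I_open _ smooth_on_compose[OF I_open open_greaterThan _ f_smooth smooth_on_powr[of "-1"]]])
  show "f t powr (- 1) = 1 / f t" if "t \<in> I" for t
    using f_pos[OF that] by (simp add: powr_minus divide_inverse)
qed (use f_pos in auto)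

lemma deriv_f_smooth: "smooth_on I (deriv f)"
  by (rule smooth_on_deriv[OF I_open f_smooth])

lemma deriv_f_deriv: "t \<in> I \<Longrightarrow> (deriv f has_real_derivative deriv (deriv f) t) (at t)"
  using smooth_on_imp_differentiable[OF deriv_f_smooth] by (simp add: DERIV_deriv_iff_real_differentiable)

text \<open>Coefficient of \<open>gF X Y\<close> along \<open>D\<close> in
  \<open>Q (lift X) (lift Y)\<close>: the Levi-Civita part gives \<open>f\<close> times its
  derivative, the \<open>lam2\<close> term subtracts from it. It equals \<open>f\<close> squared
  times \<open>H - lam2\<close>.\<close>

definition c :: "real \<Rightarrow> real" where "c t = f t * deriv f t - lam2 * (f t)\<^sup>2"

text \<open>The factor in R(D, X)D = \<kappa> X for lifted \<open>X\<close>. It is the derivative of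
  \<open>H - lam1\<close> plus \<open>(H - lam1) * (H - (lam2 - lam1))\<close>, where the square of
  \<open>H\<close> cancels.\<close>

definition \<kappa> :: "real \<Rightarrow> real" where
  "\<kappa> t = deriv (deriv f) t / f t - lam2 * H t + lam1 * lam2 - lam1\<^sup>2"

text \<open>The coefficient of \<open>gF X X\<close> along \<open>D\<close> in R(X, D)X for lifted
  \<open>X\<close>.\<close>

definition \<xi> :: "real \<Rightarrow> real" where "\<xi> t = H t * c t - deriv c t - c t * (lam2 - lam1)"

text \<open>The shift serves two cases: \<open>a = 0\<close> for \<open>Q D (lift X)\<close> and
  \<open>a = lam1\<close> for \<open>Q (lift X) D\<close>. This is why the former is later written
  with \<open>H - 0\<close>.\<close>

lemma H_smooth: "smooth_on I (\<lambda>t. H t - a)"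
proof -
  have "smooth_on I (\<lambda>t. deriv f t * (1 / f t) + - a)"
    by (intro smooth_on_add smooth_on_mult smooth_on_const I_open deriv_f_smooth inverse_f_smooth)
  then show ?thesis by simp
qed

lemma deriv_H: "t \<in> I \<Longrightarrow> deriv (\<lambda>t. H t - a) t = deriv (deriv f) t / f t - (H t)\<^sup>2"
proof (rule DERIV_imp_deriv)
  assume t: "t \<in> I"
  have "f t \<noteq> 0" using f_pos[OF t] by simp
  then have "((\<lambda>t. H t - a) has_real_derivative (deriv (deriv f) t * f t - deriv f t * deriv f t) / (f t * f t) - 0) (at t)"
    by (intro DERIV_diff DERIV_divide DERIV_const deriv_f_deriv f_deriv t)
  then show "((\<lambda>t. H t - a) has_real_derivative deriv (deriv f) t / f t - (H t)\<^sup>2) (at t)"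
    using \<open>f t \<noteq> 0\<close> by (simp add: diff_divide_distrib power2_eq_square)
qed

lemma c_smooth: "smooth_on I c"
proof -
  have "smooth_on I (\<lambda>t. f t * deriv f t + (- lam2) * (f t * f t))"
    by (intro smooth_on_add smooth_on_mult smooth_on_const I_open deriv_f_smooth f_smooth)
  then show ?thesis by (rule smooth_on_cong[OF I_open, rotated]) (simp add: c_def power2_eq_square)
qed

lemma deriv_c: "t \<in> I \<Longrightarrow> deriv c t = (deriv f t)\<^sup>2 + f t * deriv (deriv f) t - 2 * lam2 * f t * deriv f t"
proof (rule DERIV_imp_deriv)
  assume t: "t \<in> I"
  have "((\<lambda>t. f t * deriv f t - lam2 * (f t * f t)) has_real_derivative
      (deriv f t * deriv f t + deriv (deriv f) t * f t) - (deriv f t * f t + deriv f t * f t) * lam2) (at t)"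
    by (auto intro!: derivative_eq_intros f_deriv[OF t] deriv_f_deriv[OF t] simp: algebra_simps)
  then show "(c has_real_derivative (deriv f t)\<^sup>2 + f t * deriv (deriv f) t - 2 * lam2 * f t * deriv f t) (at t)"
    unfolding c_def[abs_def] by (simp add: power2_eq_square algebra_simps)
qed

section \<open>First and second derivatives under the quarter-symmetric connection\<close>

lemmas Q_closed = Q.nab_closed[OF MW]

lemma smooth_fst_MW: "smooth_on I k \<Longrightarrow> smooth_fun_on M (I \<times> W) (\<lambda>q. k (fst q))"
  using smooth_fun_on_subset[OF smooth_fun_on_fst MW(2)] .

text \<open>Since \<open>D\<close> has square -1, the 1-form of the connection takes the value -1 on
  \<open>D\<close>. This reverses the signs of \<open>lam1\<close> and \<open>lam2\<close> here, and
  that of \<open>lam1\<close> in \<open>Q (lift X) D\<close>.\<close>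

lemma Q_D_D:
  assumes q: "q \<in> I \<times> W"
  shows "Q D D q = vf_scale (\<lambda>r. lam2 - lam1) D q"
  unfolding quarter_symmetric_def nab_D_D[OF q] metric_DD[OF q]
  by (simp add: vf_scale_def fun_eq_iff algebra_simps)

lemma Q_D_lift:
  assumes q: "q \<in> I \<times> W" and X: "X \<in> VF W"
  shows "Q D (lift X) q = vf_scale (\<lambda>r. H (fst r) - 0) (lift X) q"
  unfolding quarter_symmetric_def nab_D_lift[OF q X] metric_lift_D[OF q X] metric_D_lift[OF q X]
  by (simp add: vf_scale_def)

lemma Q_lift_D:
  assumes q: "q \<in> I \<times> W" and X: "X \<in> VF W"
  shows "Q (lift X) D q = vf_scale (\<lambda>r. H (fst r) - lam1) (lift X) q"
  unfolding quarter_symmetric_def nab_lift_D[OF q X] metric_lift_D[OF q X] metric_DD[OF q]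
  by (simp add: vf_scale_def fun_eq_iff algebra_simps)

text \<open>Kept as an unreduced product of a function of \<open>fst r\<close> and a function of
  \<open>snd r\<close>, the shape to which the product rules for \<open>D\<close> and for lifts
  apply.\<close>

definition s :: "'a vector_field \<Rightarrow> 'a vector_field \<Rightarrow> real \<times> 'a \<Rightarrow> real" where
  "s X Y = (\<lambda>r. c (fst r) * (\<lambda>p. gF p (X p) (Y p)) (snd r))"

lemma s_smooth:
  assumes "X \<in> VF W" "Y \<in> VF W"
  shows "smooth_fun_on M (I \<times> W) (s X Y)"
  unfolding s_def
  by (intro M.smooth_fun_on_mult[OF MW(1)] smooth_fst_MW[OF c_smooth] smooth_fun_on_snd[OF W(1) metric_smooth[OF W assms]])

lemma Q_lift_lift:
  assumes q: "q \<in> I \<times> W" and X: "X \<in> VF W" and Y: "Y \<in> VF W"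
  shows "Q (lift X) (lift Y) q = vf_add (lift (nabF X Y)) (vf_scale (s X Y) D) q"
  unfolding quarter_symmetric_def nab_lift_lift[OF q X Y] metric_lift_D[OF q Y] metric_lift_lift[OF q X Y]
  by (simp add: vf_scale_def vf_add_def s_def c_def fun_eq_iff algebra_simps)

text \<open>The brackets in question vanish on \<open>I \<times> W\<close> but are arbitrary
  elsewhere. Locality replaces them by \<open>0\<close> times \<open>D\<close>, and linearity
  finishes.\<close>

lemma Q_zero:
  assumes q: "q \<in> I \<times> W" and B: "B \<in> M.VF (I \<times> W)" "\<And>r. r \<in> I \<times> W \<Longrightarrow> B r = (\<lambda>h. 0)"
    and Y: "Y \<in> M.VF (I \<times> W)"
  shows "Q B Y q = (\<lambda>h. 0)"
proof -
  have "Q B Y q = Q (vf_scale (\<lambda>r. 0) D) Y q"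
    by (rule Q.nab_cong[OF MW M.vf_scale_closed[OF D_field smooth_fun_on_const] Y B(1) Y _ refl q])
      (simp add: B(2) vf_scale_def)
  also have "\<dots> = vf_scale (\<lambda>r. 0) (Q D Y) q"
    by (rule Q.nab_scale_left[OF MW D_field Y smooth_fun_on_const q])
  finally show ?thesis by (simp add: vf_scale_def)
qed

text \<open>Inner derivatives are known only on \<open>I \<times> W\<close>; when they have the form
  function times field there, locality followed by the Leibniz rule gives the second
  derivative.\<close>

lemma Q_second_scale:
  assumes q: "q \<in> I \<times> W" and X: "X \<in> M.VF (I \<times> W)" and Y: "Y \<in> M.VF (I \<times> W)"
    and Z: "Z \<in> M.VF (I \<times> W)" and k: "smooth_fun_on M (I \<times> W) k"
    and eq: "\<And>r. r \<in> I \<times> W \<Longrightarrow> Y r = vf_scale k Z r"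
  shows "Q X Y q = (\<lambda>h. X q k * Z q h + k q * Q X Z q h)"
proof -
  have "Q X Y q = Q X (vf_scale k Z) q"
    by (rule Q.nab_cong[OF MW X M.vf_scale_closed[OF Z k] X Y refl eq q])
  also have "\<dots> = vf_add (vf_scale (\<lambda>q. X q k) Z) (vf_scale k (Q X Z)) q"
    by (rule Q.nab_scale_right[OF MW X Z k q])
  finally show ?thesis by (simp add: vf_add_def vf_scale_def)
qed

lemma Q_second_lift:
  assumes q: "q \<in> I \<times> W" and X: "X \<in> M.VF (I \<times> W)"
    and Y: "Y \<in> VF W" and Z: "Z \<in> VF W"
  shows "Q X (Q (lift Y) (lift Z)) q =
    (\<lambda>h. Q X (lift (nabF Y Z)) q h + (X q (s Y Z) * D q h + s Y Z q * Q X D q h))"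
proof -
  note n = lift_field[OF levi_civita_closed[OF W Y Z]]
  note sD = M.vf_scale_closed[OF D_field s_smooth[OF Y Z]]
  have "Q X (Q (lift Y) (lift Z)) q = Q X (vf_add (lift (nabF Y Z)) (vf_scale (s Y Z) D)) q"
    by (rule Q.nab_cong[OF MW X M.vf_add_closed[OF n sD] X Q_closed[OF lift_field[OF Y] lift_field[OF Z]] refl Q_lift_lift[OF _ Y Z] q])
  also have "\<dots> = vf_add (Q X (lift (nabF Y Z))) (Q X (vf_scale (s Y Z) D)) q"
    by (rule Q.nab_add_right[OF MW X n sD q])
  finally show ?thesis
    by (simp add: vf_add_def Q_second_scale[OF q X sD D_field s_smooth[OF Y Z] refl])
qed

section \<open>Curvature on the base field and on lifts\<close>

lemma curvature_D_lift_D: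
  assumes q: "q \<in> I \<times> W" and X: "X \<in> VF W"
  shows "curvature M Q D (lift X) D q = (\<lambda>h. \<kappa> (fst q) * lift X q h)"
proof -
  have t: "fst q \<in> I" using in_MW(2)[OF q] .
  have 1: "Q D (Q (lift X) D) q = (\<lambda>h. D q (\<lambda>r. H (fst r) - lam1) * lift X q h + (H (fst q) - lam1) * Q D (lift X) q h)"
    by (rule Q_second_scale[OF q D_field Q_closed[OF lift_field[OF X] D_field] lift_field[OF X] smooth_fst_MW[OF H_smooth] Q_lift_D[OF _ X]])
  have 2: "Q (lift X) (Q D D) q = (\<lambda>h. lift X q (\<lambda>r. lam2 - lam1) * D q h + (lam2 - lam1) * Q (lift X) D q h)"
    by (rule Q_second_scale[OF q lift_field[OF X] Q_closed[OF D_field D_field] D_field smooth_fun_on_const Q_D_D])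
  have 3: "Q (lie_bracket M D (lift X)) D q = (\<lambda>h. 0)"
    by (rule Q_zero[OF q M.levi_civita_bracket_closed[OF MW D_field lift_field[OF X]] bracket_D_lift[OF _ X] D_field])
  have 4: "D q (\<lambda>r. H (fst r) - lam1) = deriv (deriv f) (fst q) / f (fst q) - (H (fst q))\<^sup>2"
    unfolding ddt_fst_comp[OF H_smooth in_MW(1)[OF q]] by (rule deriv_H[OF t])
  show ?thesis
    unfolding curvature_def 1 2 3 4 Q_D_lift[OF q X] Q_lift_D[OF q X] M.tangent_const[OF M_tangent(2)[OF X q]]
    by (simp add: vf_scale_def \<kappa>_def fun_eq_iff algebra_simps power2_eq_square
        add_divide_distrib diff_divide_distrib)
qed

text \<open>Both second derivatives contain \<open>H\<close> times the lift of
  \<open>nabF X X\<close>; these fibre parts cancel and only a multiple of \<open>D\<close>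
  remains.\<close>

lemma curvature_lift_D_lift:
  assumes q: "q \<in> I \<times> W" and X: "X \<in> VF W"
  shows "curvature M Q (lift X) D (lift X) q = (\<lambda>h. (\<xi> (fst q) * gF (snd q) (X (snd q)) (X (snd q))) * D q h)"
proof -
  have 1: "Q (lift X) (Q D (lift X)) q =
      (\<lambda>h. lift X q (\<lambda>r. H (fst r) - 0) * lift X q h + (H (fst q) - 0) * Q (lift X) (lift X) q h)"
    by (rule Q_second_scale[OF q lift_field[OF X] Q_closed[OF D_field lift_field[OF X]] lift_field[OF X] smooth_fst_MW[OF H_smooth] Q_D_lift[OF _ X]])
  have 2: "lift X q (\<lambda>r. H (fst r) - 0) = 0"
    using lift_fst_comp[OF W X q, of "\<lambda>t. H t - 0"] .
  have 3: "Q (lie_bracket M (lift X) D) (lift X) q = (\<lambda>h. 0)"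
    by (rule Q_zero[OF q M.levi_civita_bracket_closed[OF MW lift_field[OF X] D_field] bracket_lift_D[OF _ X] lift_field[OF X]])
  have 4: "D q (s X X) = deriv c (fst q) * gF (snd q) (X (snd q)) (X (snd q))"
    unfolding s_def by (rule ddt_mult_comp[OF c_smooth in_MW(1)[OF q] metric_near[OF X X in_MW(3)[OF q]]])
  show ?thesis
    unfolding curvature_def 1 2 3 Q_second_lift[OF q D_field X X] 4 Q_D_lift[OF q levi_civita_closed[OF W X X]]
      Q_lift_lift[OF q X X] Q_D_D[OF q]
    by (simp add: vf_scale_def vf_add_def \<xi>_def s_def fun_eq_iff algebra_simps)
qed

lemma metric_lift_comb:
  assumes q: "q \<in> I \<times> W" and X: "X \<in> VF W" and Y: "Y \<in> VF W" and V: "V \<in> VF W"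
  shows "gM q (\<lambda>h. lift X q h + a * lift Y q h + b * D q h) (lift V q) =
    (f (fst q))\<^sup>2 * (gF (snd q) (X (snd q)) (V (snd q)) + a * gF (snd q) (Y (snd q)) (V (snd q)))"
proof -
  have "gM q (\<lambda>h. 1 * (\<lambda>h. 1 * lift X q h + a * lift Y q h) h + b * D q h) (lift V q) =
    (f (fst q))\<^sup>2 * (gF (snd q) (X (snd q)) (V (snd q)) + a * gF (snd q) (Y (snd q)) (V (snd q)))"
    unfolding M.metric_lincomb_left[OF M.tangent_lincomb[OF M_tangent(2)[OF X q] M_tangent(2)[OF Y q]] M_tangent(1)[OF q] M_tangent(2)[OF V q]]
      M.metric_lincomb_left[OF M_tangent(2)[OF X q] M_tangent(2)[OF Y q] M_tangent(2)[OF V q]]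
      metric_lift_lift[OF q X V] metric_lift_lift[OF q Y V] metric_D_lift[OF q V]
    by (simp add: algebra_simps)
  then show ?thesis by simp
qed

text \<open>Pairing with a lift removes the \<open>D\<close> component, so its coefficient may stay
  unevaluated. The term beyond the fibre derivative arises from differentiating \<open>D\<close>
  along \<open>lift X\<close>, which returns \<open>H - lam1\<close> times
  \<open>lift X\<close>.\<close>

lemma metric_Q_second:
  assumes q: "q \<in> I \<times> W" and X: "X \<in> VF W" and Y: "Y \<in> VF W"
    and Z: "Z \<in> VF W" and V: "V \<in> VF W"
  shows "gM q (Q (lift X) (Q (lift Y) (lift Z)) q) (lift V q) =
    (f (fst q))\<^sup>2 * (gF (snd q) (nabF X (nabF Y Z) (snd q)) (V (snd q)) +
      (c (fst q) * (H (fst q) - lam1) * gF (snd q) (Y (snd q)) (Z (snd q))) * gF (snd q) (X (snd q)) (V (snd q)))"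
proof -
  note n = levi_civita_closed[OF W Y Z]
  have eq: "Q (lift X) (Q (lift Y) (lift Z)) q = (\<lambda>h. lift (nabF X (nabF Y Z)) q h
      + (c (fst q) * (H (fst q) - lam1) * gF (snd q) (Y (snd q)) (Z (snd q))) * lift X q h
      + (s X (nabF Y Z) q + lift X q (s Y Z)) * D q h)"
    unfolding Q_second_lift[OF q lift_field[OF X] Y Z] Q_lift_lift[OF q X n] Q_lift_D[OF q X]
    by (simp add: vf_add_def vf_scale_def s_def[of Y Z] fun_eq_iff algebra_simps)
  show ?thesis
    unfolding eq by (rule metric_lift_comb[OF q levi_civita_closed[OF W X n] X V])
qed

text \<open>A Gauss-type equation: the correction to the fibre curvature has the form of a
  constant-curvature tensor, with factor \<open>c * (H - lam1)\<close>, that is \<open>f\<close>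
  squared times \<open>(H - lam1) * (H - lam2)\<close>. The derivatives of \<open>s\<close> point
  along \<open>D\<close> and do not enter.\<close>

lemma metric_curvature_lift:
  assumes q: "q \<in> I \<times> W" and X: "X \<in> VF W" and Y: "Y \<in> VF W"
    and Z: "Z \<in> VF W" and V: "V \<in> VF W"
  shows "gM q (curvature M Q (lift X) (lift Y) (lift Z) q) (lift V q) =
    (f (fst q))\<^sup>2 * (gF (snd q) (curvature A nabF X Y Z (snd q)) (V (snd q)) + c (fst q) * (H (fst q) - lam1) *
      (gF (snd q) (Y (snd q)) (Z (snd q)) * gF (snd q) (X (snd q)) (V (snd q))
       - gF (snd q) (X (snd q)) (Z (snd q)) * gF (snd q) (Y (snd q)) (V (snd q))))"
proof -
  note b = levi_civita_bracket_closed[OF W X Y]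
  note p = in_MW(3)[OF q]
  have "Q (lie_bracket M (lift X) (lift Y)) (lift Z) q = Q (lift (lie_bracket A X Y)) (lift Z) q"
    by (rule Q.nab_cong[OF MW lift_field[OF b] lift_field[OF Z] M.levi_civita_bracket_closed[OF MW lift_field[OF X] lift_field[OF Y]] lift_field[OF Z]
          bracket_lift_lift[OF _ X Y] refl q])
  also have "\<dots> = (\<lambda>h. lift (nabF (lie_bracket A X Y) Z) q h + 0 * lift X q h + s (lie_bracket A X Y) Z q * D q h)"
    unfolding Q_lift_lift[OF q b Z] by (simp add: vf_add_def vf_scale_def)
  finally have 1: "gM q (Q (lie_bracket M (lift X) (lift Y)) (lift Z) q) (lift V q) =
      (f (fst q))\<^sup>2 * gF (snd q) (nabF (lie_bracket A X Y) Z (snd q)) (V (snd q))"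
    using metric_lift_comb[OF q levi_civita_closed[OF W b Z] X V, of 0] by simp
  show ?thesis
    unfolding Q.metric_curvature[OF MW lift_field[OF X] lift_field[OF Y] lift_field[OF Z] q M_tangent(2)[OF V q]]
      metric_Q_second[OF q X Y Z V] metric_Q_second[OF q Y X Z V] 1
      metric_curvature[OF W X Y Z p vector_field_tangent[OF V p]]
    by (simp add: algebra_simps)
qed

text \<open>The base direction takes index 0 and shifts the fibre indices by one, matching the
  dimension \<open>Suc DIM('e)\<close> of the product. Dividing a lift by \<open>f\<close> undoes
  the factor that the warped metric puts on it.\<close>

definition product_frame :: "nat \<Rightarrow> (real \<times> 'a) vector_field" where
  "product_frame i = (case i of 0 \<Rightarrow> D | Suc j \<Rightarrow> vf_scale (\<lambda>q. 1 / f (fst q)) (lift (E j)))"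

definition product_sign :: "nat \<Rightarrow> real" where
  "product_sign i = (case i of 0 \<Rightarrow> - 1 | Suc j \<Rightarrow> \<epsilon> j)"

lemma product_frame_simps:
  "product_frame 0 = D" "product_frame (Suc j) = vf_scale (\<lambda>q. 1 / f (fst q)) (lift (E j))"
  "product_sign 0 = - 1" "product_sign (Suc j) = \<epsilon> j"
  by (simp_all add: product_frame_def product_sign_def)

lemmas EV = orthonormal_onD(1)[OF E]

lemma r_smooth: "smooth_fun_on M (I \<times> W) (\<lambda>q. 1 / f (fst q))"
  by (rule smooth_fst_MW[OF inverse_f_smooth])

lemma scaled_field: "j < DIM('e) \<Longrightarrow> vf_scale (\<lambda>q. 1 / f (fst q)) (lift (E j)) \<in> M.VF (I \<times> W)"
  by (rule M.vf_scale_closed[OF lift_field[OF EV] r_smooth])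

lemma metric_frame:
  assumes q: "q \<in> I \<times> W" and "i < DIM('e)" "j < DIM('e)"
  shows "gF (snd q) (E i (snd q)) (E j (snd q)) = (if i = j then \<epsilon> i else 0)"
  by (rule orthonormal_atD(4)[OF orthonormal_onD(2)[OF E in_MW(3)[OF q]] assms(2,3)])

lemma product_frame_orthonormal: "M.orthonormal_on (I \<times> W) DIM(real \<times> 'e) product_frame product_sign"
  unfolding M.orthonormal_on_def
proof (intro conjI allI impI ballI)
  fix i assume i: "i < DIM(real \<times> 'e)"
  show field: "product_frame i \<in> M.VF (I \<times> W)"
    using i D_field scaled_field by (cases i) (auto simp: product_frame_simps)
  show sign: "product_sign i \<in> {-1, 1}"
    using i E by (cases i) (auto simp: product_frame_simps orthonormal_on_def)
next
  fix q assume q: "q \<in> I \<times> W"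
  have fq: "f (fst q) \<noteq> 0" using f_pos[OF in_MW(2)[OF q]] by simp
  have mixed: "gM q (vf_scale (\<lambda>q. 1 / f (fst q)) (lift (E j)) q) v = 1 / f (fst q) * gM q (lift (E j) q) v"
    if "j < DIM('e)" "v \<in> M.TS q" for j v
    unfolding vf_scale_def by (rule M.metric_scale_left[OF M_tangent(2)[OF EV[OF that(1)] q] that(2)])
  have mixed': "gM q v (vf_scale (\<lambda>q. 1 / f (fst q)) (lift (E j)) q) = 1 / f (fst q) * gM q v (lift (E j) q)"
    if "j < DIM('e)" "v \<in> M.TS q" for j v
    unfolding vf_scale_def by (rule M.metric_scale_right[OF M_tangent(2)[OF EV[OF that(1)] q] that(2)])
  note St = M.vector_field_tangent[OF scaled_field q]
  show "M.orthonormal_at q DIM(real \<times> 'e) (\<lambda>i. product_frame i q) product_sign"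
    unfolding M.orthonormal_at_def
  proof (intro conjI allI impI)
    fix i assume i: "i < DIM(real \<times> 'e)"
    show "product_frame i q \<in> M.TS q"
      using i M_tangent(1)[OF q] St by (cases i) (auto simp: product_frame_simps)
    show "product_sign i \<in> {-1, 1}"
      using i E by (cases i) (auto simp: product_frame_simps orthonormal_on_def)
    fix j assume j: "j < DIM(real \<times> 'e)"
    show "gM q (product_frame i q) (product_frame j q) = (if i = j then product_sign i else 0)"
    proof (cases i; cases j)
      fix i' j' assume ij: "i = Suc i'" "j = Suc j'"
      then have l: "i' < DIM('e)" "j' < DIM('e)" using i j by auto
      show ?thesis
        unfolding ij product_frame_simps mixed[OF l(1) St[OF l(2)]] mixed'[OF l(2) M_tangent(2)[OF EV[OF l(1)] q]]
          metric_lift_lift[OF q EV[OF l(1)] EV[OF l(2)]] metric_frame[OF q l]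
        using fq by (simp add: power2_eq_square)
    next
      fix i' assume ij: "i = Suc i'" "j = 0"
      then have l: "i' < DIM('e)" using i by auto
      show ?thesis
        unfolding ij product_frame_simps mixed[OF l M_tangent(1)[OF q]] metric_lift_D[OF q EV[OF l]] by simp
    next
      fix j' assume ij: "i = 0" "j = Suc j'"
      then have l: "j' < DIM('e)" using j by auto
      show ?thesis
        unfolding ij product_frame_simps mixed'[OF l M_tangent(1)[OF q]] metric_D_lift[OF q EV[OF l]] by simp
    next
      assume "i = 0" "j = 0"
      then show ?thesis by (simp add: product_frame_simps metric_DD[OF q])
    qed
  qed
qed

text \<open>Tensoriality pulls the normalizing factor out of slots 1 and 3; its companion does so
  for slots 2 and 4. Curvature then has to be known only on unscaled lifts, which commute with
  \<open>D\<close>.\<close>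

lemma metric_Q_curvature_scale_outer:
  assumes q: "q \<in> I \<times> W" and X: "X \<in> M.VF (I \<times> W)" and Y: "Y \<in> M.VF (I \<times> W)"
    and k: "smooth_fun_on M (I \<times> W) k"
  shows "gM q (curvature M Q (vf_scale k X) Y (vf_scale k X) q) (Y q) =
    (k q)\<^sup>2 * gM q (curvature M Q X Y X q) (Y q)"
proof -
  note kX = M.vf_scale_closed[OF X k]
  have "gM q (curvature M Q (vf_scale k X) Y (vf_scale k X) q) (Y q) =
      k q * gM q (curvature M Q X Y (vf_scale k X) q) (Y q)"
    by (rule M.tensorialD(2)[OF Q.tensorial_curvature(1)[OF MW X Y q kX Y] X k])
  also have "gM q (curvature M Q X Y (vf_scale k X) q) (Y q) = k q * gM q (curvature M Q X Y X q) (Y q)"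
    by (rule M.tensorialD(2)[OF Q.tensorial_curvature(2)[OF MW X Y q X Y] X k])
  finally show ?thesis by (simp add: power2_eq_square)
qed

lemma metric_Q_curvature_scale_inner:
  assumes q: "q \<in> I \<times> W" and X: "X \<in> M.VF (I \<times> W)" and Y: "Y \<in> M.VF (I \<times> W)"
    and k: "smooth_fun_on M (I \<times> W) k"
  shows "gM q (curvature M Q X (vf_scale k Y) X q) (vf_scale k Y q) =
    (k q)\<^sup>2 * gM q (curvature M Q X Y X q) (Y q)"
proof -
  note kY = M.vf_scale_closed[OF Y k]
  have "gM q (curvature M Q X (vf_scale k Y) X q) (vf_scale k Y q) =
      k q * gM q (curvature M Q X Y X q) (vf_scale k Y q)"
    by (rule M.tensorialD(2)[OF Q.tensorial_curvature(4)[OF MW X Y q X kY] Y k])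
  also have "gM q (curvature M Q X Y X q) (vf_scale k Y q) = k q * gM q (curvature M Q X Y X q) (Y q)"
    by (rule M.tensorialD(2)[OF Q.tensorial_curvature(3)[OF MW X Y q X Y] Y k])
  finally show ?thesis by (simp add: power2_eq_square)
qed

section \<open>Curvature components in the adapted frame\<close>

lemma curvature_frame_D_D:
  assumes q: "q \<in> I \<times> W"
  shows "gM q (curvature M Q D D D q) (D q) = 0"
proof -
  have "Q (lie_bracket M D D) D q = (\<lambda>h. 0)"
    by (rule Q_zero[OF q M.levi_civita_bracket_closed[OF MW D_field D_field] bracket_D_D D_field])
  then have "curvature M Q D D D q = (\<lambda>h. 0)" by (simp add: curvature_def)
  then show ?thesis by (simp add: metric_M_zero[OF q M_tangent(1)[OF q]])
qed

lemma curvature_frame_D_lift: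
  assumes q: "q \<in> I \<times> W" and j: "j < DIM('e)"
  shows "gM q (curvature M Q D (product_frame (Suc j)) D q) (product_frame (Suc j) q) = \<kappa> (fst q) * \<epsilon> j"
proof -
  have fq: "f (fst q) \<noteq> 0" using f_pos[OF in_MW(2)[OF q]] by simp
  show ?thesis
    unfolding product_frame_simps metric_Q_curvature_scale_inner[OF q D_field lift_field[OF EV[OF j]] r_smooth]
      curvature_D_lift_D[OF q EV[OF j]] M.metric_scale_left[OF M_tangent(2)[OF EV[OF j] q] M_tangent(2)[OF EV[OF j] q]]
      metric_lift_lift[OF q EV[OF j] EV[OF j]] metric_frame[OF q j j]
    using fq by (simp add: power2_eq_square)
qed

lemma curvature_frame_lift_D:
  assumes q: "q \<in> I \<times> W" and j: "j < DIM('e)"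
  shows "gM q (curvature M Q (product_frame (Suc j)) D (product_frame (Suc j)) q) (D q) =
    - \<xi> (fst q) * \<epsilon> j / (f (fst q))\<^sup>2"
  unfolding product_frame_simps metric_Q_curvature_scale_outer[OF q lift_field[OF EV[OF j]] D_field r_smooth]
    curvature_lift_D_lift[OF q EV[OF j]] M.metric_scale_left[OF M_tangent(1)[OF q] M_tangent(1)[OF q]]
    metric_DD[OF q] metric_frame[OF q j j]
  by (simp add: power2_eq_square)

lemma curvature_frame_lift_lift:
  assumes q: "q \<in> I \<times> W" and i: "i < DIM('e)" and j: "j < DIM('e)"
  shows "gM q (curvature M Q (product_frame (Suc i)) (product_frame (Suc j)) (product_frame (Suc i)) q) (product_frame (Suc j) q) =
    (gF (snd q) (curvature A nabF (E i) (E j) (E i) (snd q)) (E j (snd q))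
      + c (fst q) * (H (fst q) - lam1) * ((if i = j then 1 else 0) - \<epsilon> i * \<epsilon> j)) / (f (fst q))\<^sup>2"
proof -
  have fq: "f (fst q) \<noteq> 0" using f_pos[OF in_MW(2)[OF q]] by simp
  have "(if j = i then \<epsilon> j else 0) * (if i = j then \<epsilon> i else 0) = (if i = j then 1 else 0)"
    using orthonormal_onD(3)[OF E i] by auto
  then show ?thesis
    unfolding product_frame_simps metric_Q_curvature_scale_inner[OF q scaled_field[OF i] lift_field[OF EV[OF j]] r_smooth]
      metric_Q_curvature_scale_outer[OF q lift_field[OF EV[OF i]] lift_field[OF EV[OF j]] r_smooth]
      metric_curvature_lift[OF q EV[OF i] EV[OF j] EV[OF i] EV[OF j]]
      metric_frame[OF q i i] metric_frame[OF q i j] metric_frame[OF q j i] metric_frame[OF q j j]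
    using fq by (simp add: power2_eq_square)
qed

text \<open>The double sum over the product frame splits into base-base (zero), base-fibre,
  fibre-base and fibre-fibre blocks. In the last one the correction contributes \<open>1\<close> for
  each diagonal pair and \<open>-1\<close> for each pair, hence \<open>l - l * l\<close> with
  \<open>l = DIM('e)\<close>.\<close>

lemma scalar_curvature_product_frame:
  assumes q: "q \<in> I \<times> W"
  shows "scalar_curvature M gM Q q = scalar_curvature A gF nabF (snd q) / (f (fst q))\<^sup>2
    - real DIM('e) * \<kappa> (fst q) + real DIM('e) * \<xi> (fst q) / (f (fst q))\<^sup>2
    + c (fst q) * (H (fst q) - lam1) * (real DIM('e) - (real DIM('e))\<^sup>2) / (f (fst q))\<^sup>2"
proof -
  let ?l = "DIM('e)" and ?t = "fst q"
  let ?K = "\<lambda>i k. gM q (curvature M Q (product_frame i) (product_frame k) (product_frame i) q) (product_frame k q)"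
  let ?KF = "\<lambda>i k. gF (snd q) (curvature A nabF (E i) (E k) (E i) (snd q)) (E k (snd q))"
  let ?m = "c ?t * (H ?t - lam1)"
  have \<epsilon>: "\<epsilon> i * \<epsilon> i = 1" if "i < ?l" for i using orthonormal_onD(3)[OF E that] .
  have "scalar_curvature M gM Q q = Q.scalar_sum q product_frame product_sign"
    by (rule Q.scalar_curvature_frame[OF MW q product_frame_orthonormal])
  also have "\<dots> = (\<Sum>i<Suc ?l. product_sign i * (\<Sum>k<Suc ?l. product_sign k * ?K i k))"
    by (simp add: Q.scalar_sum_def)
  \<comment> \<open>Index 0 is split off both sums; the minus signs are the sign -1 of the base
    direction.\<close>
  also have "\<dots> = - (\<Sum>k<?l. \<epsilon> k * ?K 0 (Suc k)) + (\<Sum>i<?l. \<epsilon> i * (- ?K (Suc i) 0 + (\<Sum>k<?l. \<epsilon> k * ?K (Suc i) (Suc k))))"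
    unfolding sum.lessThan_Suc_shift product_frame_simps(1,3,4) curvature_frame_D_D[OF q] by simp
  finally have expand: "scalar_curvature M gM Q q = - (\<Sum>k<?l. \<epsilon> k * ?K 0 (Suc k))
      + (\<Sum>i<?l. \<epsilon> i * (- ?K (Suc i) 0 + (\<Sum>k<?l. \<epsilon> k * ?K (Suc i) (Suc k))))" .
  have first: "(\<Sum>k<?l. \<epsilon> k * ?K 0 (Suc k)) = (\<Sum>k<?l. \<kappa> ?t)"
    using curvature_frame_D_lift[OF q] \<epsilon> unfolding product_frame_simps(1) by (intro sum.cong) (auto simp: mult_ac)
  have "(\<Sum>i<?l. \<epsilon> i * (- ?K (Suc i) 0 + (\<Sum>k<?l. \<epsilon> k * ?K (Suc i) (Suc k)))) =
      (\<Sum>i<?l. \<xi> ?t / (f ?t)\<^sup>2 + (\<epsilon> i * (\<Sum>k<?l. \<epsilon> k * ?KF i k) + ?m * (1 - real ?l)) / (f ?t)\<^sup>2)"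
  proof (rule sum.cong[OF refl])
    fix i assume "i \<in> {..<?l}"
    then have i: "i < ?l" by simp
    have 0: "\<epsilon> i * ?K (Suc i) 0 = - \<xi> ?t / (f ?t)\<^sup>2"
      using curvature_frame_lift_D[OF q i] \<epsilon>[OF i] unfolding product_frame_simps(1) by (simp add: mult_ac)
    have "(\<Sum>k<?l. \<epsilon> k * ?K (Suc i) (Suc k)) =
        (\<Sum>k<?l. (\<epsilon> k * ?KF i k + (?m * (if i = k then \<epsilon> k else 0) - ?m * \<epsilon> i)) / (f ?t)\<^sup>2)"
    proof (rule sum.cong[OF refl])
      fix k assume "k \<in> {..<?l}"
      then have k: "k < ?l" by simp
      have "\<epsilon> k * ((if i = k then 1 else 0) - \<epsilon> i * \<epsilon> k) = (if i = k then \<epsilon> k else 0) - \<epsilon> i * (\<epsilon> k * \<epsilon> k)"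
        by (simp add: algebra_simps)
      then have e: "\<epsilon> k * ((if i = k then 1 else 0) - \<epsilon> i * \<epsilon> k) = (if i = k then \<epsilon> k else 0) - \<epsilon> i"
        unfolding \<epsilon>[OF k] by simp
      have "\<epsilon> k * ?K (Suc i) (Suc k) =
          (\<epsilon> k * ?KF i k + ?m * (\<epsilon> k * ((if i = k then 1 else 0) - \<epsilon> i * \<epsilon> k))) / (f ?t)\<^sup>2"
        unfolding curvature_frame_lift_lift[OF q i k] by (simp only: times_divide_eq_right distrib_left mult_ac)
      then show "\<epsilon> k * ?K (Suc i) (Suc k) =
          (\<epsilon> k * ?KF i k + (?m * (if i = k then \<epsilon> k else 0) - ?m * \<epsilon> i)) / (f ?t)\<^sup>2"
        unfolding e right_diff_distrib[of ?m "if i = k then \<epsilon> k else 0"] .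
    qed
    \<comment> \<open>The diagonal term contributes only at \<open>k = i\<close>, the remaining
      correction is the same for every \<open>k\<close>.\<close>
    also have "\<dots> = ((\<Sum>k<?l. \<epsilon> k * ?KF i k) + (?m * \<epsilon> i - real ?l * (?m * \<epsilon> i))) / (f ?t)\<^sup>2"
      using i by (simp add: sum_divide_distrib[symmetric] sum.distrib sum_subtractf sum_distrib_left[symmetric])
    finally have inner: "(\<Sum>k<?l. \<epsilon> k * ?K (Suc i) (Suc k)) =
        ((\<Sum>k<?l. \<epsilon> k * ?KF i k) + (?m * \<epsilon> i - real ?l * (?m * \<epsilon> i))) / (f ?t)\<^sup>2" .
    have "\<epsilon> i * (\<Sum>k<?l. \<epsilon> k * ?K (Suc i) (Suc k)) =
        (\<epsilon> i * (\<Sum>k<?l. \<epsilon> k * ?KF i k) + ?m * (1 - real ?l) * (\<epsilon> i * \<epsilon> i)) / (f ?t)\<^sup>2"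
      unfolding inner by (simp add: algebra_simps add_divide_distrib diff_divide_distrib)
    then show "\<epsilon> i * (- ?K (Suc i) 0 + (\<Sum>k<?l. \<epsilon> k * ?K (Suc i) (Suc k))) =
      \<xi> ?t / (f ?t)\<^sup>2 + (\<epsilon> i * (\<Sum>k<?l. \<epsilon> k * ?KF i k) + ?m * (1 - real ?l)) / (f ?t)\<^sup>2"
      using 0 unfolding \<epsilon>[OF i] by (simp add: right_diff_distrib[of "\<epsilon> i"])
  qed
  also have "\<dots> = real ?l * \<xi> ?t / (f ?t)\<^sup>2 + ((\<Sum>i<?l. \<epsilon> i * (\<Sum>k<?l. \<epsilon> k * ?KF i k)) + real ?l * (?m * (1 - real ?l))) / (f ?t)\<^sup>2"
    by (simp add: sum.distrib sum_divide_distrib[symmetric])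
  finally have second: "(\<Sum>i<?l. \<epsilon> i * (- ?K (Suc i) 0 + (\<Sum>k<?l. \<epsilon> k * ?K (Suc i) (Suc k)))) =
    real ?l * \<xi> ?t / (f ?t)\<^sup>2 + ((\<Sum>i<?l. \<epsilon> i * (\<Sum>k<?l. \<epsilon> k * ?KF i k)) + real ?l * (?m * (1 - real ?l))) / (f ?t)\<^sup>2" .
  have third: "(\<Sum>i<?l. \<epsilon> i * (\<Sum>k<?l. \<epsilon> k * ?KF i k)) = scalar_curvature A gF nabF (snd q)"
    unfolding scalar_curvature_frame[OF W in_MW(3)[OF q] E] scalar_sum_def ..
  show ?thesis
    unfolding expand first second third
    by (simp add: add_divide_distrib diff_divide_distrib power2_eq_square algebra_simps)
qed

end

section \<open>Scalar curvature of the warped product at a point\<close>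

context warped_levi_civita
begin

lemma scalar_curvature_warped:
  assumes t: "t \<in> I" and p: "p \<in> carrier_of A"
  shows "scalar_curvature M gM (quarter_symmetric gM nab D lam1 lam2) (t, p) = scalar_curvature A gF nabF p / (f t)\<^sup>2
    - 2 * real DIM('e) * (deriv (deriv f) t / f t)
    - real DIM('e) * (real DIM('e) - 1) * ((deriv f t)\<^sup>2 / (f t)\<^sup>2)
    + (real DIM('e))\<^sup>2 * (lam1 + lam2) * (deriv f t / f t)
    + real DIM('e) * (lam1\<^sup>2 + lam2\<^sup>2 - (real DIM('e) + 1) * lam1 * lam2)"
proof -
  obtain W E \<epsilon> where nbhd: "open W" "p \<in> W" "W \<subseteq> carrier_of A" and frame: "orthonormal_on W DIM('e) E \<epsilon>"
    using p by (rule local_frameE)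
  interpret framed_quarter_symmetric A I gF nabF f nab W E \<epsilon> lam1 lam2
    by unfold_locales (fact nbhd frame)+
  have ft: "f t \<noteq> 0" using f_pos[OF t] by simp
  \<comment> \<open>With both derivatives of \<open>f\<close> written as multiples of
    \<open>f\<close>, every power of \<open>f\<close> cancels except in the fibre term, and the
    claim becomes a polynomial identity in \<open>a\<close>, \<open>b\<close>, \<open>lam1\<close>,
    \<open>lam2\<close> and the dimension.\<close>
  define a b where "a = deriv (deriv f) t / f t" and "b = H t"
  have ab: "deriv (deriv f) t = a * f t" "deriv f t = b * f t" using ft by (simp_all add: a_def b_def)
  have "c t / (f t)\<^sup>2 = b - lam2" "\<xi> t / (f t)\<^sup>2 = b * (b - lam2) - (b\<^sup>2 + a - 2 * lam2 * b) - (b - lam2) * (lam2 - lam1)"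
    using ft unfolding \<xi>_def deriv_c[OF t] c_def ab
    by (simp_all add: field_simps power2_eq_square)
  then have cx: "c t = (b - lam2) * (f t)\<^sup>2"
      "\<xi> t = (b * (b - lam2) - (b\<^sup>2 + a - 2 * lam2 * b) - (b - lam2) * (lam2 - lam1)) * (f t)\<^sup>2"
    using ft by (simp_all add: field_simps)
  have q: "(t, p) \<in> I \<times> W" using t nbhd(2) by simp
  show ?thesis
    unfolding scalar_curvature_product_frame[OF q] fst_conv snd_conv cx \<kappa>_def
    unfolding ab using ft
    by (simp add: power2_eq_square) (simp add: algebra_simps)
qed

end

theorem proposition3p17:
  fixes A :: "('a::{t2_space, second_countable_topology}, 'e::euclidean_space) chart set"
    and g\<^sub>F :: "'a metric_tensor"
    and nab\<^sub>F :: "'a connection"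
    and nab :: "(real \<times> 'a) connection"
    and I :: "real set"
    and f :: "real \<Rightarrow> real"
    and lam1 lam2 S :: real
    and l :: nat
  assumes "open I" and "is_interval I" and "I \<noteq> {}"
    and "smooth_manifold A" and "l = DIM('e)"
    and "pseudo_riemannian A g\<^sub>F" and "levi_civita A g\<^sub>F nab\<^sub>F"
    and "smooth_on I f" and "\<forall>t\<in>I. f t > 0"
    and "lam1 \<noteq> 0" and "lam2 \<noteq> 0"
    and "levi_civita (product_atlas I A) (warped_metric A f g\<^sub>F) nab"
  shows "has_constant_scalar_curvature (product_atlas I A) (warped_metric A f g\<^sub>F)
           (quarter_symmetric (warped_metric A f g\<^sub>F) nab (ddt I A) lam1 lam2) S
     \<longleftrightarrow> (\<exists>S\<^sub>F. has_constant_scalar_curvature A g\<^sub>F nab\<^sub>F S\<^sub>F \<and>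
           (\<forall>t\<in>I. S = S\<^sub>F / (f t)\<^sup>2
                 - 2 * real l * (deriv (deriv f) t / f t)
                 - real l * (real l - 1) * ((deriv f t)\<^sup>2 / (f t)\<^sup>2)
                 + (real l)\<^sup>2 * (lam1 + lam2) * (deriv f t / f t)
                 + real l * (lam1\<^sup>2 + lam2\<^sup>2 - (real l + 1) * lam1 * lam2)))"
proof -
  interpret warped_levi_civita A I g\<^sub>F nab\<^sub>F f nab
    by unfold_locales
      (rule assms(1) assms(3) assms(4) assms(6) assms(7) assms(8) assms(12) bspec[OF assms(9)] | assumption)+
  let ?Q = "quarter_symmetric gM nab D lam1 lam2"
  \<comment> \<open>Everything in the formula that is independent of the fibre point, so that the
    variables separate.\<close>
  define \<rho> where "\<rho> t = - 2 * real l * (deriv (deriv f) t / f t)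
                 - real l * (real l - 1) * ((deriv f t)\<^sup>2 / (f t)\<^sup>2)
                 + (real l)\<^sup>2 * (lam1 + lam2) * (deriv f t / f t)
                 + real l * (lam1\<^sup>2 + lam2\<^sup>2 - (real l + 1) * lam1 * lam2)" for t
  have M: "scalar_curvature M gM ?Q (t, p) = scalar_curvature A g\<^sub>F nab\<^sub>F p / (f t)\<^sup>2 + \<rho> t"
    if "t \<in> I" "p \<in> carrier_of A" for t p
    using scalar_curvature_warped[OF that] by (simp add: \<rho>_def assms(5))
  have rhs: "S\<^sub>F / (f t)\<^sup>2 - 2 * real l * (deriv (deriv f) t / f t)
                 - real l * (real l - 1) * ((deriv f t)\<^sup>2 / (f t)\<^sup>2)
                 + (real l)\<^sup>2 * (lam1 + lam2) * (deriv f t / f t)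
                 + real l * (lam1\<^sup>2 + lam2\<^sup>2 - (real l + 1) * lam1 * lam2) = S\<^sub>F / (f t)\<^sup>2 + \<rho> t" for S\<^sub>F t
    by (simp add: \<rho>_def)
  have const_M: "has_constant_scalar_curvature M gM ?Q S \<longleftrightarrow>
      (\<forall>t\<in>I. \<forall>p\<in>carrier_of A. scalar_curvature A g\<^sub>F nab\<^sub>F p / (f t)\<^sup>2 + \<rho> t = S)"
    using M by (auto simp: has_constant_scalar_curvature_def product_carrier)
  obtain t\<^sub>0 where t\<^sub>0: "t\<^sub>0 \<in> I" using assms(3) by auto
  obtain p\<^sub>0 where p\<^sub>0: "p\<^sub>0 \<in> carrier_of A" using assms(4) unfolding smooth_manifold_def by blast
  show ?thesis
    unfolding rhs const_M
  proof
    assume *: "\<forall>t\<in>I. \<forall>p\<in>carrier_of A. scalar_curvature A g\<^sub>F nab\<^sub>F p / (f t)\<^sup>2 + \<rho> t = S"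
    have const: "scalar_curvature A g\<^sub>F nab\<^sub>F p = scalar_curvature A g\<^sub>F nab\<^sub>F p\<^sub>0" if p: "p \<in> carrier_of A" for p
    proof -
      have "scalar_curvature A g\<^sub>F nab\<^sub>F p / (f t\<^sub>0)\<^sup>2 = scalar_curvature A g\<^sub>F nab\<^sub>F p\<^sub>0 / (f t\<^sub>0)\<^sup>2"
        using *[rule_format, OF t\<^sub>0 p] *[rule_format, OF t\<^sub>0 p\<^sub>0] by linarith
      then show ?thesis using f_pos[OF t\<^sub>0] by simp
    qed
    show "\<exists>S\<^sub>F. has_constant_scalar_curvature A g\<^sub>F nab\<^sub>F S\<^sub>F \<and> (\<forall>t\<in>I. S = S\<^sub>F / (f t)\<^sup>2 + \<rho> t)"
    \<comment> \<open>The constant is the curvature at \<open>p\<^sub>0\<close>, a point that exists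
      because carriers of manifolds are nonempty. The identity for all \<open>t\<close> is the
      hypothesis read along the line over this point.\<close>
    proof (intro exI conjI ballI)
      show "has_constant_scalar_curvature A g\<^sub>F nab\<^sub>F (scalar_curvature A g\<^sub>F nab\<^sub>F p\<^sub>0)"
        unfolding has_constant_scalar_curvature_def by (intro ballI const)
      show "S = scalar_curvature A g\<^sub>F nab\<^sub>F p\<^sub>0 / (f t)\<^sup>2 + \<rho> t" if "t \<in> I" for t
        by (rule bspec[OF bspec[OF * that] p\<^sub>0, symmetric])
    qed
  next
    assume "\<exists>S\<^sub>F. has_constant_scalar_curvature A g\<^sub>F nab\<^sub>F S\<^sub>F \<and> (\<forall>t\<in>I. S = S\<^sub>F / (f t)\<^sup>2 + \<rho> t)"
    then obtain S\<^sub>F where c: "\<forall>p\<in>carrier_of A. scalar_curvature A g\<^sub>F nab\<^sub>F p = S\<^sub>F"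
        and e: "\<forall>t\<in>I. S = S\<^sub>F / (f t)\<^sup>2 + \<rho> t"
      unfolding has_constant_scalar_curvature_def by blast
    show "\<forall>t\<in>I. \<forall>p\<in>carrier_of A. scalar_curvature A g\<^sub>F nab\<^sub>F p / (f t)\<^sup>2 + \<rho> t = S"
    proof (intro ballI)
      fix t p assume t: "t \<in> I" and p: "p \<in> carrier_of A"
      show "scalar_curvature A g\<^sub>F nab\<^sub>F p / (f t)\<^sup>2 + \<rho> t = S"
        unfolding bspec[OF c p] by (rule bspec[OF e t, symmetric])
    qed
  qed
qed

end
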